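(* Let $n\ge 1$ be an integer, let $q\in\mathbb{C}^*$ with $|q|<1$, and let $\varepsilon\in\mathbb{C}$ with $0<|\varepsilon|<1$. Suppose that $|a_i|<1$ $(i=1,2)$, $|b_j|<1$ $(j=1,\ldots,4)$ and $|t|<1$, and that the balancing condition $q\varepsilon^{2}=a_1a_2b_1b_2b_3b_4t^{2n-2}$ holds. Then for every $v\in\mathbb{C}^*$, $$ \begin{aligned} &\frac{1}{n!}\int_{\mathbb{T}^{n}} \prod_{i=1}^{n} \bigg[\frac{(\varepsilon z_{i}, -\varepsilon z_{i};q)_{\infty}}{(q\varepsilon z_{i}, -q\varepsilon z_{i};q)_{\infty}} \frac{\theta(t^{n-1}a_{1}a_{2}vz_{i}^{-1}, vz_{i};q)}{\prod_{j=1}^{2}(a_j\varepsilon^{2} z_{i},a_jz_{i}^{-1};q)_{\infty}} \prod_{k=1}^{4}\frac{(qb_{k}^{-1}\varepsilon^{2} z_{i};q)_{\infty}}{(b_{k}z_{i};q)_{\infty}} \bigg]\\ &\qquad\times\prod_{1\le j< k\le n} \frac{(\varepsilon^{2} z_{j}z_{k};q)_{\infty}}{(q\varepsilon^{2} z_{j}z_{k};q)_{\infty}} \frac{(z_{j}/z_{k},z_{k}/z_{j};q)_{\infty}} {(tz_{j}/z_{k},tz_{k}/z_{j};q)_{\infty}} \frac{(qt^{-1}\varepsilon^{2} z_{j}z_{k};q)_{\infty}} {(t\varepsilon^{2} z_{j}z_{k};q)_{\infty}} \,\varpi(z)\\ &\quad = \prod_{i=1}^{n}\frac{(t;q)_{\infty}\prod_{l=1}^{2}\theta(t^{i-1}a_{l}v;q)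 \prod_{1\le j<k\le 4}(qt^{-(i-1)}b_{j}^{-1}b_{k}^{-1}\varepsilon^{2};q)_{\infty}} {(q,t^{i};q)_{\infty}(t^{i-1}a_{1}a_{2}\varepsilon^{2};q)_{\infty}\prod_{j=1}^{2}\prod_{k=1}^{4}(t^{i-1}a_{j}b_{k};q)_{\infty}}. \end{aligned} $$
   Context: Notation: $(u;q)_\infty=\prod_{i=0}^\infty(1-q^iu)$, $(u_1,\ldots,u_m;q)_\infty=(u_1;q)_\infty\cdots(u_m;q)_\infty$, $\theta(u;q)=(u,q/u;q)_\infty$ for $u\in\mathbb{C}^*$, $\theta(u_1,\ldots,u_m;q)=\theta(u_1;q)\cdots\theta(u_m;q)$. Quotients of the form $(u;q)_\infty/(qu;q)_\infty$ are understood as $1-u$. The measure is $\varpi(z)=\frac{1}{(2\pi\sqrt{-1})^n}\frac{dz_1}{z_1}\cdots\frac{dz_n}{z_n}$, and $\mathbb{T}^n=\{(z_1,\ldots,z_n)\in\mathbb{C}^n : |z_i|=1\ (i=1,\ldots,n)\}$ is the $n$-fold product of the unit circle, each traversed in the positive direction. *)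

theory Defs
  imports "HOL-Complex_Analysis.Complex_Analysis"
begin

text \<open>
  For \<open>|q| < 1\<close> the product converges for every \<open>u\<close>, in the sense of \<^const>\<open>has_prod\<close>, which
  admits finitely many zero factors; it is then \<open>0\<close> exactly when some factor vanishes.
\<close>

definition qpoch_inf :: "complex \<Rightarrow> complex \<Rightarrow> complex"
  where "qpoch_inf u q = (\<Prod>i. 1 - q ^ i * u)"

definition qpochs_inf :: "complex list \<Rightarrow> complex \<Rightarrow> complex"
  where "qpochs_inf us q = (\<Prod>u\<leftarrow>us. qpoch_inf u q)"

definition theta :: "complex \<Rightarrow> complex \<Rightarrow> complex"
  where "theta u q = qpochs_inf [u, q / u] q"

definition thetas :: "complex list \<Rightarrow> complex \<Rightarrow> complex"
  where "thetas us q = (\<Prod>u\<leftarrow>us. theta u q)"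

text \<open>
  The integral of \<open>f \<varpi>\<close> over the torus, with
  \<open>\<varpi> = (2 \<pi> \<i>)\<^sup>-\<^sup>n (dz\<^sub>1 / z\<^sub>1) \<dots> (dz\<^sub>n / z\<^sub>n)\<close>, is the integral of its pullback along
  \<open>(s\<^sub>1, \<dots>, s\<^sub>n) \<mapsto> (\<gamma> s\<^sub>1, \<dots>, \<gamma> s\<^sub>n)\<close> from \<open>[0,1]\<^sup>n\<close>, where \<open>\<gamma>\<close> is the positively oriented unit
  circle. Points of the torus are functions of which only the values at \<open>1, \<dots>, n\<close> matter.
\<close>

definition torus_integral :: "nat \<Rightarrow> ((nat \<Rightarrow> complex) \<Rightarrow> complex) \<Rightarrow> complex"
  where "torus_integral n f =
    1 / (2 * of_real pi * \<i>) ^ n *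
    (LINT s : (PiE {1..n} (\<lambda>_. {0..1})) | PiM {1..n} (\<lambda>_. lborel).
       f (\<lambda>i. circlepath 0 1 (s i)) *
       (\<Prod>i=1..n. vector_derivative (circlepath 0 1) (at (s i)) / circlepath 0 1 (s i)))"

end

theory Submission
  imports Defs
begin

text \<open>
  Gustafson's identity, a sum over the sign changes \<open>x\<^sub>i \<mapsto> x\<^sub>i\<^sup>\<plusminus>\<^sup>1\<close>, writes a multiple of the
  integrand as a sum of terms indexed by the subsets \<open>S\<close> of the variables. Moving the variables in
  \<open>S\<close> by the factor \<open>q\<close>, which crosses no poles, turns these terms into those that the identity
  yields for the parameters with \<open>b\<^sub>4\<close> replaced by \<open>q b\<^sub>4\<close> and \<open>\<epsilon>\<^sup>2\<close> by \<open>q \<epsilon>\<^sup>2\<close>. Hence the ratio of the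
  two sides is unchanged when any \<open>b\<^sub>k\<close> is multiplied by \<open>q\<close>, and iteration reduces the theorem to
  \<open>b = 0\<close>.

  The integral at \<open>b = 0\<close> is computed by induction on \<open>n\<close>. The same invariance puts back a parameter
  \<open>b\<^sub>1\<close>, and rescaling the variables makes \<open>a\<^sub>1 = b\<^sub>1 = r\<close>. As \<open>r\<close> tends to \<open>1\<close>, the poles at \<open>r\<close> and
  \<open>1 / r\<close> pinch the contour. A partial fraction expansion confines the pinch to one variable at a time,
  on which the weight acts as a Poisson kernel, and leaves the integral in \<open>n - 1\<close> variables.
\<close>

text \<open>In each inverted variable the Gustafson factors remove the poles at \<open>a1\<close>,
  \<open>a2\<close> and at \<open>t\<close> times the uninverted variables, which are those that a
  shift by \<open>q\<close> might cross; the next poles lie a factor \<open>q\<close> further in.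
  Two instances of the identity, one at \<open>t\<close> and one at 1 / t, then produce the same
  terms before and after the shift, and the balancing condition makes their coefficients agree. That
  condition also serves to eliminate \<epsilon>, so that all formulas extend to
  \<open>b = 0\<close>.

  At \<open>b = 0\<close> no pole outside the circle is left to pinch against, which is why
  \<open>b1\<close> has to return. The integral diverges as \<open>r\<close> tends to 1, and the
  divergence is cancelled by the factor 1 - r^2 that splits off from the q-shifted factorial of
  \<open>a1 * b1\<close>. In the same limit the other variables meet a pole at 1 on their own
  contour, so they are moved to a larger circle beforehand and moved back once the limit has been
  taken.\<close>

section \<open>Infinite q-shifted factorials and theta functions\<close>

locale nome =
  fixes q :: complex
  assumes q_nz: "q \<noteq> 0" and q_less_1: "norm q < 1"
begin

abbreviation P :: "complex \<Rightarrow> complex" where "P u \<equiv> qpoch_inf u q"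
abbreviation Th :: "complex \<Rightarrow> complex" where "Th u \<equiv> theta u q"

lemma P_has_prod: "(\<lambda>i. 1 - q ^ i * u) has_prod P u"
proof -
  have "summable (\<lambda>i. norm ((1 - q ^ i * u) - 1))"
    using q_less_1 by (simp add: norm_mult norm_power summable_mult2)
  then have "convergent_prod (\<lambda>i. 1 - q ^ i * u)"
    by (intro abs_convergent_prod_imp_convergent_prod summable_imp_abs_convergent_prod)
  then show ?thesis
    by (simp add: qpoch_inf_def convergent_prod_has_prod_iff)
qed

lemma P_rec: "P u = (1 - u) * P (q * u)"
proof -
  have "(\<lambda>n. 1 - q ^ Suc n * u) has_prod P (q * u)"
    using P_has_prod[of "q * u"] by (simp add: mult_ac)
  from has_prod_Suc_imp[where f="\<lambda>n. 1 - q ^ n * u", OF this]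
  have "(\<lambda>i. 1 - q ^ i * u) has_prod (P (q * u) * (1 - u))" by simp
  from has_prod_unique2[OF P_has_prod this] show ?thesis by (simp only: mult.commute)
qed

lemma P_0 [simp]: "P 0 = 1"
  by (simp add: qpoch_inf_def)

lemma P_nonzero:
  assumes "norm u < 1"
  shows "P u \<noteq> 0"
proof -
  have "1 - q ^ i * u \<noteq> 0" for i
  proof
    assume "1 - q ^ i * u = 0"
    then have "norm (q ^ i * u) = 1" by (simp add: eq_commute[of 1])
    moreover have "norm (q ^ i * u) \<le> norm u"
      using q_less_1 by (simp add: norm_mult norm_power mult_left_le_one_le power_le_one)
    ultimately show False using assms by simp
  qed
  then show ?thesis
    using has_prod_eq_0_iff[OF P_has_prod[of u]] by auto
qed

lemma norm_q_mult_less: "norm u < 1 \<Longrightarrow> norm (q * u) < 1"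
  using q_less_1 mult_strict_mono[of "norm q" 1 "norm u" 1] by (simp add: norm_mult)

lemma P_1_minus: "norm u < 1 \<Longrightarrow> P u / P (q * u) = 1 - u"
  using P_rec[of u] P_nonzero[of "q * u"] norm_q_mult_less[of u] by simp

lemma P_holomorphic: "P holomorphic_on UNIV"
proof (rule holomorphic_uniform_sequence[where f="\<lambda>N x. \<Prod>n<N. 1 - q ^ n * x"])
  fix x :: complex
  define K where "K = cball x 1"
  have "uniformly_convergent_on K (\<lambda>N x. \<Sum>n<N. norm (- (q ^ n * x)))"
  proof (rule Weierstrass_m_test'_ev)
    show "\<forall>\<^sub>F n in sequentially. \<forall>y\<in>K. norm (norm (- (q ^ n * y))) \<le> norm q ^ n * (norm x + 1)"
    proof (intro always_eventually allI ballI)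
      fix n y assume "y \<in> K"
      then have "norm y \<le> norm x + 1"
        using norm_triangle_ineq2[of y x] by (auto simp: K_def dist_norm norm_minus_commute)
      then show "norm (norm (- (q ^ n * y))) \<le> norm q ^ n * (norm x + 1)"
        by (auto simp: norm_mult norm_power intro!: mult_left_mono)
    qed
    show "summable (\<lambda>n. norm q ^ n * (norm x + 1))"
      using q_less_1 by (intro summable_mult2) simp
  qed
  then have "uniformly_convergent_on K (\<lambda>N x. \<Prod>n<N. 1 + - (q ^ n * x))"
    by (intro uniformly_convergent_on_prod) (auto simp: K_def intro!: continuous_intros)
  then have "uniform_limit K (\<lambda>N x. \<Prod>n<N. 1 - q ^ n * x) (\<lambda>x. lim (\<lambda>N. \<Prod>n<N. 1 - q ^ n * x)) sequentially"
    by (simp add: uniformly_convergent_uniform_limit_iff)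
  moreover have "lim (\<lambda>N. \<Prod>n<N. 1 - q ^ n * y) = P y" for y
    using has_prod_imp_tendsto'[OF P_has_prod[of y]] by (simp add: limI)
  ultimately show "\<exists>d>0. cball x d \<subseteq> UNIV \<and> uniform_limit (cball x d) (\<lambda>N x. \<Prod>n<N. 1 - q ^ n * x) P sequentially"
    by (intro exI[of _ 1]) (simp add: K_def)
qed (auto intro!: holomorphic_intros)

lemma P_holomorphic_compose [holomorphic_intros]:
  "f holomorphic_on A \<Longrightarrow> (\<lambda>x. P (f x)) holomorphic_on A"
  using holomorphic_on_compose_gen[OF _ P_holomorphic, of f A] by (simp add: o_def)

lemma continuous_on_P [continuous_intros]:
  fixes f :: "'a::topological_space \<Rightarrow> complex"
  shows "continuous_on A f \<Longrightarrow> continuous_on A (\<lambda>x. P (f x))"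
  using continuous_on_compose2[OF holomorphic_on_imp_continuous_on[OF P_holomorphic], of A f] by simp

lemma theta_eq: "Th u = P u * P (q / u)"
  by (simp add: theta_def qpochs_inf_def)

lemma continuous_on_theta [continuous_intros]:
  fixes f :: "'a::topological_space \<Rightarrow> complex"
  shows "continuous_on A f \<Longrightarrow> (\<And>x. x \<in> A \<Longrightarrow> f x \<noteq> 0) \<Longrightarrow> continuous_on A (\<lambda>x. Th (f x))"
  unfolding theta_eq by (intro continuous_intros) auto

lemma theta_q_mult:
  assumes "u \<noteq> 0"
  shows "Th (q * u) = - Th u / u"
proof -
  have "P (1 / u) = - ((1 - u) / u) * P (q / u)"
    using P_rec[of "1 / u"] assms by (simp add: diff_divide_distrib)
  then have "Th (q * u) = P (q * u) * (- ((1 - u) / u) * P (q / u))"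
    using q_nz by (simp add: theta_eq)
  also have "\<dots> = - Th u / u"
    by (simp add: theta_eq P_rec[of u])
  finally show ?thesis .
qed

lemma theta_divide_q:
  assumes "u \<noteq> 0"
  shows "Th (u / q) = - (u / q) * Th u"
  using theta_q_mult[of "u / q"] assms q_nz by (simp add: field_simps)

end

text \<open>The predicate \<open>C\<close> stands for continuity or holomorphy on \<open>A\<close>; the integrands need both.\<close>
locale function_class = nome +
  fixes A :: "'b set" and C :: "('b \<Rightarrow> complex) \<Rightarrow> bool"
  assumes const: "C (\<lambda>_. c)"
    and diff: "C f \<Longrightarrow> C g \<Longrightarrow> C (\<lambda>x. f x - g x)"
    and mult: "C f \<Longrightarrow> C g \<Longrightarrow> C (\<lambda>x. f x * g x)"
    and divide: "C f \<Longrightarrow> C g \<Longrightarrow> (\<And>x. x \<in> A \<Longrightarrow> g x \<noteq> 0) \<Longrightarrow> C (\<lambda>x. f x / g x)"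
    and qpoch: "C f \<Longrightarrow> C (\<lambda>x. P (f x))"
begin

lemma prod: "(\<And>i. i \<in> I \<Longrightarrow> C (f i)) \<Longrightarrow> C (\<lambda>x. \<Prod>i\<in>I. f i x)"
  by (induction I rule: infinite_finite_induct) (auto intro: const mult)

lemma theta: "C f \<Longrightarrow> (\<And>x. x \<in> A \<Longrightarrow> f x \<noteq> 0) \<Longrightarrow> C (\<lambda>x. Th (f x))"
  unfolding theta_eq by (intro mult qpoch divide const)

lemmas intros = const diff mult divide qpoch theta

end

context nome begin

lemma continuous_class: "function_class q A (continuous_on A)"
  by unfold_locales (auto intro!: continuous_intros)

lemma holomorphic_class: "function_class q A (\<lambda>f. f holomorphic_on A)"
  by unfold_locales (auto intro!: holomorphic_intros)

end

section \<open>Gustafson's identity for sums over sign changes\<close>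

definition pairs :: "nat set \<Rightarrow> (nat \<times> nat) set"
  where "pairs I = {(j, k). j \<in> I \<and> k \<in> I \<and> j < k}"

lemma finite_pairs [simp]: "finite I \<Longrightarrow> finite (pairs I)"
  by (rule finite_subset[of _ "I \<times> I"]) (auto simp: pairs_def)

lemma pairs_empty [simp]: "pairs {} = {}"
  by (simp add: pairs_def)

text \<open>Pairs are stored in increasing order, so \<open>i\<close> may stand on either side of
  its partner. The map \<open>g\<close> orients these pairs, and symmetry of \<open>f\<close> makes
  the orientation irrelevant.\<close>

lemma prod_pairs_insert:
  fixes f :: "nat \<Rightarrow> nat \<Rightarrow> 'a::comm_monoid_mult"
  assumes "finite I" "i \<notin> I" and sym: "\<And>j k. f j k = f k j"
  shows "(\<Prod>(j,k)\<in>pairs (insert i I). f j k) = (\<Prod>k\<in>I. f i k) * (\<Prod>(j,k)\<in>pairs I. f j k)"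
proof -
  define g where "g = (\<lambda>k. if i < k then (i, k) else (k, i))"
  have *: "((j, k) \<in> g ` I) = ((j = i \<and> k \<in> I \<and> i < k) \<or> (k = i \<and> j \<in> I \<and> j < i))" for j k
    using assms(2) by (cases "j = i"; cases "k = i") (auto simp: g_def image_iff split: if_splits)
  have "(x \<in> pairs (insert i I)) = (x \<in> g ` I \<union> pairs I)" for x
  proof (cases x)
    case (Pair j k)
    show ?thesis unfolding Pair Un_iff * by (auto simp: pairs_def)
  qed
  then have "pairs (insert i I) = g ` I \<union> pairs I" by blast
  moreover have "g ` I \<inter> pairs I = {}"
    using assms(2) by (auto simp: pairs_def g_def split: if_splits)
  moreover have "inj_on g I" using assms(2) by (auto simp: inj_on_def g_def split: if_splits)
  ultimately have "(\<Prod>(j,k)\<in>pairs (insert i I). f j k)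
      = (\<Prod>k\<in>I. case g k of (j, k) \<Rightarrow> f j k) * (\<Prod>(j,k)\<in>pairs I. f j k)"
    using assms(1) by (simp add: prod.union_disjoint prod.reindex)
  also have "(\<Prod>k\<in>I. case g k of (j, k) \<Rightarrow> f j k) = (\<Prod>k\<in>I. f i k)"
    by (rule prod.cong) (auto simp: g_def sym)
  finally show ?thesis .
qed

definition flip :: "bool \<Rightarrow> complex \<Rightarrow> complex"
  where "flip s x = (if s then 1 / x else x)"

text \<open>These conditions keep all denominators 1 - X^2 and 1 - X Y of the summands nonzero,
  whatever signs are chosen. They also say that the points \<open>x i\<close> and
  \<open>1 / x i\<close> are distinct, which the interpolation arguments need.\<close>

definition generic :: "nat set \<Rightarrow> (nat \<Rightarrow> complex) \<Rightarrow> bool"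
  where "generic I x \<longleftrightarrow> (\<forall>i\<in>I. x i \<noteq> 0 \<and> x i ^ 2 \<noteq> 1) \<and>
    (\<forall>i\<in>I. \<forall>j\<in>I. i \<noteq> j \<longrightarrow> x i \<noteq> x j \<and> x i * x j \<noteq> 1)"

text \<open>\<open>K\<close> will be t^(n-1) u0 u1 u2. Already for one variable this is the value at
  which the sum over both signs loses its dependence on \<open>X\<close>.\<close>

definition gustafson_single :: "complex \<Rightarrow> complex \<Rightarrow> complex \<Rightarrow> complex \<Rightarrow> complex \<Rightarrow> complex"
  where "gustafson_single K u0 u1 u2 X = (1 - u0 * X) * (1 - u1 * X) * (1 - u2 * X) * (1 - K / X) / (1 - X\<^sup>2)"

definition gustafson_pair :: "complex \<Rightarrow> complex \<Rightarrow> complex \<Rightarrow> complex"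
  where "gustafson_pair t X Y = (1 - t * (X * Y)) / (1 - X * Y)"

definition gustafson_term ::
    "complex \<Rightarrow> complex \<Rightarrow> complex \<Rightarrow> complex \<Rightarrow> (nat \<Rightarrow> complex) \<Rightarrow> nat set \<Rightarrow> nat set \<Rightarrow> complex"
  where "gustafson_term t u0 u1 u2 x I S =
    (\<Prod>i\<in>I. gustafson_single (t ^ (card I - 1) * u0 * u1 * u2) u0 u1 u2 (flip (i \<in> S) (x i))) *
    (\<Prod>(j,k)\<in>pairs I. gustafson_pair t (flip (j \<in> S) (x j)) (flip (k \<in> S) (x k)))"

text \<open>Degree bounds are attached to functions, so that the summands keep their product form
  and an identity follows from agreement at enough points.\<close>

definition poly_fun :: "nat \<Rightarrow> (complex \<Rightarrow> complex) \<Rightarrow> bool"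
  where "poly_fun N f \<longleftrightarrow> (\<exists>p. degree p \<le> N \<and> (\<forall>u. f u = poly p u))"

lemma poly_fun_const: "poly_fun 0 (\<lambda>u. c)"
  unfolding poly_fun_def by (rule exI[of _ "[:c:]"]) auto

lemma poly_fun_linear: "poly_fun 1 (\<lambda>u. a + b * u)"
  unfolding poly_fun_def by (rule exI[of _ "[:a, b:]"]) (auto simp: mult.commute)

lemma poly_fun_mult:
  assumes "poly_fun M f" "poly_fun N g"
  shows "poly_fun (M + N) (\<lambda>u. f u * g u)"
proof -
  obtain p r where "degree p \<le> M" "\<And>u. f u = poly p u" "degree r \<le> N" "\<And>u. g u = poly r u"
    using assms unfolding poly_fun_def by blast
  then show ?thesis
    unfolding poly_fun_def using degree_mult_le[of p r] by (intro exI[of _ "p * r"]) auto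
qed

lemma poly_fun_diff:
  assumes "poly_fun N f" "poly_fun N g"
  shows "poly_fun N (\<lambda>u. f u - g u)"
proof -
  obtain p r where "degree p \<le> N" "\<And>u. f u = poly p u" "degree r \<le> N" "\<And>u. g u = poly r u"
    using assms unfolding poly_fun_def by blast
  then show ?thesis
    unfolding poly_fun_def by (intro exI[of _ "p - r"]) (auto intro: degree_diff_le)
qed

lemma poly_fun_sum:
  assumes "\<And>i. i \<in> A \<Longrightarrow> poly_fun N (f i)"
  shows "poly_fun N (\<lambda>u. \<Sum>i\<in>A. f i u)"
proof -
  obtain p where p: "\<And>i. i \<in> A \<Longrightarrow> degree (p i) \<le> N" "\<And>i u. i \<in> A \<Longrightarrow> f i u = poly (p i) u"
    using assms unfolding poly_fun_def by metis
  show ?thesis unfolding poly_fun_def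
  proof (intro exI conjI allI)
    show "degree (\<Sum>i\<in>A. p i) \<le> N"
      by (cases "finite A") (auto intro!: degree_sum_le p)
    show "(\<Sum>i\<in>A. f i u) = poly (\<Sum>i\<in>A. p i) u" for u
      by (simp add: poly_sum p)
  qed
qed

lemma poly_fun_prod:
  assumes "finite A" "\<And>i. i \<in> A \<Longrightarrow> poly_fun N (f i)"
  shows "poly_fun (N * card A) (\<lambda>u. \<Prod>i\<in>A. f i u)"
  using assms
proof (induction A rule: finite_induct)
  case empty
  then show ?case using poly_fun_const[of 1] by simp
next
  case (insert i A)
  then show ?case using poly_fun_mult[of N "f i" "N * card A" "\<lambda>u. \<Prod>i\<in>A. f i u"] by simp
qed

lemma poly_fun_eq_0:
  assumes "poly_fun N f" "finite Z" "card Z > N" "\<And>z. z \<in> Z \<Longrightarrow> f z = 0"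
  shows "f u = 0"
proof -
  obtain p where p: "degree p \<le> N" "\<And>u. f u = poly p u" using assms(1) unfolding poly_fun_def by blast
  have "p = 0"
  proof (rule ccontr)
    assume "p \<noteq> 0"
    then have "card {u. poly p u = 0} \<le> degree p" "finite {u. poly p u = 0}"
      by (rule card_poly_roots_bound poly_roots_finite)+
    moreover have "Z \<subseteq> {u. poly p u = 0}"
      using assms(4) p(2) by auto
    ultimately have "card Z \<le> degree p"
      using card_mono order_trans by blast
    then show False using assms(3) p(1) by linarith
  qed
  then show ?thesis using p(2)[of u] by simp
qed

text \<open>These are the interpolation nodes. When a parameter equals one of them, the terms with
  one of the two signs of some variable vanish.\<close>

lemma generic_inverse_points:
  assumes "generic I x" "finite I"
  shows "finite (x ` I \<union> (\<lambda>i. 1 / x i) ` I)" "card (x ` I \<union> (\<lambda>i. 1 / x i) ` I) = 2 * card I"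
proof -
  have "inj_on x I" "inj_on (\<lambda>i. 1 / x i) I"
    using assms(1) unfolding generic_def inj_on_def by (auto simp: field_simps)
  moreover have "x ` I \<inter> (\<lambda>i. 1 / x i) ` I = {}"
  proof -
    have False if "i \<in> I" "j \<in> I" "x i = 1 / x j" for i j
      using that assms(1) unfolding generic_def
      by (cases "i = j") (auto simp: field_simps power2_eq_square)
    then show ?thesis by blast
  qed
  ultimately show "card (x ` I \<union> (\<lambda>i. 1 / x i) ` I) = 2 * card I"
    using assms(2) by (simp add: card_Un_disjoint card_image)
qed (use assms in auto)

text \<open>Every term in which the variable \<open>i\<close> takes the value 1 / u0 contains the
  factor 1 - u0 / u0. In the surviving terms that variable equals \<open>u0\<close>, and its pair
  factors (1 - t u0 X) / (1 - u0 X) replace the parameter \<open>u0\<close> by \<open>t * u0\<close>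
  in the other variables.\<close>

lemma gustafson_reduce:
  assumes "finite I" "i \<notin> I" "generic (insert i I) x" and u0: "u0 = flip s (x i)"
  shows "(\<Sum>S\<in>Pow (insert i I). gustafson_term t u0 u1 u2 x (insert i I) S) =
    (1 - u0 * u1) * (1 - u0 * u2) * (1 - t ^ card I * u1 * u2) *
    (\<Sum>S\<in>Pow I. gustafson_term t (t * u0) u1 u2 x I S)"
proof -
  let ?J = "insert i I" and ?f = "gustafson_term t u0 u1 u2 x (insert i I)"
  \<comment> \<open>\<open>S'\<close> makes the choice at \<open>i\<close> for which the flipped
    variable is \<open>u0\<close>.\<close>
  define S' where "S' = (\<lambda>S. if s then insert i S else S)"
  have x: "x i \<noteq> 0" "x i ^ 2 \<noteq> 1" and xx: "\<And>j. j \<in> I \<Longrightarrow> x j \<noteq> 0"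
    "\<And>j. j \<in> I \<Longrightarrow> x i \<noteq> x j \<and> x i * x j \<noteq> 1"
    using assms(2,3) unfolding generic_def by auto
  have u0n: "u0 \<noteq> 0" "u0\<^sup>2 \<noteq> 1" using x by (auto simp: u0 flip_def field_simps)
  have "(\<Sum>S\<in>Pow ?J. ?f S) = (\<Sum>S\<in>Pow I. ?f S) + (\<Sum>S\<in>insert i ` Pow I. ?f S)"
    unfolding Pow_insert using assms(1,2) by (intro sum.union_disjoint) auto
  also have "(\<Sum>S\<in>insert i ` Pow I. ?f S) = (\<Sum>S\<in>Pow I. ?f (insert i S))"
    using assms(2) by (subst sum.reindex) (auto simp: inj_on_def o_def)
  also have "(\<Sum>S\<in>Pow I. ?f S) + \<dots> = (\<Sum>S\<in>Pow I. ?f S + ?f (insert i S))"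
    by (simp add: sum.distrib)
  also have "\<dots> = (\<Sum>S\<in>Pow I. ?f (S' S))"
  proof (rule sum.cong[OF refl])
    fix S assume "S \<in> Pow I"
    then have "i \<notin> S" using assms(2) by auto
    have vanish: "?f T = 0" if "(i \<in> T) = (\<not> s)" for T
    proof -
      have "1 - u0 * flip (i \<in> T) (x i) = 0" using that x(1) by (auto simp: u0 flip_def)
      then show ?thesis using assms(1,2) by (simp add: gustafson_term_def gustafson_single_def)
    qed
    show "?f S + ?f (insert i S) = ?f (S' S)"
      using vanish[of S] vanish[of "insert i S"] \<open>i \<notin> S\<close> by (cases s) (auto simp: S'_def)
  qed
  also have "\<dots> = (\<Sum>S\<in>Pow I. (1 - u0 * u1) * (1 - u0 * u2) * (1 - t ^ card I * u1 * u2) *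
     gustafson_term t (t * u0) u1 u2 x I S)"
  proof (rule sum.cong[OF refl])
    fix S assume "S \<in> Pow I"
    let ?X = "\<lambda>j. flip (j \<in> S) (x j)"
    let ?n = "card I"
    have "i \<notin> S" using \<open>S \<in> Pow I\<close> assms(2) by auto
    then have i: "flip (i \<in> S' S) (x i) = u0" by (auto simp: S'_def u0)
    have jI: "flip (j \<in> S' S) (x j) = ?X j" if "j \<in> I" for j
      using that assms(2) by (cases "j = i") (auto simp: S'_def)
    let ?K = "t ^ ?n * u0 * u1 * u2"
    have "?f (S' S) = (gustafson_single ?K u0 u1 u2 u0 * (\<Prod>j\<in>I. gustafson_single ?K u0 u1 u2 (?X j))) *
       ((\<Prod>j\<in>I. gustafson_pair t u0 (?X j)) * (\<Prod>(j,k)\<in>pairs I. gustafson_pair t (?X j) (?X k)))"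
    proof -
      have "(\<Prod>(j,k)\<in>pairs ?J. gustafson_pair t (flip (j \<in> S' S) (x j)) (flip (k \<in> S' S) (x k)))
        = (\<Prod>j\<in>I. gustafson_pair t (flip (i \<in> S' S) (x i)) (flip (j \<in> S' S) (x j))) *
          (\<Prod>(j,k)\<in>pairs I. gustafson_pair t (flip (j \<in> S' S) (x j)) (flip (k \<in> S' S) (x k)))"
        using assms(1,2) by (intro prod_pairs_insert) (auto simp: gustafson_pair_def mult.commute)
      also have "\<dots> = (\<Prod>j\<in>I. gustafson_pair t u0 (?X j)) * (\<Prod>(j,k)\<in>pairs I. gustafson_pair t (?X j) (?X k))"
        by (intro arg_cong2[where f="(*)"] prod.cong) (auto simp: i jI pairs_def)
      finally show ?thesis using assms(1,2) by (simp add: gustafson_term_def i jI)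
    qed
    also have "gustafson_single ?K u0 u1 u2 u0 = (1 - u0 * u1) * (1 - u0 * u2) * (1 - t ^ ?n * u1 * u2)"
      using u0n by (simp add: gustafson_single_def power2_eq_square mult_ac)
    finally have f: "?f (S' S) = (1 - u0 * u1) * (1 - u0 * u2) * (1 - t ^ ?n * u1 * u2) *
        ((\<Prod>j\<in>I. gustafson_single ?K u0 u1 u2 (?X j) * gustafson_pair t u0 (?X j)) *
         (\<Prod>(j,k)\<in>pairs I. gustafson_pair t (?X j) (?X k)))"
      by (simp only: prod.distrib mult_ac)
    \<comment> \<open>The value of \<open>K\<close> is unchanged, since one power of
      \<open>t\<close> passes from \<open>t ^ card I\<close> to the new parameter
      \<open>t * u0\<close>.\<close>
    have "(\<Prod>j\<in>I. gustafson_single ?K u0 u1 u2 (?X j) * gustafson_pair t u0 (?X j)) =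
      (\<Prod>j\<in>I. gustafson_single (t ^ (?n - 1) * (t * u0) * u1 * u2) (t * u0) u1 u2 (?X j))"
    proof (rule prod.cong[OF refl])
      fix j assume j: "j \<in> I"
      have "?n = Suc (?n - 1)" using j assms(1) by (cases "?n") auto
      then have K: "?K = t ^ (?n - 1) * (t * u0) * u1 * u2"
        using power_Suc[of t "?n - 1"] by (simp only: mult_ac)
      have "1 - u0 * ?X j \<noteq> 0"
        using xx[OF j] x by (cases s) (auto simp: u0 flip_def field_simps)
      then have "gustafson_single ?K u0 u1 u2 (?X j) * gustafson_pair t u0 (?X j) =
          gustafson_single ?K (t * u0) u1 u2 (?X j)"
        by (simp add: gustafson_single_def gustafson_pair_def mult_ac)
      then show "gustafson_single ?K u0 u1 u2 (?X j) * gustafson_pair t u0 (?X j) =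
          gustafson_single (t ^ (?n - 1) * (t * u0) * u1 * u2) (t * u0) u1 u2 (?X j)"
        by (simp only: K)
    qed
    with f show "?f (S' S) = (1 - u0 * u1) * (1 - u0 * u2) * (1 - t ^ card I * u1 * u2) *
     gustafson_term t (t * u0) u1 u2 x I S"
      by (simp only: gustafson_term_def)
  qed
  finally show ?thesis by (simp add: sum_distrib_left)
qed

lemma gustafson_term_swap:
  "gustafson_term t u0 u1 u2 x I S = gustafson_term t u1 u0 u2 x I S"
  by (simp add: gustafson_term_def gustafson_single_def mult_ac)

lemma generic_subset: "generic J x \<Longrightarrow> I \<subseteq> J \<Longrightarrow> generic I x"
  unfolding generic_def by blast

lemma generic_flip_points:
  assumes "z \<in> x ` I \<union> (\<lambda>i. 1 / x i) ` I"
  obtains i s where "i \<in> I" "z = flip s (x i)"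
proof -
  from assms obtain i where "i \<in> I" "z = flip False (x i) \<or> z = flip True (x i)"
    by (auto simp: flip_def)
  then show ?thesis using that by blast
qed

text \<open>With \<open>u0 = 0\<close> also \<open>K\<close> vanishes, so both sides have degree at
  most \<open>card I\<close> in \<open>u1\<close> and the \<open>2 * card I\<close> nodes are more
  than enough. At a node the two parameters trade places, which makes
  \<open>gustafson_reduce\<close> applicable and leaves a sum with a zero parameter again.\<close>

lemma gustafson_0:
  assumes "finite I" "generic I x"
  shows "(\<Sum>S\<in>Pow I. gustafson_term t 0 u1 u2 x I S) = (\<Prod>i<card I. 1 - t ^ i * u1 * u2)"
  using assms
proof (induction "card I" arbitrary: I u1)
  case 0
  then show ?case by (simp add: gustafson_term_def)
next
  case (Suc n)
  let ?f = "\<lambda>u. (\<Sum>S\<in>Pow I. gustafson_term t 0 u u2 x I S) - (\<Prod>i<card I. 1 - t ^ i * u * u2)"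
  have "?f u1 = 0"
  proof (rule poly_fun_eq_0[where N="card I" and f="?f"])
    have 1: "poly_fun (card I) (\<lambda>u. \<Prod>i\<in>I. gustafson_single (t ^ (card I - 1) * 0 * u * u2) 0 u u2 (flip (i \<in> S) (x i)))" for S
    proof -
      have *: "poly_fun 1 (\<lambda>u. gustafson_single 0 0 u u2 X)" for X
        using poly_fun_linear[of "(1 - u2 * X) / (1 - X\<^sup>2)" "- X * (1 - u2 * X) / (1 - X\<^sup>2)"]
        by (simp add: gustafson_single_def diff_divide_distrib add_divide_distrib algebra_simps)
      show ?thesis using poly_fun_prod[OF Suc(3), of 1, OF *] by simp
    qed
    have 2: "poly_fun (card I) (\<lambda>u. \<Prod>i<card I. 1 - t ^ i * u * u2)"
    proof -
      have "poly_fun 1 (\<lambda>u. 1 - t ^ i * u * u2)" for i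
        using poly_fun_linear[of 1 "- (t ^ i * u2)"] by (simp add: mult_ac)
      from poly_fun_prod[of "{..<card I}", OF _ this] show ?thesis by simp
    qed
    show "poly_fun (card I) ?f"
      unfolding gustafson_term_def
      using poly_fun_mult[OF 1 poly_fun_const] by (intro poly_fun_diff poly_fun_sum 2) simp
    show "finite (x ` I \<union> (\<lambda>i. 1 / x i) ` I)" "card (x ` I \<union> (\<lambda>i. 1 / x i) ` I) > card I"
      using generic_inverse_points[OF Suc(4,3)] Suc(2) by auto
    fix z assume "z \<in> x ` I \<union> (\<lambda>i. 1 / x i) ` I"
    then obtain i s where i: "i \<in> I" "z = flip s (x i)" by (rule generic_flip_points)
    define I' where "I' = I - {i}"
    have I: "I = insert i I'" "i \<notin> I'" "finite I'" "n = card I'" "generic I' x"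
      using i Suc(2-4) by (auto simp: I'_def intro: generic_subset)
    then have gJ: "generic (insert i I') x" using Suc(4) by simp
    have "(\<Sum>S\<in>Pow I. gustafson_term t 0 z u2 x I S) = (\<Sum>S\<in>Pow I. gustafson_term t z 0 u2 x I S)"
      by (simp add: gustafson_term_swap[of t 0])
    also have "\<dots> = (1 - z * u2) * (\<Sum>S\<in>Pow I'. gustafson_term t 0 (t * z) u2 x I' S)"
      using gustafson_reduce[OF I(3,2) gJ i(2), where ?u1.0=0 and ?u2.0=u2 and t=t] Suc(4) I(1)
      by (simp add: gustafson_term_swap[of t 0])
    also have "\<dots> = (\<Prod>i<card I. 1 - t ^ i * z * u2)"
      unfolding Suc.hyps(1)[OF I(4,3,5)] Suc(2)[symmetric] I(4)[symmetric]
      by (subst prod.lessThan_Suc_shift) (simp add: mult_ac)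
    finally show "?f z = 0" by simp
  qed
  then show ?case by simp
qed

text \<open>Both sides are polynomials in \<open>u0\<close> of degree at most \<open>2 * card I\<close>. They agree at the
  \<open>2 * card I\<close> points \<open>x i\<close> and \<open>1 / x i\<close>, where one variable drops out, and at \<open>0\<close>.\<close>
theorem gustafson_identity:
  assumes "finite I" "generic I x"
  shows "(\<Sum>S\<in>Pow I. gustafson_term t u0 u1 u2 x I S) =
    (\<Prod>i<card I. (1 - t ^ i * u0 * u1) * (1 - t ^ i * u0 * u2) * (1 - t ^ i * u1 * u2))"
  using assms
proof (induction "card I" arbitrary: I u0)
  case 0
  then show ?case by (simp add: gustafson_term_def)
next
  case (Suc n)
  let ?R = "\<lambda>u. \<Prod>i<card I. (1 - t ^ i * u * u1) * (1 - t ^ i * u * u2) * (1 - t ^ i * u1 * u2)"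
  let ?f = "\<lambda>u. (\<Sum>S\<in>Pow I. gustafson_term t u u1 u2 x I S) - ?R u"
  have "?f u0 = 0"
  proof (rule poly_fun_eq_0[where N="2 * card I" and f="?f"])
    have 1: "poly_fun (2 * card I) (\<lambda>u. \<Prod>i\<in>I. gustafson_single (t ^ (card I - 1) * u * u1 * u2) u u1 u2 (flip (i \<in> S) (x i)))" for S
    proof -
      have *: "poly_fun 2 (\<lambda>u. gustafson_single (t ^ (card I - 1) * u * u1 * u2) u u1 u2 X)" for X
        using poly_fun_mult[OF poly_fun_mult[OF poly_fun_linear[of 1 "- X"]
            poly_fun_linear[of 1 "- (t ^ (card I - 1) * u1 * u2) / X"]]
            poly_fun_const[of "(1 - u1 * X) * (1 - u2 * X) / (1 - X\<^sup>2)"]]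
        by (simp add: gustafson_single_def mult_ac numeral_2_eq_2)
      show ?thesis using poly_fun_prod[OF Suc(3), of 2, OF *] by simp
    qed
    have 2: "poly_fun (2 * card I) ?R"
    proof -
      have "poly_fun 2 (\<lambda>u. (1 - t ^ i * u * u1) * (1 - t ^ i * u * u2) * (1 - t ^ i * u1 * u2))" for i
        using poly_fun_mult[OF poly_fun_mult[OF poly_fun_linear[of 1 "- (t ^ i * u1)"]
            poly_fun_linear[of 1 "- (t ^ i * u2)"]] poly_fun_const[of "1 - t ^ i * u1 * u2"]]
        by (simp add: mult_ac numeral_2_eq_2)
      from poly_fun_prod[of "{..<card I}", OF _ this] show ?thesis by simp
    qed
    show "poly_fun (2 * card I) ?f"
      unfolding gustafson_term_def
      using poly_fun_mult[OF 1 poly_fun_const] by (intro poly_fun_diff poly_fun_sum 2) simp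
    let ?Z = "x ` I \<union> (\<lambda>i. 1 / x i) ` I"
    have "0 \<notin> ?Z" using Suc(4) by (auto simp: generic_def)
    then show "finite (insert 0 ?Z)" "card (insert 0 ?Z) > 2 * card I"
      using generic_inverse_points[OF Suc(4,3)] Suc(2) by auto
    fix z assume "z \<in> insert 0 ?Z"
    then consider "z = 0" | "z \<in> ?Z" by blast
    then show "?f z = 0"
    proof cases
      case 1
      then show ?thesis using gustafson_0[OF Suc(3,4)] by simp
    next
      case 2
      then obtain i s where i: "i \<in> I" "z = flip s (x i)" by (rule generic_flip_points)
      define I' where "I' = I - {i}"
      have I: "I = insert i I'" "i \<notin> I'" "finite I'" "n = card I'" "generic I' x"
        using i Suc(2-4) by (auto simp: I'_def intro: generic_subset)
      then have gJ: "generic (insert i I') x" using Suc(4) by simp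
      have "(\<Sum>S\<in>Pow I. gustafson_term t z u1 u2 x I S) =
          (1 - z * u1) * (1 - z * u2) * (1 - t ^ n * u1 * u2) * (\<Sum>S\<in>Pow I'. gustafson_term t (t * z) u1 u2 x I' S)"
        using gustafson_reduce[OF I(3,2) gJ i(2)] Suc(4) I(1,4) by simp
      also have "\<dots> = ?R z"
        unfolding Suc.hyps(1)[OF I(4,3,5)] Suc(2)[symmetric] I(4)[symmetric] prod.distrib
        by (subst prod.lessThan_Suc_shift, subst prod.lessThan_Suc_shift, subst prod.lessThan_Suc) (simp add: mult_ac)
      finally show "?f z = 0" by simp
    qed
  qed
  then show ?case by simp
qed

section \<open>Normalised arc length on the unit circle\<close>

abbreviation unit_circle :: "complex set" where "unit_circle \<equiv> sphere 0 1"

text \<open>This is the Haar measure dz / (2 pi i z). Its underlying space is the circle itself, so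
  that its powers live on the torus.\<close>

definition circle_measure :: "complex measure"
  where "circle_measure =
    distr (restrict_space lborel {0..1}) (restrict_space borel unit_circle) (circlepath 0 1)"

lemma space_circle_measure [simp]: "space circle_measure = unit_circle"
  by (simp add: circle_measure_def space_restrict_space)

lemma sets_circle_measure: "sets circle_measure = sets (restrict_space borel unit_circle)"
  by (simp add: circle_measure_def)

lemma norm_circlepath_01 [simp]: "norm (circlepath 0 1 s) = 1"
  by (simp add: circlepath)

lemma circlepath_01_measurable [measurable]: "circlepath 0 1 \<in> borel_measurable borel"
  by (rule borel_measurable_continuous_onI) (auto simp: circlepath intro!: continuous_intros)

lemma circlepath_measurable_restrict:
  "circlepath 0 1 \<in> measurable (restrict_space lborel {0..1}) (restrict_space borel unit_circle)"
  by (intro measurable_restrict_space2 measurable_restrict_space1) auto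

lemma circle_measure_measurable_borel [measurable]: "(\<lambda>x. x) \<in> borel_measurable circle_measure"
  unfolding circle_measure_def by (auto intro: measurable_restrict_space1)

lemma emeasure_circle_measure:
  assumes "A \<in> sets circle_measure"
  shows "emeasure circle_measure A = (\<integral>\<^sup>+s\<in>{0..1}. indicator A (circlepath 0 1 s) \<partial>lborel)"
proof -
  have "emeasure circle_measure A = (\<integral>\<^sup>+s. indicator A s \<partial>circle_measure)"
    using assms by simp
  also have "\<dots> = (\<integral>\<^sup>+s. indicator A (circlepath 0 1 s) \<partial>restrict_space lborel {0..1})"
    unfolding circle_measure_def
    by (rule nn_integral_distr[OF circlepath_measurable_restrict]) (use assms in \<open>simp add: sets_circle_measure\<close>)
  also have "\<dots> = (\<integral>\<^sup>+s\<in>{0..1}. indicator A (circlepath 0 1 s) \<partial>lborel)"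
    by (subst nn_integral_restrict_space) auto
  finally show ?thesis .
qed

lemma emeasure_circle_measure_space: "emeasure circle_measure unit_circle = 1"
proof -
  have "emeasure circle_measure unit_circle = (\<integral>\<^sup>+s\<in>{0..1::real}. 1 \<partial>lborel)"
    by (subst emeasure_circle_measure) (auto simp: sets_circle_measure sets_restrict_space_iff intro!: nn_integral_cong)
  also have "\<dots> = 1" by simp
  finally show ?thesis .
qed

lemma circle_measure_finite: "finite_measure circle_measure"
  by (rule finite_measureI) (simp add: emeasure_circle_measure_space)

lemma integral_circle_measure:
  fixes f :: "complex \<Rightarrow> complex"
  assumes "f \<in> borel_measurable circle_measure"
  shows "integral\<^sup>L circle_measure f = (LINT s:{0..1}|lborel. f (circlepath 0 1 s))"
proof -
  have "integral\<^sup>L circle_measure f = (LINT s|restrict_space lborel {0..1}. f (circlepath 0 1 s))"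
    unfolding circle_measure_def
    by (rule integral_distr[OF circlepath_measurable_restrict])
       (use assms in \<open>simp add: circle_measure_def\<close>)
  also have "\<dots> = (LINT s:{0..1}|lborel. f (circlepath 0 1 s))"
    by (subst integral_restrict_space) (auto simp: set_lebesgue_integral_def)
  finally show ?thesis .
qed

lemma circlepath_01_eq_iff: "circlepath 0 1 s = circlepath 0 1 s' \<longleftrightarrow> (\<exists>n::int. s = s' + n)"
proof -
  have "circlepath 0 1 s = circlepath 0 1 s' \<longleftrightarrow>
      (\<exists>n::int. 2 * of_real pi * \<i> * of_real s = 2 * of_real pi * \<i> * of_real s' + (of_int (2 * n) * pi) * \<i>)"
    by (simp add: circlepath exp_eq)
  also have "\<dots> \<longleftrightarrow> (\<exists>n::int. s = s' + n)"
  proof (rule ex_cong1)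
    fix n :: int
    have "2 * of_real pi * \<i> * of_real s = 2 * of_real pi * \<i> * of_real s' + (of_int (2 * n) * pi) * \<i>
       \<longleftrightarrow> (2 * of_real pi * \<i>) * of_real s = (2 * of_real pi * \<i>) * complex_of_real (s' + n)"
      by (simp add: algebra_simps)
    also have "\<dots> \<longleftrightarrow> s = s' + n"
      by (simp only: mult_cancel_left of_real_eq_iff) simp
    finally show "(2 * of_real pi * \<i> * of_real s = 2 * of_real pi * \<i> * of_real s' + (of_int (2 * n) * pi) * \<i>) = (s = s' + n)" .
  qed
  finally show ?thesis .
qed

lemma circlepath_01_add: "circlepath 0 1 (s + r) = circlepath 0 1 s * circlepath 0 1 r"
  by (simp add: circlepath exp_add ring_distribs)

lemma circlepath_01_onto:
  assumes "norm c = 1"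
  obtains r where "0 \<le> r" "r < 1" "c = circlepath 0 1 r"
proof -
  obtain r where r: "c = circlepath 0 1 r"
  proof -
    have "c = exp (\<i> * Arg c)" using assms Arg_eq[of c] by (cases "c = 0") auto
    then show ?thesis by (intro that[of "Arg c / (2 * pi)"]) (simp add: circlepath)
  qed
  have "c = circlepath 0 1 (frac r)"
    unfolding r circlepath_01_eq_iff by (rule exI[of _ "\<lfloor>r\<rfloor>"]) (simp add: frac_def)
  then show ?thesis by (intro that[of "frac r"]) (auto simp: frac_ge_0 frac_lt_1)
qed

lemma circle_measure_singleton: "emeasure circle_measure {c} = 0"
proof (cases "norm c = 1")
  case False
  \<comment> \<open>Off the circle the singleton is not a measurable set, and its
    \<open>emeasure\<close> is 0 by convention.\<close>
  then have "{c} \<notin> sets circle_measure"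
    using sets.sets_into_space[of "{c}" circle_measure] by auto
  then show ?thesis by (rule emeasure_notin_sets)
next
  case True
  obtain r where r: "0 \<le> r" "r < 1" "c = circlepath 0 1 r" using circlepath_01_onto[OF True] .
  have c: "{c} \<in> sets circle_measure" using True by (auto simp: sets_circle_measure sets_restrict_space_iff)
  have "emeasure circle_measure {c} = (\<integral>\<^sup>+s\<in>{0..1}. indicator {c} (circlepath 0 1 s) \<partial>lborel)"
    by (rule emeasure_circle_measure[OF c])
  \<comment> \<open>The parameter is determined up to an integer, and only three translates of
    \<open>r\<close> can meet the unit interval.\<close>
  also have "\<dots> \<le> (\<integral>\<^sup>+s. indicator {r - 1, r, r + 1} s \<partial>lborel)"
  proof (rule nn_integral_mono)
    fix s :: real
    have "s \<in> {r - 1, r, r + 1}" if s: "s \<in> {0..1}" "circlepath 0 1 s = c"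
    proof -
      obtain n :: int where n: "s = r + n" using s(2) r(3) circlepath_01_eq_iff by auto
      have "real_of_int n < 2" "real_of_int n > -2" using n s(1) r by auto
      then have "n = -1 \<or> n = 0 \<or> n = 1" by linarith
      then show ?thesis using n by auto
    qed
    then show "indicator {c} (circlepath 0 1 s) * indicator {0..1} s \<le> (indicator {r - 1, r, r + 1} s :: ennreal)"
      by (auto simp: indicator_def)
  qed
  also have "\<dots> = emeasure lborel {r - 1, r, r + 1}" by (intro nn_integral_indicator) auto
  also have "\<dots> = 0" by (intro emeasure_lborel_countable) auto
  finally show ?thesis by simp
qed

lemma measurable_circle_mult:
  assumes "norm c = 1"
  shows "(\<lambda>z. c * z) \<in> measurable circle_measure circle_measure"
proof -
  have "(\<lambda>z. c * z) \<in> measurable circle_measure (restrict_space borel unit_circle)"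
    using assms by (intro measurable_restrict_space2) (auto simp: norm_mult)
  then show ?thesis by (simp add: measurable_cong_sets[OF refl sets_circle_measure])
qed

text \<open>Rotation moves the parameter interval to \<open>{r..r+1}\<close>. The part beyond 1 is
  brought back by periodicity, which restores the unit interval.\<close>

lemma circle_measure_rotate:
  assumes c: "norm c = 1"
  shows "distr circle_measure circle_measure (\<lambda>z. c * z) = circle_measure"
proof (rule measure_eqI)
  fix A assume "A \<in> sets (distr circle_measure circle_measure (\<lambda>z. c * z))"
  then have A: "A \<in> sets circle_measure" by simp
  obtain r where r: "0 \<le> r" "r < 1" "c = circlepath 0 1 r" using circlepath_01_onto[OF c] .
  define g where "g = (\<lambda>s. indicator A (circlepath 0 1 s) :: ennreal)"
  have [measurable]: "g \<in> borel_measurable borel"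
  proof -
    have "A \<in> sets borel" using A by (auto simp: sets_circle_measure sets_restrict_space_iff)
    then show ?thesis unfolding g_def by measurable
  qed
  have per: "g (s + 1) = g s" for s
    by (simp add: g_def circlepath_01_eq_iff[THEN iffD2, of "s + 1" s] exI[of _ 1])
  have "emeasure (distr circle_measure circle_measure (\<lambda>z. c * z)) A =
      emeasure circle_measure ((\<lambda>z. c * z) -` A \<inter> unit_circle)"
    using A c by (subst emeasure_distr) (auto intro: measurable_circle_mult)
  also have "\<dots> = (\<integral>\<^sup>+s\<in>{0..1}. g (r + s) \<partial>lborel)"
  proof (subst emeasure_circle_measure)
    show "(\<lambda>z. c * z) -` A \<inter> unit_circle \<in> sets circle_measure"
      using measurable_sets[OF measurable_circle_mult[OF c] A] by simp
  qed (auto intro!: nn_integral_cong simp: g_def r circlepath_01_add indicator_def)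
  also have "\<dots> = (\<integral>\<^sup>+u. g u * indicator {r..r+1} u \<partial>lborel)"
  proof -
    have "(\<integral>\<^sup>+u. g u * indicator {r..r+1} u \<partial>lborel) = (\<integral>\<^sup>+s. g (r + s) * indicator {r..r+1} (r + s) \<partial>lborel)"
      using nn_integral_real_affine[of "\<lambda>u. g u * indicator {r..r+1} u" 1 r] by simp
    also have "\<dots> = (\<integral>\<^sup>+s\<in>{0..1}. g (r + s) \<partial>lborel)"
      by (intro nn_integral_cong) (auto simp: indicator_def)
    finally show ?thesis by simp
  qed
  also have "\<dots> = (\<integral>\<^sup>+u. g u * indicator {r..<1} u + g u * indicator {1..r+1} u \<partial>lborel)"
    using r by (intro nn_integral_cong) (auto simp: indicator_def)
  also have "\<dots> = (\<integral>\<^sup>+u. g u * indicator {r..<1} u \<partial>lborel) + (\<integral>\<^sup>+u. g u * indicator {1..r+1} u \<partial>lborel)"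
    by (rule nn_integral_add) auto
  also have "(\<integral>\<^sup>+u. g u * indicator {1..r+1} u \<partial>lborel) = (\<integral>\<^sup>+s. g (1 + s) * indicator {1..r+1} (1 + s) \<partial>lborel)"
    using nn_integral_real_affine[of "\<lambda>u. g u * indicator {1..r+1} u" 1 1] by simp
  also have "\<dots> = (\<integral>\<^sup>+s. g s * indicator {0..r} s \<partial>lborel)"
    using per by (intro nn_integral_cong) (auto simp: indicator_def add.commute)
  also have "(\<integral>\<^sup>+u. g u * indicator {r..<1} u \<partial>lborel) + \<dots> =
     (\<integral>\<^sup>+u. g u * indicator {r..<1} u + g u * indicator {0..r} u \<partial>lborel)"
    by (rule nn_integral_add[symmetric]) auto
  \<comment> \<open>The point \<open>r\<close> is counted twice on the left and the point 1 not at
    all, so equality holds only almost everywhere.\<close>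
  also have "\<dots> = (\<integral>\<^sup>+u\<in>{0..1}. g u \<partial>lborel)"
  proof (rule nn_integral_cong_AE)
    have "AE u in lborel. u \<noteq> r" "AE u in lborel. u \<noteq> (1::real)"
      by (rule AE_lborel_singleton)+
    then show "AE u in lborel. g u * indicator {r..<1} u + g u * indicator {0..r} u = g u * indicator {0..1} u"
      by eventually_elim (use r in \<open>auto simp: indicator_def\<close>)
  qed
  also have "\<dots> = emeasure circle_measure A"
    by (simp add: emeasure_circle_measure[OF A] g_def)
  finally show "emeasure (distr circle_measure circle_measure (\<lambda>z. c * z)) A = emeasure circle_measure A" .
qed simp

lemma integral_circle_contour:
  assumes "continuous_on unit_circle f"
  shows "integral\<^sup>L circle_measure f = contour_integral (circlepath 0 1) (\<lambda>z. f z / z) / (2 * of_real pi * \<i>)"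
proof -
  have "f \<in> borel_measurable circle_measure"
    using borel_measurable_continuous_on_restrict[OF assms] by (simp add: measurable_cong_sets[OF sets_circle_measure refl])
  then have "integral\<^sup>L circle_measure f = (LINT s:{0..1}|lborel. f (circlepath 0 1 s))"
    by (rule integral_circle_measure)
  also have "\<dots> = integral {0..1} (\<lambda>s. f (circlepath 0 1 s))"
  proof (rule set_borel_integral_eq_integral)
    have "continuous_on {0..1} (\<lambda>s. f (circlepath 0 1 s))"
      by (rule continuous_on_compose2[OF assms]) (auto simp: circlepath intro!: continuous_intros)
    then show "set_integrable lborel {0..1} (\<lambda>s. f (circlepath 0 1 s))"
      by (rule borel_integrable_atLeastAtMost')
  qed
  also have "\<dots> = integral {0..1} (\<lambda>s. f (circlepath 0 1 s) / circlepath 0 1 s * vector_derivative (circlepath 0 1) (at s) / (2 * of_real pi * \<i>))"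
    by (intro integral_cong) (simp only: vector_derivative_circlepath, simp add: circlepath)
  also have "\<dots> = contour_integral (circlepath 0 1) (\<lambda>z. f z / z) / (2 * of_real pi * \<i>)"
    unfolding contour_integral_integral integral_divide[symmetric] by (simp del: integral_divide add: mult_ac)
  finally show ?thesis .
qed

lemma integral_circle_rotate:
  fixes f :: "complex \<Rightarrow> complex"
  assumes "norm c = 1" "f \<in> borel_measurable circle_measure"
  shows "(\<integral>z. f (c * z) \<partial>circle_measure) = integral\<^sup>L circle_measure f"
  using integral_distr[OF measurable_circle_mult[OF assms(1)] assms(2)] circle_measure_rotate[OF assms(1)] by simp

text \<open>Rotation invariance removes the phase of \<open>c\<close>. The mean is then the contour
  integral of g(z) / z over a circle of radius |c|, up to 2 pi i, and concentric circles are
  homotopic in the annulus.\<close>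

lemma circle_mean_annulus:
  assumes hol: "g holomorphic_on {z. r1 < norm z \<and> norm z < r2}" and r1: "r1 \<ge> 0"
    and c: "r1 < norm c" "norm c < r2" and c': "r1 < norm c'" "norm c' < r2"
  shows "(\<integral>z. g (c * z) \<partial>circle_measure) = (\<integral>z. g (c' * z) \<partial>circle_measure)"
proof -
  let ?A = "{z. r1 < norm z \<and> norm z < r2}"
  have A: "open ?A" by (intro open_Collect_conj open_Collect_less continuous_intros)
  have cont: "continuous_on unit_circle (\<lambda>z. g (d * z))" if "r1 < norm d" "norm d < r2" for d
    by (rule continuous_on_compose2[OF holomorphic_on_imp_continuous_on[OF hol]])
       (use that in \<open>auto intro!: continuous_intros simp: norm_mult\<close>)
  have real: "(\<integral>z. g (d * z) \<partial>circle_measure) = contour_integral (circlepath 0 (norm d)) (\<lambda>z. g z / z) / (2 * of_real pi * \<i>)"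
    if d: "r1 < norm d" "norm d < r2" for d
  proof -
    have "d \<noteq> 0" using r1 d by auto
    define s where "s = sgn d"
    have s: "norm s = 1" "d = of_real (norm d) * s"
      using \<open>d \<noteq> 0\<close> unfolding s_def by (simp add: norm_sgn) (simp add: sgn_eq)
    have d': "r1 < norm (of_real (norm d) :: complex)" "norm (of_real (norm d) :: complex) < r2" using d by auto
    have "(\<integral>z. g (d * z) \<partial>circle_measure) = (\<integral>z. g (of_real (norm d) * (s * z)) \<partial>circle_measure)"
      by (simp add: s(2)[symmetric] mult.assoc[symmetric])
    also have "\<dots> = (\<integral>z. g (of_real (norm d) * z) \<partial>circle_measure)"
      using borel_measurable_continuous_on_restrict[OF cont[OF d']]
      by (intro integral_circle_rotate[OF s(1)]) (simp add: measurable_cong_sets[OF sets_circle_measure refl])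
    also have "\<dots> = contour_integral (circlepath 0 1) (\<lambda>z. g (of_real (norm d) * z) / z) / (2 * of_real pi * \<i>)"
      by (rule integral_circle_contour[OF cont[OF d']])
    also have "contour_integral (circlepath 0 1) (\<lambda>z. g (of_real (norm d) * z) / z) =
        contour_integral (circlepath 0 (norm d)) (\<lambda>z. g z / z)"
      unfolding contour_integral_integral
      by (intro integral_cong) (use \<open>d \<noteq> 0\<close> in \<open>simp only: vector_derivative_circlepath, simp add: circlepath\<close>)
    finally show ?thesis .
  qed
  have "contour_integral (circlepath 0 (norm c)) (\<lambda>z. g z / z) = contour_integral (circlepath 0 (norm c')) (\<lambda>z. g z / z)"
  proof (rule Cauchy_theorem_homotopic_loops[OF _ A])
    show "(\<lambda>z. g z / z) holomorphic_on ?A"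
      using hol r1 by (auto intro!: holomorphic_intros)
    show "homotopic_loops ?A (circlepath 0 (norm c)) (circlepath 0 (norm c'))"
    proof (rule homotopic_loops_linear)
      fix t :: real
      show "closed_segment (circlepath 0 (norm c) t) (circlepath 0 (norm c') t) \<subseteq> ?A"
      proof
        fix x assume "x \<in> closed_segment (circlepath 0 (norm c) t) (circlepath 0 (norm c') t)"
        then obtain u where u: "0 \<le> u" "u \<le> 1"
          "x = (1 - u) *\<^sub>R circlepath 0 (norm c) t + u *\<^sub>R circlepath 0 (norm c') t"
          by (auto simp: closed_segment_def)
        let ?m = "(1 - u) * norm c + u * norm c'"
        have "x = of_real ?m * circlepath 0 1 t"
          by (simp add: u(3) circlepath scaleR_conv_of_real algebra_simps)
        then have "norm x = ?m" using u by (simp only: norm_mult norm_of_real norm_circlepath_01) simp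
        moreover have "?m \<in> {r1<..<r2}"
          using convexD_alt[of "{r1<..<r2}" "norm c" "norm c'" u] u c c' by (simp add: algebra_simps)
        ultimately show "x \<in> ?A" by simp
      qed
    qed (auto simp: path_circlepath)
  qed auto
  then show ?thesis using real[OF c] real[OF c'] by simp
qed

section \<open>Integration over the torus\<close>

abbreviation torus_measure :: "nat set \<Rightarrow> (nat \<Rightarrow> complex) measure"
  where "torus_measure I \<equiv> PiM I (\<lambda>_. circle_measure)"

definition torus :: "nat set \<Rightarrow> (nat \<Rightarrow> complex) set"
  where "torus I = PiE I (\<lambda>_. unit_circle)"

lemma space_torus_measure [simp]: "space (torus_measure I) = torus I"
  by (simp add: space_PiM torus_def)

lemma torusI: "(\<And>i. i \<in> I \<Longrightarrow> norm (z i) = 1) \<Longrightarrow> (\<And>i. i \<notin> I \<Longrightarrow> z i = undefined) \<Longrightarrow> z \<in> torus I"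
  unfolding torus_def by (rule PiE_I) auto

lemma torus_undefined: "z \<in> torus I \<Longrightarrow> i \<notin> I \<Longrightarrow> z i = undefined"
  unfolding torus_def by (rule PiE_arb)

lemma norm_torus [simp]: "z \<in> torus I \<Longrightarrow> i \<in> I \<Longrightarrow> norm (z i) = 1"
  by (auto simp: torus_def PiE_def Pi_def)

lemma torus_nonzero [simp]: "z \<in> torus I \<Longrightarrow> i \<in> I \<Longrightarrow> z i \<noteq> 0"
  using norm_torus[of z I i] by fastforce

lemma circle_sigma_finite: "product_sigma_finite (\<lambda>_::nat. circle_measure)"
  by (simp add: product_sigma_finite_def finite_measure.axioms(1) circle_measure_finite)

interpretation circle: product_sigma_finite "\<lambda>_::nat. circle_measure"
  by (rule circle_sigma_finite)

lemma emeasure_torus: "finite I \<Longrightarrow> emeasure (torus_measure I) (torus I) = 1"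
  unfolding torus_def
  by (subst circle.emeasure_PiM) (use sets.top[of circle_measure] in \<open>auto simp: emeasure_circle_measure_space\<close>)

lemma torus_measure_finite: "finite I \<Longrightarrow> finite_measure (torus_measure I)"
  by (rule finite_measureI) (simp add: emeasure_torus)

text \<open>A point of the torus takes the value \<open>undefined\<close> outside \<open>I\<close>.
  With these coordinates confined to a singleton, the torus is a full product of compact sets and
  Tychonoff's theorem applies.\<close>

lemma compact_torus: "compact (torus I)"
proof -
  define X where "X = (\<lambda>i. if i \<in> I then unit_circle else {undefined})"
  have "z \<in> torus I \<longleftrightarrow> z \<in> PiE UNIV X" for z
  proof -
    have "z \<in> torus I \<longleftrightarrow> (\<forall>i. z i \<in> X i)"
      unfolding torus_def PiE_iff extensional_def X_def by auto
    then show ?thesis by (simp add: PiE_iff)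
  qed
  then have "torus I = PiE UNIV X" by blast
  moreover have "compactin euclidean (PiE UNIV X)"
    unfolding euclidean_product_topology[symmetric] compactin_PiE
    by (rule disjI2) (simp add: X_def)
  ultimately show ?thesis
    by (simp only: compactin_euclidean_iff)
qed

lemma continuous_on_coordinate [continuous_intros]:
  "continuous_on A (\<lambda>z::nat \<Rightarrow> complex. z i)"
  by (rule continuous_on_subset[OF continuous_on_product_coordinates subset_UNIV])

lemma continuous_on_snd_coordinate [continuous_intros]:
  "continuous_on A (\<lambda>p::'a::topological_space \<times> (nat \<Rightarrow> complex). snd p i)"
  by (rule continuous_on_product_then_coordinatewise) (intro continuous_intros)

text \<open>Continuity refers to the product topology on all functions, measurability to the product
  sigma-algebra over \<open>I\<close>; this is the passage from one to the other.\<close>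

lemma torus_identity_measurable: "(\<lambda>z. z) \<in> measurable (torus_measure I) (restrict_space borel (torus I))"
proof (rule measurable_restrict_space2)
  show "(\<lambda>z. z) \<in> borel_measurable (torus_measure I)"
  proof (rule measurable_coordinatewise_then_product)
    fix i
    show "(\<lambda>z. z i) \<in> borel_measurable (torus_measure I)"
    proof (cases "i \<in> I")
      case True
      then have "(\<lambda>z. z i) \<in> measurable (torus_measure I) circle_measure" by measurable
      from measurable_compose[OF this circle_measure_measurable_borel] show ?thesis .
    next
      case False
      have "(\<lambda>z. undefined) \<in> borel_measurable (torus_measure I)" by simp
      then show ?thesis
        by (rule measurable_cong[THEN iffD1, rotated]) (use False in \<open>simp add: torus_undefined\<close>)
    qed
  qed
qed auto

lemma torus_measurable:
  fixes h :: "(nat \<Rightarrow> complex) \<Rightarrow> complex"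
  assumes "continuous_on (torus I) h"
  shows "h \<in> borel_measurable (torus_measure I)"
  using measurable_compose[OF torus_identity_measurable borel_measurable_continuous_on_restrict[OF assms]] .

lemma compact_bounded_norm:
  fixes h :: "'a::topological_space \<Rightarrow> 'b::real_normed_vector"
  assumes "compact X" "continuous_on X h"
  shows "\<exists>B. \<forall>z\<in>X. norm (h z) \<le> B"
  using compact_imp_bounded[OF compact_continuous_image[OF assms(2,1)]] unfolding bounded_iff by auto

lemma torus_integrable:
  fixes h :: "(nat \<Rightarrow> complex) \<Rightarrow> complex"
  assumes "finite I" "continuous_on (torus I) h"
  shows "integrable (torus_measure I) h"
proof -
  obtain B where "\<And>z. z \<in> torus I \<Longrightarrow> norm (h z) \<le> B"
    using compact_bounded_norm[OF compact_torus assms(2)] by blast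
  then show ?thesis
    by (intro finite_measure.integrable_const_bound[OF torus_measure_finite[OF assms(1)], of _ B] torus_measurable assms) auto
qed

text \<open>Dominated convergence; compactness of \<open>K \<times> torus I\<close> supplies a
  constant as dominating function.\<close>

lemma torus_integral_tendsto:
  fixes F :: "'p::{second_countable_topology,metric_space} \<times> (nat \<Rightarrow> complex) \<Rightarrow> complex"
  assumes I: "finite I" and K: "compact K" and cont: "continuous_on (K \<times> torus I) F"
    and p: "\<And>n. p n \<in> K" "p0 \<in> K" "p \<longlonglongrightarrow> p0"
  shows "(\<lambda>n. \<integral>z. F (p n, z) \<partial>torus_measure I) \<longlonglongrightarrow> (\<integral>z. F (p0, z) \<partial>torus_measure I)"
proof -
  obtain B where B: "\<And>x. x \<in> K \<times> torus I \<Longrightarrow> norm (F x) \<le> B"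
    using compact_bounded_norm[OF compact_Times[OF K compact_torus] cont] by blast
  have meas: "(\<lambda>z. F (x, z)) \<in> borel_measurable (torus_measure I)" if "x \<in> K" for x
    by (rule torus_measurable, rule continuous_on_compose2[OF cont]) (use that in \<open>auto intro!: continuous_intros\<close>)
  show ?thesis
  proof (rule integral_dominated_convergence[where w="\<lambda>_. B"])
    show "integrable (torus_measure I) (\<lambda>_. B)"
      by (rule finite_measure.integrable_const[OF torus_measure_finite[OF I]])
    show "AE z in torus_measure I. (\<lambda>n. F (p n, z)) \<longlonglongrightarrow> F (p0, z)"
    proof (rule AE_I2)
      fix z assume "z \<in> space (torus_measure I)"
      then have z: "z \<in> torus I" by simp
      have "continuous_on K (\<lambda>x. F (x, z))"
        by (rule continuous_on_compose2[OF cont]) (use z in \<open>auto intro!: continuous_intros\<close>)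
      then show "(\<lambda>n. F (p n, z)) \<longlonglongrightarrow> F (p0, z)"
        using p by (auto simp: continuous_on_sequentially o_def)
    qed
    show "AE z in torus_measure I. norm (F (p n, z)) \<le> B" for n
      by (rule AE_I2) (use B p in auto)
  qed (use meas p in auto)
qed

text \<open>By Fubini in the coordinate \<open>i\<close>, each fibre of the diagonal has at most one
  point on the circle, and points are null.\<close>

lemma AE_torus_neq:
  assumes I: "finite I" and ij: "i \<in> I" "j \<in> I" "i \<noteq> j"
  shows "AE z in torus_measure I. z i \<noteq> z j"
proof -
  define I' where "I' = I - {i}"
  have I': "I = insert i I'" "i \<notin> I'" "finite I'" "j \<in> I'" using I ij by (auto simp: I'_def)
  have "continuous_on (torus I) (\<lambda>z. z i - z j)" by (intro continuous_intros)
  from torus_measurable[OF this] have [measurable]: "(\<lambda>z. z i - z j) \<in> borel_measurable (torus_measure I)" .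
  have "{z \<in> space (torus_measure I). z i - z j = 0} \<in> sets (torus_measure I)" by measurable
  then have m: "{z \<in> torus I. z i = z j} \<in> sets (torus_measure I)" by simp
  have "emeasure (torus_measure I) {z \<in> torus I. z i = z j}
      = (\<integral>\<^sup>+z. indicator {z \<in> torus I. z i = z j} z \<partial>torus_measure I)" using m by simp
  also have "\<dots> = (\<integral>\<^sup>+x. (\<integral>\<^sup>+y. indicator {z \<in> torus I. z i = z j} (x(i := y)) \<partial>circle_measure) \<partial>torus_measure I')"
    unfolding I'(1) by (rule circle.product_nn_integral_insert[OF I'(3,2)]) (use m in \<open>simp add: I'(1)\<close>)
  also have "\<dots> = (\<integral>\<^sup>+x. 0 \<partial>torus_measure I')"
  proof (rule nn_integral_cong)
    fix x :: "nat \<Rightarrow> complex"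
    have "(\<integral>\<^sup>+y. indicator {z \<in> torus I. z i = z j} (x(i := y)) \<partial>circle_measure) \<le> (\<integral>\<^sup>+y. indicator {x j} y \<partial>circle_measure)"
      by (rule nn_integral_mono) (use ij in \<open>auto simp: indicator_def\<close>)
    also have "\<dots> = 0"
    proof (cases "{x j} \<in> sets circle_measure")
      case True
      then show ?thesis by (simp add: circle_measure_singleton)
    next
      case False
      then have "norm (x j) \<noteq> 1" by (auto simp: sets_circle_measure sets_restrict_space_iff)
      then have "(\<integral>\<^sup>+y. indicator {x j} y \<partial>circle_measure) = (\<integral>\<^sup>+y. 0 \<partial>circle_measure)"
        by (intro nn_integral_cong) (auto simp: indicator_def)
      then show ?thesis by simp
    qed
    finally show "(\<integral>\<^sup>+y. indicator {z \<in> torus I. z i = z j} (x(i := y)) \<partial>circle_measure) = 0" by simp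
  qed
  finally have "emeasure (torus_measure I) {z \<in> torus I. z i = z j} = 0" by simp
  then show ?thesis
    by (intro AE_I[OF _ _ m]) auto
qed

text \<open>Both Gustafson's identity and the partial fraction expansion require distinct variables;
  under the integral this excludes only a null set.\<close>

lemma AE_torus_inj:
  assumes "finite I"
  shows "AE z in torus_measure I. inj_on z I"
proof -
  have "AE z in torus_measure I. \<forall>i\<in>I. \<forall>j\<in>I - {i}. z i \<noteq> z j"
    using AE_torus_neq[OF assms] assms by (intro AE_finite_allI) auto
  then show ?thesis
  proof eventually_elim
    case (elim z)
    show ?case
    proof (rule inj_onI)
      fix i j assume "i \<in> I" "j \<in> I" "z i = z j"
      with elim show "i = j" by blast
    qed
  qed
qed

definition scale :: "nat set \<Rightarrow> complex \<Rightarrow> (nat \<Rightarrow> complex) \<Rightarrow> nat \<Rightarrow> complex"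
  where "scale S c z = (\<lambda>i. if i \<in> S then c * z i else z i)"

lemma scale_scale: "scale S c (scale S d z) = scale S (c * d) z"
  by (auto simp: scale_def)

lemma scale_1 [simp]: "scale S 1 z = z"
  by (auto simp: scale_def)

lemma scale_torus: "norm c = 1 \<Longrightarrow> S \<subseteq> I \<Longrightarrow> z \<in> torus I \<Longrightarrow> scale S c z \<in> torus I"
  by (rule torusI) (auto simp: scale_def norm_mult torus_undefined)

lemma continuous_on_scale: "continuous_on A (\<lambda>p. scale S (fst p) (snd p))"
  unfolding scale_def
proof (rule continuous_on_coordinatewise_then_product)
  fix i
  show "continuous_on A (\<lambda>p. if i \<in> S then fst p * snd p i else snd p i)"
    by (cases "i \<in> S") (auto intro!: continuous_intros)
qed

lemma scale_measurable:
  assumes c: "norm c = 1" "S \<subseteq> I"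
  shows "scale S c \<in> measurable (torus_measure I) (torus_measure I)"
proof (rule measurable_PiM_single')
  show "(\<lambda>z. scale S c z i) \<in> measurable (torus_measure I) circle_measure" if "i \<in> I" for i
  proof (cases "i \<in> S")
    case True
    have "(\<lambda>z. z i) \<in> measurable (torus_measure I) circle_measure" using that by measurable
    from measurable_compose[OF this measurable_circle_mult[OF c(1)]] show ?thesis
      using True by (simp add: scale_def)
  qed (use that in \<open>simp add: scale_def\<close>)
  show "scale S c \<in> space (torus_measure I) \<rightarrow> (\<Pi>\<^sub>E i\<in>I. space circle_measure)"
    using scale_torus[OF c] by (auto simp: torus_def)
qed

lemma torus_rotate:
  assumes I: "finite I" and c: "norm c = 1" "S \<subseteq> I"
  shows "distr (torus_measure I) (torus_measure I) (scale S c) = torus_measure I"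
proof (rule circle.PiM_eqI[OF I])
  fix A :: "nat \<Rightarrow> complex set" assume A: "\<And>i. i \<in> I \<Longrightarrow> A i \<in> sets circle_measure"
  let ?B = "\<lambda>i. if i \<in> S then (\<lambda>z. c * z) -` A i \<inter> unit_circle else A i"
  have B: "?B i \<in> sets circle_measure" if "i \<in> I" for i
    using measurable_sets[OF measurable_circle_mult[OF c(1)] A[OF that]] A[OF that] by simp
  have "emeasure (distr (torus_measure I) (torus_measure I) (scale S c)) (Pi\<^sub>E I A) =
      emeasure (torus_measure I) (scale S c -` Pi\<^sub>E I A \<inter> torus I)"
    using A I by (subst emeasure_distr[OF scale_measurable[OF c]]) (auto intro!: sets_PiM_I_finite)
  also have "scale S c -` Pi\<^sub>E I A \<inter> torus I = Pi\<^sub>E I ?B"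
  proof -
    have "norm x = 1" if "i \<in> I" "x \<in> A i" for i x using sets.sets_into_space[OF A[OF that(1)]] that(2) by auto
    then have *: "z \<in> Pi\<^sub>E I A \<Longrightarrow> z \<in> torus I" "z \<in> Pi\<^sub>E I ?B \<Longrightarrow> z \<in> torus I" for z
      unfolding torus_def PiE_iff by (fastforce split: if_splits)+
    have "scale S c z \<in> Pi\<^sub>E I A \<longleftrightarrow> z \<in> Pi\<^sub>E I ?B" if "z \<in> torus I" for z
      using that scale_torus[OF c that] unfolding PiE_iff torus_def by (auto simp: scale_def)
    then show ?thesis using * by blast
  qed
  also have "emeasure (torus_measure I) (Pi\<^sub>E I ?B) = (\<Prod>i\<in>I. emeasure circle_measure (?B i))"
    by (rule circle.emeasure_PiM[OF I B])
  also have "\<dots> = (\<Prod>i\<in>I. emeasure circle_measure (A i))"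
  proof (rule prod.cong[OF refl])
    fix i assume "i \<in> I"
    have "emeasure (distr circle_measure circle_measure (\<lambda>z. c * z)) (A i) = emeasure circle_measure ((\<lambda>z. c * z) -` A i \<inter> unit_circle)"
      using emeasure_distr[OF measurable_circle_mult[OF c(1)] A[OF \<open>i \<in> I\<close>]] by simp
    then show "emeasure circle_measure (?B i) = emeasure circle_measure (A i)"
      using circle_measure_rotate[OF c(1)] by simp
  qed
  finally show "emeasure (distr (torus_measure I) (torus_measure I) (scale S c)) (Pi\<^sub>E I A) = (\<Prod>i\<in>I. emeasure circle_measure (A i))" .
qed simp

lemma integral_torus_rotate:
  fixes h :: "(nat \<Rightarrow> complex) \<Rightarrow> complex"
  assumes I: "finite I" and c: "norm c = 1" "S \<subseteq> I" and h: "continuous_on (torus I) h"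
  shows "(\<integral>z. h (scale S c z) \<partial>torus_measure I) = integral\<^sup>L (torus_measure I) h"
  using integral_distr[OF scale_measurable[OF c] torus_measurable[OF h]] torus_rotate[OF I c] by simp

text \<open>The integral is averaged over all rotations of the coordinates in \<open>S\<close>, which leaves a
  one-dimensional circular mean.\<close>
theorem torus_scale:
  fixes h :: "(nat \<Rightarrow> complex) \<Rightarrow> complex"
  assumes I: "finite I" "S \<subseteq> I"
    and hol: "\<And>z. z \<in> torus I \<Longrightarrow> (\<lambda>c. h (scale S c z)) holomorphic_on {c. r1 < norm c \<and> norm c < r2}"
    and r: "0 \<le> r1" "r1 < 1" "1 < r2" and c: "r1 < norm c" "norm c < r2"
    and cont: "continuous_on (torus I) h" "continuous_on (torus I) (\<lambda>z. h (scale S c z))"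
  shows "(\<integral>z. h (scale S c z) \<partial>torus_measure I) = integral\<^sup>L (torus_measure I) h"
proof -
  interpret T: finite_measure "torus_measure I" by (rule torus_measure_finite[OF I(1)])
  interpret C: finite_measure circle_measure by (rule circle_measure_finite)
  interpret CT: pair_sigma_finite circle_measure "torus_measure I" ..
  interpret CTf: finite_measure "circle_measure \<Otimes>\<^sub>M torus_measure I"
    by (rule finite_measure_pair_measure[OF torus_measure_finite[OF I(1)] circle_measure_finite])
  have avg: "integral\<^sup>L (torus_measure I) g = (\<integral>z. (\<integral>w. g (scale S w z) \<partial>circle_measure) \<partial>torus_measure I)"
    if g: "continuous_on (torus I) g" for g :: "(nat \<Rightarrow> complex) \<Rightarrow> complex"
  proof -
    define k where "k = (\<lambda>p. g (scale S (fst p) (snd p)))"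
    have kc: "continuous_on (unit_circle \<times> torus I) k"
      unfolding k_def
      by (rule continuous_on_compose2[OF g continuous_on_scale]) (use I in \<open>auto intro!: scale_torus\<close>)
    obtain B where B: "\<And>x. x \<in> unit_circle \<times> torus I \<Longrightarrow> norm (k x) \<le> B"
      using compact_bounded_norm[OF compact_Times[OF compact_sphere compact_torus] kc] by blast
    have km: "k \<in> borel_measurable (circle_measure \<Otimes>\<^sub>M torus_measure I)"
    proof -
      have "(\<lambda>p. (fst p, snd p)) \<in> measurable (circle_measure \<Otimes>\<^sub>M torus_measure I) (borel \<Otimes>\<^sub>M borel)"
      proof (rule measurable_Pair)
        show "fst \<in> borel_measurable (circle_measure \<Otimes>\<^sub>M torus_measure I)"
          using measurable_compose[OF measurable_fst circle_measure_measurable_borel] by simp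
        have "(\<lambda>z. z) \<in> borel_measurable (torus_measure I)"
          using measurable_compose[OF torus_identity_measurable measurable_restrict_space1[OF measurable_ident]] by simp
        from measurable_compose[OF measurable_snd this]
        show "snd \<in> borel_measurable (circle_measure \<Otimes>\<^sub>M torus_measure I)" .
      qed
      then have "(\<lambda>p. p) \<in> measurable (circle_measure \<Otimes>\<^sub>M torus_measure I) (restrict_space borel (unit_circle \<times> torus I))"
        by (intro measurable_restrict_space2) (auto simp: space_pair_measure borel_prod)
      from measurable_compose[OF this borel_measurable_continuous_on_restrict[OF kc]] show ?thesis .
    qed
    have int: "integrable (circle_measure \<Otimes>\<^sub>M torus_measure I) (case_prod (\<lambda>w z. g (scale S w z)))"
    proof -
      have "integrable (circle_measure \<Otimes>\<^sub>M torus_measure I) k"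
        by (rule CTf.integrable_const_bound[of _ B]) (use B km in \<open>auto simp: space_pair_measure\<close>)
      then show ?thesis by (simp add: k_def case_prod_beta')
    qed
    have "(\<integral>z. (\<integral>w. g (scale S w z) \<partial>circle_measure) \<partial>torus_measure I) =
       (\<integral>w. (\<integral>z. g (scale S w z) \<partial>torus_measure I) \<partial>circle_measure)"
      by (rule CT.Fubini_integral[OF int])
    also have "\<dots> = (\<integral>w. integral\<^sup>L (torus_measure I) g \<partial>circle_measure)"
      by (rule Bochner_Integration.integral_cong[OF refl]) (use integral_torus_rotate[OF I(1) _ I(2) g] in auto)
    also have "\<dots> = integral\<^sup>L (torus_measure I) g"
      by (simp add: measure_def emeasure_circle_measure_space)
    finally show ?thesis by simp
  qed
  have "integral\<^sup>L (torus_measure I) h = (\<integral>z. (\<integral>w. h (scale S (1 * w) z) \<partial>circle_measure) \<partial>torus_measure I)"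
    using avg[OF cont(1)] by simp
  also have "\<dots> = (\<integral>z. (\<integral>w. h (scale S (c * w) z) \<partial>circle_measure) \<partial>torus_measure I)"
    by (intro Bochner_Integration.integral_cong refl circle_mean_annulus[OF hol]) (use r c in auto)
  also have "\<dots> = (\<integral>z. h (scale S c z) \<partial>torus_measure I)"
    using avg[OF cont(2)] by (simp add: scale_scale)
  finally show ?thesis by simp
qed

text \<open>Each index lies in \<open>card I - 1\<close> pairs.\<close>

lemma prod_pairs_factors:
  fixes f :: "nat \<Rightarrow> complex"
  assumes "finite I"
  shows "(\<Prod>(j,k)\<in>pairs I. f j * f k) = (\<Prod>i\<in>I. f i ^ (card I - 1))"
  using assms
proof (induction I rule: finite_induct)
  case empty
  then show ?case by simp
next
  case (insert i I)
  have "(\<Prod>(j,k)\<in>pairs (insert i I). f j * f k) = (\<Prod>k\<in>I. f i * f k) * (\<Prod>(j,k)\<in>pairs I. f j * f k)"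
    using insert(1,2) by (intro prod_pairs_insert) (auto simp: mult.commute)
  also have "\<dots> = f i ^ card I * (\<Prod>k\<in>I. f k * f k ^ (card I - 1))"
    by (simp add: insert.IH prod.distrib)
  also have "(\<Prod>k\<in>I. f k * f k ^ (card I - 1)) = (\<Prod>k\<in>I. f k ^ card I)"
  proof (rule prod.cong[OF refl])
    fix k assume "k \<in> I"
    then have "card I = Suc (card I - 1)" using insert(1) by (cases "card I") auto
    then show "f k * f k ^ (card I - 1) = f k ^ card I" by (metis power_Suc)
  qed
  finally show ?case using insert(1,2) by simp
qed

section \<open>The weight with \<epsilon> eliminated\<close>

context nome begin

definition pair_weight :: "complex \<Rightarrow> complex \<Rightarrow> complex \<Rightarrow> complex \<Rightarrow> complex \<Rightarrow> complex"
  where "pair_weight t E m x y =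
    (1 - E * x * y) * (P (x / y) * P (y / x)) / (P (t * x / y) * P (t * y / x)) *
    (P (m * x * y) / P (t * E * x * y))"

text \<open>The factors with \<plusminus>\<epsilon> have telescoped to 1 - E x^2, so no square root
  of \<open>E\<close> enters. The numbers \<open>c1\<close> to \<open>c4\<close> stand for q E /
  b_k, and \<open>al\<close> for the constant in the first theta function.\<close>

definition single_weight where
  "single_weight a1 a2 b1 b2 b3 b4 c1 c2 c3 c4 E al v x =
    (1 - E * x\<^sup>2) * (Th (al / x) * Th (v * x)) /
    (P (a1 * E * x) * P (a1 / x) * P (a2 * E * x) * P (a2 / x)) *
    (P (c1 * x) * P (c2 * x) * P (c3 * x) * P (c4 * x)) / (P (b1 * x) * P (b2 * x) * P (b3 * x) * P (b4 * x))"

text \<open>The parameter \<open>E\<close> is \<open>\<epsilon>\<^sup>2\<close> as determined by the balancing condition, and the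
  numerator parameters \<open>q b\<^sub>k\<^sup>-\<^sup>1 \<epsilon>\<^sup>2\<close> are written without division, so that
  the weight makes sense at \<open>b\<^sub>k = 0\<close>.\<close>
definition weight :: "nat set \<Rightarrow> complex \<Rightarrow> complex \<Rightarrow> complex \<Rightarrow> complex \<Rightarrow> complex \<Rightarrow> complex \<Rightarrow> complex \<Rightarrow> complex \<Rightarrow> (nat \<Rightarrow> complex) \<Rightarrow> complex"
  where "weight I t v a1 a2 b1 b2 b3 b4 z =
    (let n = card I; M = a1 * a2 * t ^ (2 * n - 2); E = M * b1 * b2 * b3 * b4 / q
     in (\<Prod>i\<in>I. single_weight a1 a2 b1 b2 b3 b4
           (M * b2 * b3 * b4) (M * b1 * b3 * b4) (M * b1 * b2 * b4) (M * b1 * b2 * b3) E (t ^ (n - 1) * a1 * a2 * v) v (z i)) *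
        (\<Prod>(j,k)\<in>pairs I. pair_weight t E (M * b1 * b2 * b3 * b4 / t) (z j) (z k)))"

end

section \<open>Multiplication of the parameter \<open>b4\<close> by \<open>q\<close>\<close>

locale half_shift = nome +
  fixes a1 a2 b1 b2 b3 b4 t v :: complex and n :: nat
  assumes nz: "a1 \<noteq> 0" "a2 \<noteq> 0" "b1 \<noteq> 0" "b2 \<noteq> 0" "b3 \<noteq> 0" "b4 \<noteq> 0" "t \<noteq> 0" "v \<noteq> 0"
    and lt1: "norm a1 < 1" "norm a2 < 1" "norm b1 < 1" "norm b2 < 1" "norm b3 < 1" "norm b4 < 1" "norm t < 1"
    and E_lt1: "norm (a1 * a2 * t ^ (2 * n - 2) * b1 * b2 * b3 * b4 / q) < 1"
begin

definition "M = a1 * a2 * t ^ (2 * n - 2)"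
definition "E = M * b1 * b2 * b3 * b4 / q"
definition "K = t ^ (n - 1) * a1 * a2 * b4"
definition "al = t ^ (n - 1) * a1 * a2 * v"
definition "m = M * b1 * b2 * b3 * b4 / t"

abbreviation "single \<equiv> single_weight a1 a2 b1 b2 b3 b4
  (M * b2 * b3 * b4) (M * b1 * b3 * b4) (M * b1 * b2 * b4) (M * b1 * b2 * b3) E al v"
abbreviation "single' \<equiv> single_weight a1 a2 b1 b2 b3 (q * b4)
  (q * (M * b2 * b3 * b4)) (q * (M * b1 * b3 * b4)) (q * (M * b1 * b2 * b4)) (M * b1 * b2 * b3) (q * E) al v"
abbreviation "pair \<equiv> pair_weight t E m"
abbreviation "pair' \<equiv> pair_weight t (q * E) (q * m)"

text \<open>The flag is true for the variables in the shifted set \<open>S\<close>; a mixed pair has its second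
  variable in \<open>S\<close>. In both definitions the factor of the Gustafson summand has been cancelled, which
  leaves no pole between the unit circle and its image under the shift.\<close>
definition term_single :: "bool \<Rightarrow> complex \<Rightarrow> complex" where
  "term_single s x = (if s then
     x * b4 * (1 - K * E * x) * (Th (al / x) * Th (v * x)) /
     (P (a1 * E * x) * P (q * (a1 / x)) * P (a2 * E * x) * P (q * (a2 / x))) *
     (P (M * b2 * b3 * b4 * x) * P (M * b1 * b3 * b4 * x) * P (M * b1 * b2 * b4 * x) * P (M * b1 * b2 * b3 * x / q)) /
     (P (b1 * x) * P (b2 * x) * P (b3 * x) * P (b4 * x))
   else
     (1 - K / x) * (Th (al / x) * Th (v * x)) /
     (P (q * (a1 * E * x)) * P (a1 / x) * P (q * (a2 * E * x)) * P (a2 / x)) *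
     (P (M * b2 * b3 * b4 * x) * P (M * b1 * b3 * b4 * x) * P (M * b1 * b2 * b4 * x) * P (M * b1 * b2 * b3 * x)) /
     (P (b1 * x) * P (b2 * x) * P (b3 * x) * P (q * (b4 * x))))"

definition term_mixed :: "complex \<Rightarrow> complex \<Rightarrow> complex" where
  "term_mixed x y = (1 - E * x * y) * (P (q * (x / y)) * P (y / x)) / (P (q * (t * x / y)) * P (t * y / x)) *
     (P (m * x * y) / P (t * E * x * y))"

definition term_pair :: "bool \<Rightarrow> bool \<Rightarrow> complex \<Rightarrow> complex \<Rightarrow> complex" where
  "term_pair s s' x y =
    (if s then if s' then
       t * ((P (x / y) * P (y / x)) / (P (t * x / y) * P (t * y / x)) * (P (m * x * y / q) / P (t * E * x * y)))
     else term_mixed y x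
     else if s' then term_mixed x y
     else (P (x / y) * P (y / x)) / (P (t * x / y) * P (t * y / x)) * (P (m * x * y) / P (q * (t * E * x * y))))"

definition "shift_term I S z = (\<Prod>i\<in>I. term_single (i \<in> S) (z i)) *
  (\<Prod>(j,k)\<in>pairs I. term_pair (j \<in> S) (k \<in> S) (z j) (z k))"

lemma E_nz: "E \<noteq> 0"
  using nz q_nz by (auto simp: M_def E_def)

text \<open>For \<open>e\<close> a square root of \<open>E\<close>, Gustafson's identity is applied
  to the variables e z_i, so that a sign change sends z to 1 / (E z). The parameters are chosen such
  that each factor moves a q-shifted factorial of the weight by one step. The primed version belongs
  to the parameters after the shift: there \<open>e\<close> is a square root of
  \<open>q * E\<close>, and \<open>t\<close> is inverted.\<close>

abbreviation "factor e s x \<equiv>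
  gustafson_single (t ^ (n - 1) * (e * a1) * (e * a2) * (b4 / e)) (e * a1) (e * a2) (b4 / e) (flip s (e * x))"
abbreviation "factor' e s x \<equiv>
  gustafson_single ((1 / t) ^ (n - 1) * (e / b1) * (e / b2) * (e / b3)) (e / b1) (e / b2) (e / b3) (flip s (e * x))"

lemma E_less_1: "norm E < 1"
  using E_lt1 by (simp add: E_def M_def)

text \<open>Every parameter in a denominator has modulus at most \<open>\<rho>\<close>. After the
  cancellations in \<open>term_single\<close> and \<open>term_mixed\<close>, a shifted variable
  therefore meets no pole in the annulus from |q| \<rho> to 1 / \<rho>, which contains the circles
  of radius 1 and |q|.\<close>

definition "\<rho> = Max {norm a1, norm a2, norm b1, norm b2, norm b3, norm b4, norm t, norm E}"

lemma rho: "0 < \<rho>" "\<rho> < 1" "norm a1 \<le> \<rho>" "norm a2 \<le> \<rho>" "norm b1 \<le> \<rho>" "norm b2 \<le> \<rho>" "norm b3 \<le> \<rho>"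
  "norm b4 \<le> \<rho>" "norm t \<le> \<rho>" "norm E \<le> \<rho>"
proof -
  show le: "norm a1 \<le> \<rho>" "norm a2 \<le> \<rho>" "norm b1 \<le> \<rho>" "norm b2 \<le> \<rho>" "norm b3 \<le> \<rho>"
    "norm b4 \<le> \<rho>" "norm t \<le> \<rho>" "norm E \<le> \<rho>"
    unfolding \<rho>_def by (rule Max_ge; simp)+
  show "0 < \<rho>" using le(1) nz(1) by (meson less_le_trans zero_less_norm_iff)
  show "\<rho> < 1" unfolding \<rho>_def using lt1 E_less_1 by (subst Max_less_iff) auto
qed

lemma P_nz_upper:
  assumes "norm u \<le> \<rho>" "norm x < 1 / \<rho>"
  shows "P (u * x) \<noteq> 0"
proof (rule P_nonzero)
  have "norm (u * x) \<le> \<rho> * norm x" unfolding norm_mult using assms by (intro mult_right_mono) auto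
  also have "\<dots> < 1" using assms rho(1) by (simp add: field_simps)
  finally show "norm (u * x) < 1" .
qed

lemma P_nz_upper2:
  assumes "norm u \<le> \<rho>" "norm w \<le> \<rho>" "norm x < 1 / \<rho>" "norm y < 1 / \<rho>"
  shows "P (u * w * x * y) \<noteq> 0"
proof (rule P_nonzero)
  have "norm u * norm x \<le> \<rho> * norm x" using assms by (intro mult_right_mono) auto
  then have 1: "norm u * norm x < 1" using assms rho(1) by (simp add: field_simps)
  have "norm w * norm y \<le> \<rho> * norm y" using assms by (intro mult_right_mono) auto
  then have 2: "norm w * norm y < 1" using assms rho(1) by (simp add: field_simps)
  have "(norm u * norm x) * (norm w * norm y) < 1"
    using mult_strict_mono[OF 1 2] by simp
  then show "norm (u * w * x * y) < 1" by (simp add: norm_mult mult_ac)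
qed

lemma P_nz_lower:
  assumes "norm u \<le> \<rho>" "norm q * \<rho> < norm x"
  shows "P (q * (u / x)) \<noteq> 0"
proof (rule P_nonzero)
  have "norm (q * u) \<le> norm q * \<rho>" unfolding norm_mult using assms by (intro mult_left_mono) auto
  then have "norm (q * u) < norm x" using assms by linarith
  then show "norm (q * (u / x)) < 1" by (auto simp: norm_mult norm_divide divide_simps)
qed

lemma P_nz_unit: "norm u \<le> \<rho> \<Longrightarrow> norm x = 1 \<Longrightarrow> P (u / x) \<noteq> 0"
  using rho(2) by (intro P_nonzero) (simp add: norm_divide)

lemma unit_less: "norm (x::complex) = 1 \<Longrightarrow> norm x < 1 / \<rho>"
  using rho(1,2) by (simp add: field_simps)

lemma aE_le: "norm u \<le> \<rho> \<Longrightarrow> norm (u * E) \<le> \<rho>"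
  using E_less_1 mult_mono[of "norm u" \<rho> "norm E" 1] rho(1) by (simp add: norm_mult)

lemma q_le: "norm u \<le> \<rho> \<Longrightarrow> norm (q * u) \<le> \<rho>"
  using q_less_1 mult_mono[of "norm q" 1 "norm u" \<rho>] rho(1) by (simp add: norm_mult)

end

context nome begin

lemma P_nz_1: "norm u < 1 \<Longrightarrow> norm x = 1 \<Longrightarrow> P (u * x) \<noteq> 0" "norm u < 1 \<Longrightarrow> norm x = 1 \<Longrightarrow> P (u / x) \<noteq> 0"
  by (rule P_nonzero, simp add: norm_mult norm_divide)+

lemma P_nz_2: "norm u < 1 \<Longrightarrow> norm w < 1 \<Longrightarrow> norm x = 1 \<Longrightarrow> P (u * w * x) \<noteq> 0"
  using mult_strict_mono[of "norm u" 1 "norm w" 1] by (intro P_nz_1) (simp_all add: norm_mult)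

text \<open>Parameters and variables may vary together with \<open>w\<close>: the later limits in
  the \<open>b\<close>s and in \<open>a2\<close> under the integral rest on joint
  continuity.\<close>

lemma continuous_weight:
  fixes f :: "'b::topological_space \<Rightarrow> nat \<Rightarrow> complex"
  assumes f: "\<And>i. i \<in> I \<Longrightarrow> continuous_on A (\<lambda>w. f w i)" "\<And>w i. w \<in> A \<Longrightarrow> i \<in> I \<Longrightarrow> norm (f w i) = 1"
    and cont: "continuous_on A v" "continuous_on A a1" "continuous_on A a2"
      "continuous_on A b1" "continuous_on A b2" "continuous_on A b3" "continuous_on A b4"
    and v: "\<And>w. w \<in> A \<Longrightarrow> v w \<noteq> 0"
    and a: "\<And>w. w \<in> A \<Longrightarrow> a1 w \<noteq> 0 \<and> norm (a1 w) < 1" "\<And>w. w \<in> A \<Longrightarrow> a2 w \<noteq> 0 \<and> norm (a2 w) < 1"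
    and b: "\<And>w. w \<in> A \<Longrightarrow> norm (b1 w) < 1" "\<And>w. w \<in> A \<Longrightarrow> norm (b2 w) < 1"
      "\<And>w. w \<in> A \<Longrightarrow> norm (b3 w) < 1" "\<And>w. w \<in> A \<Longrightarrow> norm (b4 w) < 1"
    and t: "t \<noteq> 0" "norm t < 1"
    and E: "\<And>w. w \<in> A \<Longrightarrow> norm (a1 w * a2 w * t ^ (2 * card I - 2) * b1 w * b2 w * b3 w * b4 w / q) < 1"
  shows "continuous_on A (\<lambda>w. weight I t (v w) (a1 w) (a2 w) (b1 w) (b2 w) (b3 w) (b4 w) (f w))"
proof -
  have f0: "f w i \<noteq> 0" if "w \<in> A" "i \<in> I" for w i using f(2)[OF that] by auto
  define E where "E = (\<lambda>w. a1 w * a2 w * t ^ (2 * card I - 2) * b1 w * b2 w * b3 w * b4 w / q)"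
  have Ec: "continuous_on A E" unfolding E_def by (intro continuous_intros cont) (simp add: q_nz)
  have E1: "norm (E w) < 1" if "w \<in> A" for w using E[OF that] by (simp add: E_def)
  have 1: "continuous_on A (\<lambda>w. single_weight (a1 w) (a2 w) (b1 w) (b2 w) (b3 w) (b4 w) (c1 w) (c2 w) (c3 w) (c4 w) (E w)
      (t ^ (card I - 1) * a1 w * a2 w * v w) (v w) (f w i))"
    if i: "i \<in> I" and c: "continuous_on A c1" "continuous_on A c2" "continuous_on A c3" "continuous_on A c4" for i c1 c2 c3 c4
    unfolding single_weight_def
    by (intro continuous_intros f cont c Ec i)
       (use i f f0 v a b t E1 P_nz_1 P_nz_2 in auto)
  have tf: "norm (t * f w j) = norm t" if "w \<in> A" "j \<in> I" for w j
    using that f(2) by (simp add: norm_mult)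
  have 2: "continuous_on A (\<lambda>w. pair_weight t (E w) (m w) (f w j) (f w k))"
    if jk: "j \<in> I" "k \<in> I" and m: "continuous_on A m" for j k m
  proof -
    have nz: "P (t * f w j / f w k) \<noteq> 0 \<and> P (t * f w k / f w j) \<noteq> 0 \<and> P (t * E w * f w j * f w k) \<noteq> 0" if w: "w \<in> A" for w
    proof (intro conjI)
      show "P (t * f w j / f w k) \<noteq> 0" "P (t * f w k / f w j) \<noteq> 0"
        using P_nz_1(2)[of "t * f w j" "f w k"] P_nz_1(2)[of "t * f w k" "f w j"] tf[OF w] f(2)[OF w] jk t(2) by auto
      show "P (t * E w * f w j * f w k) \<noteq> 0"
        using P_nz_2[of t "E w" "f w j * f w k"] t(2) E1[OF w] f(2)[OF w] jk by (simp add: norm_mult mult.assoc)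
    qed
    show ?thesis unfolding pair_weight_def
      by (intro continuous_intros f Ec m jk) (use jk f0 nz in auto)
  qed
  have 3: "continuous_on A (\<lambda>w. case p of (j, k) \<Rightarrow> pair_weight t (E w) (m w) (f w j) (f w k))"
    if "p \<in> pairs I" "continuous_on A m" for p m
    using that 2 by (cases p) (auto simp: pairs_def)
  define M where "M = (\<lambda>w. a1 w * a2 w * t ^ (2 * card I - 2))"
  define c1 where "c1 = (\<lambda>w. M w * b2 w * b3 w * b4 w)"
  define c2 where "c2 = (\<lambda>w. M w * b1 w * b3 w * b4 w)"
  define c3 where "c3 = (\<lambda>w. M w * b1 w * b2 w * b4 w)"
  define c4 where "c4 = (\<lambda>w. M w * b1 w * b2 w * b3 w)"
  define m where "m = (\<lambda>w. M w * b1 w * b2 w * b3 w * b4 w / t)"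
  have M: "continuous_on A M" unfolding M_def by (intro continuous_intros cont)
  have c: "continuous_on A c1" "continuous_on A c2" "continuous_on A c3" "continuous_on A c4"
    unfolding c1_def c2_def c3_def c4_def by (intro continuous_intros cont M)+
  have m: "continuous_on A m" unfolding m_def by (intro continuous_intros cont M) (simp add: t)
  have "weight I t (v w) (a1 w) (a2 w) (b1 w) (b2 w) (b3 w) (b4 w) (f w) =
    (\<Prod>i\<in>I. single_weight (a1 w) (a2 w) (b1 w) (b2 w) (b3 w) (b4 w) (c1 w) (c2 w) (c3 w) (c4 w) (E w)
      (t ^ (card I - 1) * a1 w * a2 w * v w) (v w) (f w i)) *
    (\<Prod>p\<in>pairs I. case p of (j, k) \<Rightarrow> pair_weight t (E w) (m w) (f w j) (f w k))" for w
    unfolding weight_def Let_def c1_def c2_def c3_def c4_def m_def E_def M_def ..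
  then show ?thesis
    by (simp only:) (intro continuous_on_mult continuous_on_prod 1 3 c m)
qed

end

context half_shift begin

lemma qE: "q * E = M * b1 * b2 * b3 * b4"
  using q_nz by (simp add: E_def)

lemma M_eq: "M * b4 = t ^ (n - 1) * K"
proof -
  have "2 * n - 2 = (n - 1) + (n - 1)" by simp
  then have "t ^ (2 * n - 2) = t ^ (n - 1) * t ^ (n - 1)" by (simp only: power_add)
  then show ?thesis by (simp add: M_def K_def mult_ac)
qed

lemma al_eq: "al * b4 = K * v"
  by (simp add: al_def K_def mult_ac)

lemma gustafson_plus:
  assumes e: "e\<^sup>2 = E" and x: "x \<noteq> 0"
  shows "factor e False x =
    (1 - a1 * E * x) * (1 - a2 * E * x) * (1 - b4 * x) * (1 - K / x) / (1 - E * x\<^sup>2)"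
proof -
  have "e \<noteq> 0" using e E_nz by auto
  then have 1: "e * a1 * (e * x) = a1 * E * x" "e * a2 * (e * x) = a2 * E * x" "b4 / e * (e * x) = b4 * x"
    "t ^ (n - 1) * (e * a1) * (e * a2) * (b4 / e) / (e * x) = K / x" "(e * x)\<^sup>2 = E * x\<^sup>2"
    using x by (simp_all add: K_def e[symmetric] power2_eq_square)
  show ?thesis unfolding gustafson_single_def flip_def if_False 1 by simp
qed

lemma gustafson_minus:
  assumes e: "e\<^sup>2 = E" and x: "x \<noteq> 0"
  shows "factor e True x =
    (1 - a1 / x) * (1 - a2 / x) * (1 - b4 / (E * x)) * (1 - K * E * x) / (1 - 1 / (E * x\<^sup>2))"
proof -
  have "e \<noteq> 0" using e E_nz by auto
  then have 1: "e * a1 * (1 / (e * x)) = a1 / x" "e * a2 * (1 / (e * x)) = a2 / x" "b4 / e * (1 / (e * x)) = b4 / (E * x)"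
    "t ^ (n - 1) * (e * a1) * (e * a2) * (b4 / e) / (1 / (e * x)) = K * E * x" "(1 / (e * x))\<^sup>2 = 1 / (E * x\<^sup>2)"
    using x by (simp_all add: K_def e[symmetric] power2_eq_square)
  show ?thesis unfolding gustafson_single_def flip_def if_True 1 by simp
qed

text \<open>The balancing condition enters here: since e^2 = M b1 b2 b3 b4, the fourth factor
  becomes the same \<open>1 - K / x\<close> as in \<open>gustafson_plus\<close>, although the two
  identities have different parameters.\<close>

lemma gustafson_plus':
  assumes e: "e\<^sup>2 = q * E" and x: "x \<noteq> 0"
  shows "factor' e False x =
    (1 - M * b2 * b3 * b4 * x) * (1 - M * b1 * b3 * b4 * x) * (1 - M * b1 * b2 * b4 * x) * (1 - K / x) / (1 - q * E * x\<^sup>2)"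
proof -
  have e2: "e * e = M * b1 * b2 * b3 * b4" using e qE by (simp add: power2_eq_square)
  have e0: "e \<noteq> 0" using e E_nz q_nz by auto
  have "(1 / t) ^ (n - 1) * (e / b1) * (e / b2) * (e / b3) / (e * x) = (e * e) / (t ^ (n - 1) * b1 * b2 * b3 * x)"
    using e0 x by (simp add: power_one_over)
  also have "\<dots> = (b1 * b2 * b3 * (M * b4)) / (t ^ (n - 1) * b1 * b2 * b3 * x)"
    by (simp add: e2 mult_ac)
  also have "\<dots> = K / x"
    unfolding M_eq using nz x by simp
  finally have 2: "(1 / t) ^ (n - 1) * (e / b1) * (e / b2) * (e / b3) / (e * x) = K / x" .
  have 1: "e / b1 * (e * x) = M * b2 * b3 * b4 * x" "e / b2 * (e * x) = M * b1 * b3 * b4 * x" "e / b3 * (e * x) = M * b1 * b2 * b4 * x"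
    "(e * x)\<^sup>2 = q * E * x\<^sup>2"
    using nz e2 by (simp_all add: field_simps e[symmetric] power2_eq_square)
  show ?thesis unfolding gustafson_single_def flip_def if_False 1 2 by simp
qed

lemma gustafson_minus':
  assumes e: "e\<^sup>2 = q * E" and x: "x \<noteq> 0"
  shows "factor' e True x =
    (1 - 1 / (b1 * x)) * (1 - 1 / (b2 * x)) * (1 - 1 / (b3 * x)) * (1 - K * (q * E) * x) / (1 - 1 / (q * E * x\<^sup>2))"
proof -
  have e2: "e * e = M * b1 * b2 * b3 * b4" using e qE by (simp add: power2_eq_square)
  have e0: "e \<noteq> 0" using e E_nz q_nz by auto
  have "(1 / t) ^ (n - 1) * (e / b1) * (e / b2) * (e / b3) / (1 / (e * x)) = (e * e) / (t ^ (n - 1) * b1 * b2 * b3) * e\<^sup>2 * x"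
    using e0 x by (simp add: power_one_over power2_eq_square)
  also have "\<dots> = (b1 * b2 * b3 * (M * b4)) / (t ^ (n - 1) * b1 * b2 * b3) * (q * E) * x"
    by (simp add: e2 e mult_ac)
  also have "\<dots> = K * (q * E) * x"
    unfolding M_eq using nz x by simp
  finally have 2: "(1 / t) ^ (n - 1) * (e / b1) * (e / b2) * (e / b3) / (1 / (e * x)) = K * (q * E) * x" .
  have 1: "e / b1 * (1 / (e * x)) = 1 / (b1 * x)" "e / b2 * (1 / (e * x)) = 1 / (b2 * x)" "e / b3 * (1 / (e * x)) = 1 / (b3 * x)"
    "(1 / (e * x))\<^sup>2 = 1 / (q * E * x\<^sup>2)"
    using e0 by (simp_all add: e[symmetric] power2_eq_square)
  show ?thesis unfolding gustafson_single_def flip_def if_True 1 2 by simp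
qed

lemma divide_one_minus_inverse: "y \<noteq> 0 \<Longrightarrow> 1 - y \<noteq> 0 \<Longrightarrow> (1 - y) / (1 - 1 / y) = - (y::complex)"
proof -
  assume y: "y \<noteq> 0" "1 - y \<noteq> 0"
  have "1 - 1 / y = - ((1 - y) / y)" using y by (simp add: diff_divide_distrib)
  then show ?thesis using y by simp
qed

lemma E_x2_ne_1: "norm x = 1 \<Longrightarrow> 1 - E * x\<^sup>2 \<noteq> 0" and qE_x2_ne_1: "norm x = 1 \<Longrightarrow> 1 - q * E * x\<^sup>2 \<noteq> 0"
proof -
  assume x: "norm x = 1"
  have *: "1 - u * x\<^sup>2 \<noteq> 0" if "norm u < 1" for u
  proof
    assume "1 - u * x\<^sup>2 = 0"
    then have "norm (u * x\<^sup>2) = 1" by simp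
    then show False using that x by (simp add: norm_mult norm_power)
  qed
  show "1 - E * x\<^sup>2 \<noteq> 0" by (rule * [OF E_less_1])
  show "1 - q * E * x\<^sup>2 \<noteq> 0" by (rule * [OF norm_q_mult_less[OF E_less_1]])
qed

lemma P_nz_simps:
  assumes "norm x = 1"
  shows "P (b1 * x) \<noteq> 0" "P (b2 * x) \<noteq> 0" "P (b3 * x) \<noteq> 0" "P (b4 * x) \<noteq> 0" "P (q * (b4 * x)) \<noteq> 0"
    "P (a1 * E * x) \<noteq> 0" "P (a2 * E * x) \<noteq> 0" "P (a1 / x) \<noteq> 0" "P (a2 / x) \<noteq> 0"
  using P_nz_upper[OF q_le[OF rho(8)] unit_less[OF assms]]
  by (auto simp: mult.assoc dest: P_nz_upper[OF rho(5) unit_less[OF assms], THEN notE]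
      P_nz_upper[OF rho(6) unit_less[OF assms], THEN notE] P_nz_upper[OF rho(7) unit_less[OF assms], THEN notE]
      P_nz_upper[OF rho(8) unit_less[OF assms], THEN notE]
      P_nz_upper[OF aE_le[OF rho(3)] unit_less[OF assms], unfolded mult.assoc, THEN notE]
      P_nz_upper[OF aE_le[OF rho(4)] unit_less[OF assms], unfolded mult.assoc, THEN notE]
      P_nz_unit[OF rho(3) assms, THEN notE] P_nz_unit[OF rho(4) assms, THEN notE])

lemma single_plus:
  assumes "norm x = 1" "e\<^sup>2 = E"
  shows "single x * factor e False x
    = term_single False x"
proof -
  have x: "x \<noteq> 0" using assms by auto
  note P_nz = P_nz_simps[OF assms(1)]
  have r: "P (a1 * E * x) = (1 - a1 * E * x) * P (q * (a1 * E * x))" "P (a2 * E * x) = (1 - a2 * E * x) * P (q * (a2 * E * x))"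
    "P (b4 * x) = (1 - b4 * x) * P (q * (b4 * x))" by (rule P_rec)+
  have *: "(w * T) / ((f1 * A1) * A' * (f2 * A2) * B') * C / (D * (f3 * B)) * (f1 * f2 * f3 * k / w) =
     k * T / (A1 * A' * A2 * B') * C / (D * B)"
    if "w \<noteq> 0" "f1 * A1 \<noteq> 0" "f2 * A2 \<noteq> 0" "f3 * B \<noteq> 0" for w T f1 A1 A' f2 A2 B' C D f3 B k :: complex
    using that by (simp add: field_simps)
  show ?thesis
    unfolding gustafson_plus[OF assms(2) x] term_single_def single_weight_def if_False
    using *[OF E_x2_ne_1[OF assms(1)], of "1 - a1 * E * x" "P (q * (a1 * E * x))" "1 - a2 * E * x" "P (q * (a2 * E * x))"
       "1 - b4 * x" "P (q * (b4 * x))", folded r, OF P_nz(6,7,4)] by blast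
qed

text \<open>The inverted denominator leaves -E x^2 from 1 - E x^2. Combined with 1 - b4 / (E x) this
  becomes x b4 (1 - E x / b4), and the last factor extends the q-shifted factorial of
  \<open>M * b1 * b2 * b3 * x\<close> by one step. The factors 1 - a_j / x remove the poles at
  \<open>a1\<close> and \<open>a2\<close>.\<close>

lemma single_minus:
  assumes "norm x = 1" "e\<^sup>2 = E"
  shows "single x * factor e True x
    = term_single True x"
proof -
  have x: "x \<noteq> 0" using assms by auto
  note P_nz = P_nz_simps[OF assms(1)]
  have r: "P (a1 / x) = (1 - a1 / x) * P (q * (a1 / x))" "P (a2 / x) = (1 - a2 / x) * P (q * (a2 / x))"
    by (rule P_rec)+
  have c4: "M * b1 * b2 * b3 / q = E / b4" using nz q_nz by (simp add: E_def)
  have rc: "P (M * b1 * b2 * b3 * x / q) = (1 - E * x / b4) * P (M * b1 * b2 * b3 * x)"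
  proof -
    have "M * b1 * b2 * b3 * x / q = E * x / b4" using c4 by (metis times_divide_eq_left)
    then have "1 - E * x / b4 = 1 - M * b1 * b2 * b3 * x / q" by simp
    moreover have "P (M * b1 * b2 * b3 * x / q) = (1 - M * b1 * b2 * b3 * x / q) * P (M * b1 * b2 * b3 * x)"
      using P_rec[of "M * b1 * b2 * b3 * x / q"] q_nz by simp
    ultimately show ?thesis by (simp only:)
  qed
  have Ex: "(1 - E * x\<^sup>2) / (1 - 1 / (E * x\<^sup>2)) = - (E * x\<^sup>2)"
    using E_x2_ne_1[OF assms(1)] x E_nz by (intro divide_one_minus_inverse) auto
  have b: "- (E * x\<^sup>2) * (1 - b4 / (E * x)) = x * b4 * (1 - E * x / b4)"
    using nz x E_nz by (simp add: field_simps power2_eq_square)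
  have *: "(w * T) / (A * (f1 * A1) * B * (f2 * A2)) * (C * C4) / D * (f1 * f2 * g * k / w') =
     ((w / w') * g) * k * T / (A * A1 * B * A2) * (C * C4) / D"
    if "f1 * A1 \<noteq> 0" "f2 * A2 \<noteq> 0" for w w' g T f1 A1 A f2 A2 B C C4 D k :: complex
    using that by (simp add: mult_ac)
  have **: "(u * g) * k * T / N * (C * C4) / D = u * k * T / N * (C * (g * C4)) / D" for u k T N C C4 D g :: complex
    by (simp add: mult_ac)
  show ?thesis
    unfolding gustafson_minus[OF assms(2) x] term_single_def single_weight_def if_True rc
    unfolding *[of "1 - a1 / x" "P (q * (a1 / x))" "1 - a2 / x" "P (q * (a2 / x))", folded r, OF P_nz(8,9)]
    unfolding Ex b ** ..
qed

lemma single_plus':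
  assumes "norm x = 1" "e\<^sup>2 = q * E"
  shows "single' x * factor' e False x
    = term_single False x"
proof -
  have x: "x \<noteq> 0" using assms by auto
  have r: "P (M * b2 * b3 * b4 * x) = (1 - M * b2 * b3 * b4 * x) * P (q * (M * b2 * b3 * b4) * x)"
    "P (M * b1 * b3 * b4 * x) = (1 - M * b1 * b3 * b4 * x) * P (q * (M * b1 * b3 * b4) * x)"
    "P (M * b1 * b2 * b4 * x) = (1 - M * b1 * b2 * b4 * x) * P (q * (M * b1 * b2 * b4) * x)"
    using P_rec[of "M * b2 * b3 * b4 * x"] P_rec[of "M * b1 * b3 * b4 * x"] P_rec[of "M * b1 * b2 * b4 * x"]
    by (simp_all only: mult.assoc)
  have a: "a1 * (q * E) * x = q * (a1 * E * x)" "a2 * (q * E) * x = q * (a2 * E * x)" "q * b4 * x = q * (b4 * x)"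
    by (simp_all only: mult_ac)
  have *: "(w * T) / N * (C1 * C2 * C3 * C4) / D * (f1 * f2 * f3 * k / w) =
     k * T / N * ((f1 * C1) * (f2 * C2) * (f3 * C3) * C4) / D"
    if "w \<noteq> 0" for w T N C1 C2 C3 C4 D f1 f2 f3 k :: complex
    using that by (simp add: mult_ac)
  show ?thesis
    unfolding gustafson_plus'[OF assms(2) x] term_single_def single_weight_def if_False r a
    by (rule *[OF qE_x2_ne_1[OF assms(1)]])
qed

text \<open>Passing from \<open>x\<close> to \<open>q * x\<close>, the two theta functions
  contribute \<open>al / (q * v * x\<^sup>2)\<close>. The value t^(n-1) a1 a2 v of \<open>al\<close>
  is the one for which, under the balancing condition, all else in the coefficient cancels and
  \<open>t ^ (n - 1)\<close> is left.\<close>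

lemma single_minus':
  assumes "norm x = 1" "e\<^sup>2 = q * E"
  shows "single' x * factor' e True x
    = t ^ (n - 1) * term_single True (q * x)"
proof -
  have x: "x \<noteq> 0" using assms by auto
  note P_nz = P_nz_simps[OF assms(1)]
  have r: "P (b1 * x) = (1 - b1 * x) * P (b1 * (q * x))" "P (b2 * x) = (1 - b2 * x) * P (b2 * (q * x))"
    "P (b3 * x) = (1 - b3 * x) * P (b3 * (q * x))"
    using P_rec[of "b1 * x"] P_rec[of "b2 * x"] P_rec[of "b3 * x"] by (simp_all only: mult_ac)
  have a: "a1 * (q * E) * x = a1 * E * (q * x)" "a2 * (q * E) * x = a2 * E * (q * x)" "q * b4 * x = b4 * (q * x)"
    "q * (a1 / (q * x)) = a1 / x" "q * (a2 / (q * x)) = a2 / x"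
    "q * (M * b2 * b3 * b4) * x = M * b2 * b3 * b4 * (q * x)" "q * (M * b1 * b3 * b4) * x = M * b1 * b3 * b4 * (q * x)"
    "q * (M * b1 * b2 * b4) * x = M * b1 * b2 * b4 * (q * x)" "M * b1 * b2 * b3 * x = M * b1 * b2 * b3 * (q * x) / q"
    "K * (q * E) * x = K * E * (q * x)"
    using q_nz by (simp_all add: mult_ac)
  have alz: "al \<noteq> 0" using nz by (simp add: al_def)
  have th: "Th (al / (q * x)) * Th (v * (q * x)) = al / (q * v * x\<^sup>2) * (Th (al / x) * Th (v * x))"
  proof -
    have "Th (al / (q * x)) = - (al / x / q) * Th (al / x)"
      using theta_divide_q[of "al / x"] alz x by (simp add: mult.commute)
    moreover have "Th (v * (q * x)) = - Th (v * x) / (v * x)"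
      using theta_q_mult[of "v * x"] nz x by (simp add: mult_ac)
    ultimately show ?thesis by (simp add: power2_eq_square mult_ac)
  qed
  have Ex: "(1 - q * E * x\<^sup>2) / (1 - 1 / (q * E * x\<^sup>2)) = - (q * E * x\<^sup>2)"
    using qE_x2_ne_1[OF assms(1)] x E_nz q_nz by (intro divide_one_minus_inverse) auto
  have b: "1 - 1 / (b * x) = - (1 - b * x) / (b * x)" if "b \<noteq> 0" for b
    using that x by (simp add: field_simps)
  have *: "(w * T) / N * C / (f1 * B1 * (f2 * B2) * (f3 * B3) * B4) * (- f1 / g1 * (- f2 / g2) * (- f3 / g3) * k / w') =
     - ((w / w') / (g1 * g2 * g3)) * k * T / N * C / (B1 * B2 * B3 * B4)"
    if "f1 * B1 \<noteq> 0" "f2 * B2 \<noteq> 0" "f3 * B3 \<noteq> 0" for w w' T N C B1 B2 B3 B4 f1 f2 f3 g1 g2 g3 k :: complex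
    using that by (simp add: mult_ac)
  have coef: "- (- (q * E * x\<^sup>2) / (b1 * x * (b2 * x) * (b3 * x))) = t ^ (n - 1) * (q * x * b4 * (al / (q * v * x\<^sup>2)))"
  proof -
    have "- (- (q * E * x\<^sup>2) / (b1 * x * (b2 * x) * (b3 * x))) = (M * b4) / x"
      unfolding qE using nz x by (simp add: power2_eq_square)
    also have "\<dots> = t ^ (n - 1) * (K * v) / (v * x)" using nz by (simp add: M_eq)
    also have "\<dots> = t ^ (n - 1) * (q * x * b4 * (al / (q * v * x\<^sup>2)))"
      unfolding al_eq[symmetric] using nz x q_nz by (simp add: power2_eq_square mult_ac)
    finally show ?thesis .
  qed
  have **: "(s * (u * g)) * k * T / N * C / D = s * (u * k * (g * T) / N * C / D)" for s u k T N C D g :: complex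
    by (simp add: mult_ac)
  show ?thesis
    unfolding gustafson_minus'[OF assms(2) x] term_single_def single_weight_def if_True th b[OF nz(3)] b[OF nz(4)] b[OF nz(5)] a
    unfolding *[of "1 - b1 * x" "P (b1 * (q * x))" "1 - b2 * x" "P (b2 * (q * x))" "1 - b3 * x" "P (b3 * (q * x))", folded r, OF P_nz(1,2,3)]
    unfolding Ex coef ** ..
qed

lemma pair_nz:
  assumes "norm x = 1" "norm y = 1"
  shows "1 - E * x * y \<noteq> 0" "1 - q * E * x * y \<noteq> 0" "P (t * E * x * y) \<noteq> 0" "P (q * (t * E * x * y)) \<noteq> 0"
    "P (t * x / y) \<noteq> 0" "P (t * y / x) \<noteq> 0" "P (q * (t * x / y)) \<noteq> 0" "P (q * (t * y / x)) \<noteq> 0"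
    "1 - t * E * x * y \<noteq> 0" "1 - t * x / y \<noteq> 0" "1 - t * y / x \<noteq> 0" "1 - t * (q * E) * x * y \<noteq> 0"
proof -
  have *: "1 - u \<noteq> 0 \<and> P u \<noteq> 0 \<and> P (q * u) \<noteq> 0" if "norm u < 1" for u
    using that P_nonzero[of u] P_nonzero[OF norm_q_mult_less[of u]] by auto
  have E: "norm (E * x * y) < 1" using assms E_less_1 by (simp add: norm_mult)
  have qE: "norm (q * E * x * y) < 1" using assms norm_q_mult_less[OF E_less_1] by (simp add: norm_mult)
  have tE: "norm (t * E * x * y) < 1" using assms mult_strict_mono[OF lt1(7) E_less_1] by (simp add: norm_mult)
  have tqE: "norm (t * (q * E) * x * y) < 1" using norm_q_mult_less[OF tE] by (simp add: mult_ac)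
  have tx: "norm (t * x / y) < 1" "norm (t * y / x) < 1" using assms lt1(7) by (simp_all add: norm_mult norm_divide)
  show "1 - E * x * y \<noteq> 0" "1 - q * E * x * y \<noteq> 0" "P (t * E * x * y) \<noteq> 0" "P (q * (t * E * x * y)) \<noteq> 0"
    "P (t * x / y) \<noteq> 0" "P (t * y / x) \<noteq> 0" "P (q * (t * x / y)) \<noteq> 0" "P (q * (t * y / x)) \<noteq> 0"
    "1 - t * E * x * y \<noteq> 0" "1 - t * x / y \<noteq> 0" "1 - t * y / x \<noteq> 0" "1 - t * (q * E) * x * y \<noteq> 0"
    using *[OF E] *[OF qE] *[OF tE] *[OF tx(1)] *[OF tx(2)] *[OF tqE] by blast+
qed

lemma qE_m: "q * E = t * m"
  using nz by (simp add: qE m_def)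

lemma minus_div_cancel: "c \<noteq> 0 \<Longrightarrow> (- a / c) / (- b / c) = a / (b::complex)"
  by simp

lemma pair_term_FF:
  assumes "norm x = 1" "norm y = 1"
  shows "pair x y * ((1 - t * (E * x * y)) / (1 - E * x * y)) = term_pair False False x y"
proof -
  note nzs = pair_nz[OF assms]
  have r: "P (t * E * x * y) = (1 - t * E * x * y) * P (q * (t * E * x * y))" by (rule P_rec)
  have *: "w * U / V * (X / (f * Y)) * (f / w) = U / V * (X / Y)" if "w \<noteq> 0" "f \<noteq> 0" for w U V X Y f :: complex
    using that by simp
  show ?thesis unfolding pair_weight_def term_pair_def if_False r
    using *[OF nzs(1,9)] by (simp add: mult.assoc)
qed

text \<open>The denominator of the Gustafson factor vanishes on the diagonal, but it is absorbed by
  \<open>P (x / y)\<close>, so \<open>term_mixed\<close> is regular there. The numerator removes the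
  pole of \<open>y\<close> at \<open>t * x\<close>, which the shift of \<open>y\<close> might
  cross.\<close>

lemma pair_term_FT:
  assumes "norm x = 1" "norm y = 1" "x \<noteq> y"
  shows "pair x y * ((1 - t * (x / y)) / (1 - x / y)) = term_mixed x y"
proof -
  note nzs = pair_nz[OF assms(1,2)]
  have y: "y \<noteq> 0" using assms by auto
  have xy: "1 - x / y \<noteq> 0" using assms(3) y by (simp add: field_simps)
  have r: "P (t * x / y) = (1 - t * x / y) * P (q * (t * x / y))" "P (x / y) = (1 - x / y) * P (q * (x / y))" by (rule P_rec)+
  have *: "w * (g * A * B) / (f * C * D) * Z * (f / g) = w * (A * B) / (C * D) * Z" if "g \<noteq> 0" "f \<noteq> 0" for w g A B f C D Z :: complex
    using that by simp
  show ?thesis unfolding pair_weight_def term_mixed_def r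
    using *[OF xy nzs(10)] by simp
qed

lemma pair_term_TT:
  assumes "norm x = 1" "norm y = 1"
  shows "pair x y * ((1 - t * (1 / (E * x * y))) / (1 - 1 / (E * x * y))) = term_pair True True x y"
proof -
  note nzs = pair_nz[OF assms]
  have xy: "E * x * y \<noteq> 0" using assms E_nz by auto
  have r: "P (m * x * y / q) = (1 - E * x * y / t) * P (m * x * y)"
  proof -
    have u: "m * x * y / q = E * x * y / t" using qE_m q_nz nz by (simp add: field_simps)
    have "P (m * x * y / q) = (1 - m * x * y / q) * P (m * x * y)"
      using P_rec[of "m * x * y / q"] q_nz by simp
    then show ?thesis by (simp add: u)
  qed
  have g: "(1 - t * (1 / (E * x * y))) / (1 - 1 / (E * x * y)) = t * (1 - E * x * y / t) / (1 - E * x * y)"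
  proof -
    have "1 - t * (1 / (E * x * y)) = - (t * (1 - E * x * y / t)) / (E * x * y)"
      "1 - 1 / (E * x * y) = - (1 - E * x * y) / (E * x * y)"
      using xy nz by (simp_all add: field_simps)
    then show ?thesis by (simp only: minus_div_cancel[OF xy])
  qed
  have *: "w * U / V * (X / Y) * (t * f / w) = t * (U / V * (f * X / Y))" if "w \<noteq> 0" for w U V X Y f :: complex
    using that by simp
  show ?thesis unfolding pair_weight_def term_pair_def if_True r g
    by (rule *[OF nzs(1)])
qed

lemma pair_term_FF':
  assumes "norm x = 1" "norm y = 1"
  shows "pair' x y * ((1 - 1 / t * (q * E * x * y)) / (1 - q * E * x * y)) = term_pair False False x y"
proof -
  note nzs = pair_nz[OF assms]
  have m: "1 / t * (q * E * x * y) = m * x * y" using nz by (simp add: qE_m)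
  have r: "P (m * x * y) = (1 - m * x * y) * P (q * m * x * y)" using P_rec[of "m * x * y"] by (simp only: mult.assoc)
  have t: "t * (q * E) * x * y = q * (t * E * x * y)" by (simp add: mult_ac)
  have *: "w * U / V * (X / Y) * (f / w) = U / V * (f * X / Y)" if "w \<noteq> 0" for w U V X Y f :: complex
    using that by simp
  show ?thesis unfolding pair_weight_def term_pair_def if_False r m t
    by (rule *[OF nzs(2)])
qed

text \<open>Each shifted variable of a pair costs one factor \<open>t\<close>, here one and in
  \<open>pair_term_TT'\<close> two. They are paid for by the powers of \<open>t\<close> in
  \<open>single_minus'\<close>.\<close>

lemma pair_term_FT':
  assumes "norm x = 1" "norm y = 1" "x \<noteq> y"
  shows "t * (pair' x y * ((1 - 1 / t * (x / y)) / (1 - x / y))) = term_mixed x (q * y)"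
proof -
  note nzs = pair_nz[OF assms(1,2)]
  have y: "y \<noteq> 0" "x \<noteq> 0" using assms by auto
  have xy: "1 - y / x \<noteq> 0" using assms(3) y by (simp add: field_simps)
  have g: "t * ((1 - 1 / t * (x / y)) / (1 - x / y)) = (1 - t * y / x) / (1 - y / x)"
  proof -
    have "1 - 1 / t * (x / y) = - ((1 - t * y / x) / t) / (y / x)" "1 - x / y = - (1 - y / x) / (y / x)" and yx: "y / x \<noteq> 0"
      using y nz by (simp_all add: field_simps)
    then have "(1 - 1 / t * (x / y)) / (1 - x / y) = ((1 - t * y / x) / t) / (1 - y / x)" by (simp only: minus_div_cancel[OF yx])
    then show ?thesis using nz by simp
  qed
  have r: "P (t * y / x) = (1 - t * y / x) * P (q * (t * y / x))" "P (y / x) = (1 - y / x) * P (q * (y / x))" by (rule P_rec)+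
  have a: "q * (x / (q * y)) = x / y" "q * (t * x / (q * y)) = t * x / y" "q * y / x = q * (y / x)" "t * (q * y) / x = q * (t * y / x)"
     "E * x * (q * y) = q * E * x * y" "m * x * (q * y) = q * m * x * y" "t * E * x * (q * y) = t * (q * E) * x * y"
    using q_nz by (simp_all add: mult_ac)
  have *: "w * (A * (g * B)) / (C * (f * D)) * Z * (f / g) = w * (A * B) / (C * D) * Z" if "g \<noteq> 0" "f \<noteq> 0" for w g A B f C D Z :: complex
    using that by simp
  have "t * (pair' x y * ((1 - 1 / t * (x / y)) / (1 - x / y))) = pair' x y * ((1 - t * y / x) / (1 - y / x))"
    unfolding g[symmetric] by (simp only: mult_ac)
  also have "\<dots> = term_mixed x (q * y)"
    unfolding pair_weight_def term_mixed_def a r by (rule *[OF xy nzs(11)])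
  finally show ?thesis .
qed

lemma pair_term_TT':
  assumes "norm x = 1" "norm y = 1"
  shows "t * t * (pair' x y * ((1 - 1 / t * (1 / (q * E * x * y))) / (1 - 1 / (q * E * x * y)))) = term_pair True True (q * x) (q * y)"
proof -
  note nzs = pair_nz[OF assms]
  have x0: "x \<noteq> 0" "y \<noteq> 0" using assms by auto
  have xy: "q * E * x * y \<noteq> 0" using assms E_nz q_nz by auto
  have r: "P (t * (q * E) * x * y) = (1 - t * (q * E) * x * y) * P (t * E * (q * x) * (q * y))"
    using P_rec[of "t * (q * E) * x * y"] by (simp add: mult_ac)
  have g: "(1 - 1 / t * (1 / (q * E * x * y))) / (1 - 1 / (q * E * x * y)) = (1 / t) * ((1 - t * (q * E) * x * y) / (1 - q * E * x * y))"
  proof -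
    have "1 - 1 / t * (1 / (q * E * x * y)) = - ((1 - t * (q * E) * x * y) / t) / (q * E * x * y)"
      "1 - 1 / (q * E * x * y) = - (1 - q * E * x * y) / (q * E * x * y)"
      using xy nz x0 q_nz E_nz by (simp_all add: field_simps)
    then have "(1 - 1 / t * (1 / (q * E * x * y))) / (1 - 1 / (q * E * x * y)) = ((1 - t * (q * E) * x * y) / t) / (1 - q * E * x * y)"
      by (simp only: minus_div_cancel[OF xy])
    then show ?thesis by simp
  qed
  have a: "q * x / (q * y) = x / y" "q * y / (q * x) = y / x" "t * (q * x) / (q * y) = t * x / y" "t * (q * y) / (q * x) = t * y / x"
     "m * (q * x) * (q * y) / q = q * m * x * y"
    using q_nz by (simp_all add: mult_ac)
  have *: "t * t * (w * U / V * (X / (f * Y)) * (1 / t * (f / w))) = t * (U / V * (X / Y))" if "w \<noteq> 0" "f \<noteq> 0" for w U V X Y f :: complex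
    using that nz by simp
  show ?thesis unfolding pair_weight_def term_pair_def if_True r g a
    by (rule *[OF nzs(2,12)])
qed

lemma pair_weight_sym: "pair_weight u F k x y = pair_weight u F k y x"
  by (simp add: pair_weight_def mult_ac)

lemma flip_mult:
  assumes "e\<^sup>2 = F" "F \<noteq> 0" "x \<noteq> 0" "y \<noteq> 0"
  shows "flip False (e * x) * flip False (e * y) = F * x * y" "flip False (e * x) * flip True (e * y) = x / y"
    "flip True (e * x) * flip False (e * y) = y / x" "flip True (e * x) * flip True (e * y) = 1 / (F * x * y)"
  using assms by (auto simp: flip_def power2_eq_square)

lemma pair_term:
  assumes "norm x = 1" "norm y = 1" "x \<noteq> y" "e\<^sup>2 = E"
  shows "pair x y * gustafson_pair t (flip s (e * x)) (flip s' (e * y)) = term_pair s s' x y"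
proof -
  have x: "x \<noteq> 0" "y \<noteq> 0" using assms by auto
  note f = flip_mult[OF assms(4) E_nz x]
  show ?thesis
    using pair_term_FF[OF assms(1,2)] pair_term_FT[OF assms(1,2,3)] pair_term_FT[OF assms(2,1) assms(3)[symmetric]] pair_term_TT[OF assms(1,2)]
    by (cases s; cases s') (simp_all add: gustafson_pair_def f term_pair_def pair_weight_sym[of _ _ _ x y])
qed

lemma pair_term':
  assumes "norm x = 1" "norm y = 1" "x \<noteq> y" "e\<^sup>2 = q * E"
  shows "(if s then t else 1) * (if s' then t else 1) * (pair' x y * gustafson_pair (1 / t) (flip s (e * x)) (flip s' (e * y))) =
    term_pair s s' (if s then q * x else x) (if s' then q * y else y)"
proof -
  have x: "x \<noteq> 0" "y \<noteq> 0" and qE0: "q * E \<noteq> 0" using assms E_nz q_nz by auto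
  note f = flip_mult[OF assms(4) qE0 x]
  consider "\<not> s" "\<not> s'" | "\<not> s" s' | s "\<not> s'" | s s' by blast
  then show ?thesis
  proof cases
    case 1
    then show ?thesis using pair_term_FF'[OF assms(1,2)] unfolding gustafson_pair_def by (simp only: f if_False mult_1)
  next
    case 2
    then show ?thesis using pair_term_FT'[OF assms(1,2,3)] unfolding gustafson_pair_def term_pair_def by (simp only: f if_False if_True mult_1)
  next
    case 3
    then show ?thesis using pair_term_FT'[OF assms(2,1) assms(3)[symmetric]]
      unfolding gustafson_pair_def term_pair_def pair_weight_sym[of _ _ _ x y] by (simp only: f if_False if_True mult_1 mult_1_right)
  next
    case 4
    then show ?thesis using pair_term_TT'[OF assms(1,2)] unfolding gustafson_pair_def by (simp only: f if_True)
  qed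
qed

lemma al_nz: "al \<noteq> 0" using nz by (simp add: al_def)

lemma term_single_True_nz:
  assumes "norm q * \<rho> < norm x" "norm x < 1 / \<rho>"
  shows "x \<noteq> 0" "P (a1 * E * x) \<noteq> 0" "P (q * (a1 / x)) \<noteq> 0" "P (a2 * E * x) \<noteq> 0" "P (q * (a2 / x)) \<noteq> 0"
    "P (b1 * x) \<noteq> 0" "P (b2 * x) \<noteq> 0" "P (b3 * x) \<noteq> 0" "P (b4 * x) \<noteq> 0"
proof -
  show "x \<noteq> 0" using assms(1) rho(1) by (auto simp: mult_less_0_iff)
qed (rule P_nz_upper P_nz_lower aE_le rho assms)+

lemma term_single_False_nz:
  assumes "norm x = 1"
  shows "x \<noteq> 0" "P (q * (a1 * E * x)) \<noteq> 0" "P (a1 / x) \<noteq> 0" "P (q * (a2 * E * x)) \<noteq> 0" "P (a2 / x) \<noteq> 0"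
    "P (b1 * x) \<noteq> 0" "P (b2 * x) \<noteq> 0" "P (b3 * x) \<noteq> 0" "P (q * (b4 * x)) \<noteq> 0"
proof -
  show "x \<noteq> 0" using assms by auto
  show "P (q * (a1 * E * x)) \<noteq> 0" "P (q * (a2 * E * x)) \<noteq> 0"
    using P_nz_upper[OF q_le[OF aE_le[OF rho(3)]] unit_less[OF assms]]
      P_nz_upper[OF q_le[OF aE_le[OF rho(4)]] unit_less[OF assms]] by (simp_all only: mult.assoc not_False_eq_True)
qed (rule P_nz_simps assms)+

lemma term_mixed_nz:
  assumes "norm x = 1" "norm q * \<rho> < norm y" "norm y < 1 / \<rho>"
  shows "x \<noteq> 0" "y \<noteq> 0" "P (q * (t * x / y)) \<noteq> 0" "P (t * y / x) \<noteq> 0" "P (t * E * x * y) \<noteq> 0" "P (t * E * y * x) \<noteq> 0"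
proof -
  show "x \<noteq> 0" "y \<noteq> 0" using assms rho(1) by (auto simp: mult_less_0_iff)
  show "P (q * (t * x / y)) \<noteq> 0" by (rule P_nz_lower) (use assms rho in \<open>auto simp: norm_mult\<close>)
  have "P (t / x * y) \<noteq> 0" by (rule P_nz_upper) (use assms rho in \<open>auto simp: norm_divide\<close>)
  then show "P (t * y / x) \<noteq> 0" by simp
  show "P (t * E * x * y) \<noteq> 0" "P (t * E * y * x) \<noteq> 0"
    by (rule P_nz_upper2 rho assms unit_less[OF assms(1)])+
qed

lemma term_pair_TT_nz:
  assumes "norm x = norm y" "x \<noteq> 0" "norm x < 1 / \<rho>"
  shows "x \<noteq> 0" "y \<noteq> 0" "P (t * x / y) \<noteq> 0" "P (t * y / x) \<noteq> 0" "P (t * E * x * y) \<noteq> 0"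
proof -
  show 0: "x \<noteq> 0" "y \<noteq> 0" using assms by auto
  show "P (t * x / y) \<noteq> 0" "P (t * y / x) \<noteq> 0"
    by (rule P_nonzero, use assms 0 lt1(7) in \<open>simp add: norm_mult norm_divide\<close>)+
  show "P (t * E * x * y) \<noteq> 0"
    by (rule P_nz_upper2) (use assms rho in auto)
qed

text \<open>The variables in \<open>S\<close> move on a common circle, so that their mutual quotients stay on the unit
  circle.\<close>
definition admissible :: "nat set \<Rightarrow> nat set \<Rightarrow> (nat \<Rightarrow> complex) \<Rightarrow> bool" where
  "admissible I S z \<longleftrightarrow> (\<exists>r. norm q * \<rho> < r \<and> r < 1 / \<rho> \<and> (\<forall>i\<in>I. norm (z i) = (if i \<in> S then r else 1)))"

lemma admissibleD:
  assumes "admissible I S z" "i \<in> I"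
  shows "i \<in> S \<Longrightarrow> norm q * \<rho> < norm (z i) \<and> norm (z i) < 1 / \<rho>" "i \<notin> S \<Longrightarrow> norm (z i) = 1"
    "i \<in> S \<Longrightarrow> j \<in> I \<Longrightarrow> j \<in> S \<Longrightarrow> norm (z i) = norm (z j)" "z i \<noteq> 0"
proof -
  obtain r where r: "norm q * \<rho> < r" "r < 1 / \<rho>" and z: "\<And>i. i \<in> I \<Longrightarrow> norm (z i) = (if i \<in> S then r else 1)"
    using assms(1) unfolding admissible_def by blast
  have "0 \<le> norm q * \<rho>" using rho(1) by simp
  then have "0 < r" using r(1) by linarith
  then have "0 < norm (z i)" using z[OF assms(2)] by simp
  then show "z i \<noteq> 0" by simp
  have "norm (z i) = r" if "i \<in> S" "i \<in> I" for i using z[OF that(2)] that(1) by (simp only: if_True)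
  then show "i \<in> S \<Longrightarrow> norm q * \<rho> < norm (z i) \<and> norm (z i) < 1 / \<rho>"
    "i \<in> S \<Longrightarrow> j \<in> I \<Longrightarrow> j \<in> S \<Longrightarrow> norm (z i) = norm (z j)"
    using r assms(2) by (simp_all only:)
  show "i \<notin> S \<Longrightarrow> norm (z i) = 1" using z[OF assms(2)] by (simp only: if_False)
qed

lemma admissible_scale:
  assumes "z \<in> torus I" "norm q * \<rho> < norm c" "norm c < 1 / \<rho>"
  shows "admissible I S (scale S c z)"
  unfolding admissible_def using assms by (intro exI[of _ "norm c"]) (auto simp: scale_def norm_mult)

lemma q_rho: "norm q * \<rho> < 1" "norm q * \<rho> < norm q" "1 < 1 / \<rho>"
  using rho q_less_1 q_nz mult_strict_mono[of "norm q" 1 \<rho> 1] by auto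

lemma shift_term_class:
  assumes fc: "function_class q A C" and f: "\<And>i. i \<in> I \<Longrightarrow> C (\<lambda>w. f w i)"
    and adm: "\<And>w. w \<in> A \<Longrightarrow> admissible I S (f w)"
  shows "C (\<lambda>w. shift_term I S (f w))"
proof -
  interpret fc: function_class q A C by (rule fc)
  note S = admissibleD(1)[OF adm] and nS = admissibleD(2)[OF adm] and eq = admissibleD(3)[OF adm] and f0 = admissibleD(4)[OF adm]
  have 1: "C (\<lambda>w. term_single (i \<in> S) (f w i))" if i: "i \<in> I" for i
  proof (cases "i \<in> S")
    case True
    have T: "f w i \<noteq> 0 \<and> P (a1 * E * f w i) \<noteq> 0 \<and> P (q * (a1 / f w i)) \<noteq> 0 \<and> P (a2 * E * f w i) \<noteq> 0 \<and>
        P (q * (a2 / f w i)) \<noteq> 0 \<and> P (b1 * f w i) \<noteq> 0 \<and> P (b2 * f w i) \<noteq> 0 \<and> P (b3 * f w i) \<noteq> 0 \<and> P (b4 * f w i) \<noteq> 0"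
      if "w \<in> A" for w
      by (intro conjI) (rule term_single_True_nz[OF conjunct1[OF S[OF that i True]] conjunct2[OF S[OF that i True]]])+
    have *: "C (\<lambda>w. term_single True (f w i))"
      unfolding term_single_def if_True
      by (intro fc.intros f[OF i]) (use T al_nz nz q_nz in auto)
    with True show ?thesis by simp
  next
    case False
    have T: "f w i \<noteq> 0 \<and> P (q * (a1 * E * f w i)) \<noteq> 0 \<and> P (a1 / f w i) \<noteq> 0 \<and> P (q * (a2 * E * f w i)) \<noteq> 0 \<and>
        P (a2 / f w i) \<noteq> 0 \<and> P (b1 * f w i) \<noteq> 0 \<and> P (b2 * f w i) \<noteq> 0 \<and> P (b3 * f w i) \<noteq> 0 \<and> P (q * (b4 * f w i)) \<noteq> 0"
      if "w \<in> A" for w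
      by (intro conjI) (rule term_single_False_nz[OF nS[OF that i False]])+
    have *: "C (\<lambda>w. term_single False (f w i))"
      unfolding term_single_def if_False
      by (intro fc.intros f[OF i]) (use T al_nz nz in auto)
    with False show ?thesis by simp
  qed
  have mixed: "C (\<lambda>w. term_mixed (f w j) (f w k))" if jk: "j \<in> I" "k \<in> I" "j \<notin> S" "k \<in> S" for j k
  proof -
    have T: "f w j \<noteq> 0 \<and> f w k \<noteq> 0 \<and> P (q * (t * f w j / f w k)) \<noteq> 0 \<and> P (t * f w k / f w j) \<noteq> 0 \<and> P (t * E * f w j * f w k) \<noteq> 0"
      if "w \<in> A" for w
      by (intro conjI) (rule term_mixed_nz[OF nS[OF that jk(1,3)] conjunct1[OF S[OF that jk(2,4)]] conjunct2[OF S[OF that jk(2,4)]]])+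
    show ?thesis unfolding term_mixed_def
      by (intro fc.intros f jk(1,2)) (use T in auto)
  qed
  have 2: "C (\<lambda>w. term_pair (j \<in> S) (k \<in> S) (f w j) (f w k))" if jk: "j \<in> I" "k \<in> I" for j k
  proof -
    consider "j \<in> S" "k \<in> S" | "j \<in> S" "k \<notin> S" | "j \<notin> S" "k \<in> S" | "j \<notin> S" "k \<notin> S" by blast
    then show ?thesis
    proof cases
      case 1
      have T: "P (t * f w j / f w k) \<noteq> 0 \<and> P (t * f w k / f w j) \<noteq> 0 \<and> P (t * E * f w j * f w k) \<noteq> 0" if "w \<in> A" for w
        by (intro conjI) (rule term_pair_TT_nz[OF eq[OF that jk(1) 1(1) jk(2) 1(2)] f0[OF that jk(1)] conjunct2[OF S[OF that jk(1) 1(1)]]])+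
      have "C (\<lambda>w. term_pair True True (f w j) (f w k))"
        unfolding term_pair_def if_True
        by (intro fc.intros f jk) (use f0 jk q_nz T in auto)
      with 1 show ?thesis by simp
    next
      case 2
      then show ?thesis using mixed[OF jk(2,1) 2(2,1)] by (simp add: term_pair_def)
    next
      case 3
      then show ?thesis using mixed[OF jk 3] by (simp add: term_pair_def)
    next
      case 4
      have T: "P (t * f w j / f w k) \<noteq> 0 \<and> P (t * f w k / f w j) \<noteq> 0 \<and> P (q * (t * E * f w j * f w k)) \<noteq> 0" if "w \<in> A" for w
        by (intro conjI) (rule pair_nz[OF nS[OF that jk(1) 4(1)] nS[OF that jk(2) 4(2)]])+
      have "C (\<lambda>w. term_pair False False (f w j) (f w k))"
        unfolding term_pair_def if_False
        by (intro fc.intros f jk) (use f0 jk T in auto)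
      with 4 show ?thesis by simp
    qed
  qed
  have 3: "C (\<lambda>w. case p of (j, k) \<Rightarrow> term_pair (j \<in> S) (k \<in> S) (f w j) (f w k))" if "p \<in> pairs I" for p
    using that 2 by (cases p) (auto simp: pairs_def)
  show ?thesis unfolding shift_term_def
    by (intro fc.mult fc.prod 1 3)
qed

lemma integral_shift_term:
  assumes I: "finite I" "S \<subseteq> I"
  shows "(\<integral>z. shift_term I S (scale S q z) \<partial>torus_measure I) = (\<integral>z. shift_term I S z \<partial>torus_measure I)"
proof (rule torus_scale[OF I, where ?r1.0 = "norm q * \<rho>" and ?r2.0 = "1 / \<rho>"])
  show "(\<lambda>c. shift_term I S (scale S c z)) holomorphic_on {c. norm q * \<rho> < norm c \<and> norm c < 1 / \<rho>}" if "z \<in> torus I" for z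
  proof (rule shift_term_class[OF holomorphic_class])
    show "(\<lambda>c. scale S c z i) holomorphic_on {c. norm q * \<rho> < norm c \<and> norm c < 1 / \<rho>}" for i
      unfolding scale_def by (cases "i \<in> S") (auto intro!: holomorphic_intros)
  qed (use that in \<open>auto intro: admissible_scale\<close>)
  have c: "continuous_on (torus I) (\<lambda>z. shift_term I S (scale S c z))" if "norm q * \<rho> < norm c" "norm c < 1 / \<rho>" for c
  proof (rule shift_term_class[OF continuous_class])
    show "continuous_on (torus I) (\<lambda>z. scale S c z i)" for i
      unfolding scale_def by (cases "i \<in> S") (auto intro!: continuous_intros)
  qed (use that in \<open>auto intro: admissible_scale\<close>)
  show "continuous_on (torus I) (shift_term I S)" using c[of 1] q_rho by simp
  show "continuous_on (torus I) (\<lambda>z. shift_term I S (scale S q z))" using c[of q] q_rho q_less_1 by simp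
  show "0 \<le> norm q * \<rho>" using rho by simp
qed (use q_rho q_less_1 in auto)

text \<open>The product of any two of the points has modulus |F| < 1, hence differs from 1; only
  coincidences among the variables have to be excluded. This is where |\<epsilon>| < 1 is used for
  Gustafson's identity.\<close>

lemma generic_torus:
  assumes z: "z \<in> torus I" "inj_on z I" and e: "e\<^sup>2 = F" "F \<noteq> 0" "norm F < 1"
  shows "generic I (\<lambda>i. e * z i)"
proof -
  have ne: "F * u \<noteq> 1" if "norm u = 1" for u
  proof
    assume "F * u = 1"
    then have "norm (F * u) = 1" by simp
    then show False using that e(3) by (simp add: norm_mult)
  qed
  have e0: "e \<noteq> 0" using e by auto
  have p: "e * z i * (e * z j) \<noteq> 1" if "i \<in> I" "j \<in> I" for i j
  proof -
    have "e * z i * (e * z j) = F * (z i * z j)" unfolding e(1)[symmetric] power2_eq_square by (simp only: mult_ac)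
    moreover have "F * (z i * z j) \<noteq> 1" by (rule ne) (use z(1) that in \<open>simp add: norm_mult\<close>)
    ultimately show ?thesis by (simp only:) simp
  qed
  show ?thesis
    unfolding generic_def
  proof (intro conjI ballI impI)
    fix i j assume ij: "i \<in> I" "j \<in> I"
    show "e * z i \<noteq> 0" using z(1) ij e0 by simp
    show "(e * z i)\<^sup>2 \<noteq> 1" using p[OF ij(1,1)] by (simp add: power2_eq_square)
    show "e * z i * (e * z j) \<noteq> 1" by (rule p[OF ij])
    show "e * z i \<noteq> e * z j" if "i \<noteq> j" using inj_onD[OF z(2) _ ij] e0 that by auto
  qed
qed

context
  fixes I :: "nat set"
  assumes I: "finite I" and n: "card I = n"
begin

lemma weight_eq: "weight I t v a1 a2 b1 b2 b3 b4 z = (\<Prod>i\<in>I. single (z i)) * (\<Prod>(j,k)\<in>pairs I. pair (z j) (z k))"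
  unfolding weight_def n Let_def E_def M_def m_def al_def ..

lemma weight_eq': "weight I t v a1 a2 b1 b2 b3 (q * b4) z = (\<Prod>i\<in>I. single' (z i)) * (\<Prod>(j,k)\<in>pairs I. pair' (z j) (z k))"
proof -
  have *: "M * b2 * b3 * (q * b4) = q * (M * b2 * b3 * b4)" "M * b1 * b3 * (q * b4) = q * (M * b1 * b3 * b4)"
    "M * b1 * b2 * (q * b4) = q * (M * b1 * b2 * b4)" "M * b1 * b2 * b3 * (q * b4) / q = q * E"
    "M * b1 * b2 * b3 * (q * b4) / t = q * m"
    using q_nz by (simp_all add: E_def m_def mult_ac)
  show ?thesis unfolding weight_def n Let_def M_def[symmetric] al_def[symmetric] * ..
qed

lemma weight_sum:
  assumes z: "z \<in> torus I" "inj_on z I"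
  shows "weight I t v a1 a2 b1 b2 b3 b4 z * (\<Prod>i<n. (1 - t ^ i * (a1 * a2 * E)) * (1 - t ^ i * (a1 * b4)) * (1 - t ^ i * (a2 * b4)))
    = (\<Sum>S\<in>Pow I. shift_term I S z)"
proof -
  \<comment> \<open>The choice of root is immaterial, since the summands depend on \<open>e\<close>
    only through its square.\<close>
  define e where "e = csqrt E"
  have e: "e\<^sup>2 = E" by (simp add: e_def)
  have e0: "e \<noteq> 0" using e E_nz by auto
  have c: "(\<Prod>i<n. (1 - t ^ i * (a1 * a2 * E)) * (1 - t ^ i * (a1 * b4)) * (1 - t ^ i * (a2 * b4))) =
     (\<Sum>S\<in>Pow I. gustafson_term t (e * a1) (e * a2) (b4 / e) (\<lambda>i. e * z i) I S)"
    using e0 by (subst gustafson_identity[OF I generic_torus[OF z e E_nz E_less_1]])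
      (simp add: n e[symmetric] power2_eq_square mult_ac)
  show ?thesis unfolding c sum_distrib_left
  proof (rule sum.cong[OF refl])
    fix S
    have "weight I t v a1 a2 b1 b2 b3 b4 z * gustafson_term t (e * a1) (e * a2) (b4 / e) (\<lambda>i. e * z i) I S =
      (\<Prod>i\<in>I. single (z i) * factor e (i \<in> S) (z i)) *
      (\<Prod>(j,k)\<in>pairs I. pair (z j) (z k) * gustafson_pair t (flip (j \<in> S) (e * z j)) (flip (k \<in> S) (e * z k)))"
      unfolding weight_eq gustafson_term_def n by (simp add: prod.distrib case_prod_unfold mult_ac)
    also have "\<dots> = shift_term I S z" unfolding shift_term_def
    proof (intro arg_cong2[where f="(*)"] prod.cong refl)
      fix i assume "i \<in> I"
      then show "single (z i) * factor e (i \<in> S) (z i) = term_single (i \<in> S) (z i)"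
        using single_plus[OF _ e] single_minus[OF _ e] z(1) by (cases "i \<in> S") auto
    next
      fix p assume "p \<in> pairs I"
      then obtain j k where p: "p = (j, k)" "j \<in> I" "k \<in> I" "j \<noteq> k" by (auto simp: pairs_def)
      then have "z j \<noteq> z k" using z(2) by (auto dest: inj_onD)
      with p show "(case p of (j, k) \<Rightarrow> pair (z j) (z k) * gustafson_pair t (flip (j \<in> S) (e * z j)) (flip (k \<in> S) (e * z k))) =
          (case p of (j, k) \<Rightarrow> term_pair (j \<in> S) (k \<in> S) (z j) (z k))"
        using pair_term[OF _ _ _ e] z(1) by simp
    qed
    finally show "weight I t v a1 a2 b1 b2 b3 b4 z * gustafson_term t (e * a1) (e * a2) (b4 / e) (\<lambda>i. e * z i) I S = shift_term I S z" .
  qed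
qed

lemma weight_sum':
  assumes z: "z \<in> torus I" "inj_on z I"
  shows "weight I t v a1 a2 b1 b2 b3 (q * b4) z *
     (\<Prod>i<n. (1 - (1 / t) ^ i * (q * E / (b1 * b2))) * (1 - (1 / t) ^ i * (q * E / (b1 * b3))) * (1 - (1 / t) ^ i * (q * E / (b2 * b3))))
    = (\<Sum>S\<in>Pow I. shift_term I S (scale S q z))"
proof -
  define e where "e = csqrt (q * E)"
  have e: "e\<^sup>2 = q * E" by (simp add: e_def)
  have qE0: "q * E \<noteq> 0" using q_nz E_nz by simp
  have c: "(\<Prod>i<n. (1 - (1 / t) ^ i * (q * E / (b1 * b2))) * (1 - (1 / t) ^ i * (q * E / (b1 * b3))) * (1 - (1 / t) ^ i * (q * E / (b2 * b3)))) =
     (\<Sum>S\<in>Pow I. gustafson_term (1 / t) (e / b1) (e / b2) (e / b3) (\<lambda>i. e * z i) I S)"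
    by (subst gustafson_identity[OF I generic_torus[OF z e qE0 norm_q_mult_less[OF E_less_1]]])
      (simp add: n e[symmetric] power2_eq_square mult_ac)
  show ?thesis unfolding c sum_distrib_left
  proof (rule sum.cong[OF refl])
    fix S assume "S \<in> Pow I"
    \<comment> \<open>By \<open>prod_pairs_factors\<close>, the factors \<open>t ^ (n - 1)\<close>
      that \<open>single_minus'\<close> yields for the variables in \<open>S\<close> are
      redistributed over the pairs, where \<open>pair_term'\<close> consumes them.\<close>
    define f where "f = (\<lambda>i. if i \<in> S then t else 1)"
    have f0: "f i \<noteq> 0" for i using nz by (simp add: f_def)
    have f1: "(\<Prod>i\<in>I. f i ^ (n - 1)) \<noteq> 0" using f0 I by simp
    let ?s = "\<lambda>i. single' (z i) * factor' e (i \<in> S) (z i)"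
    let ?p = "\<lambda>j k. pair' (z j) (z k) * gustafson_pair (1 / t) (flip (j \<in> S) (e * z j)) (flip (k \<in> S) (e * z k))"
    have 1: "?s i = f i ^ (n - 1) * term_single (i \<in> S) (scale S q z i)" if "i \<in> I" for i
      using single_plus'[OF _ e] single_minus'[OF _ e] z(1) that by (cases "i \<in> S") (auto simp: f_def scale_def)
    have 2: "f j * f k * ?p j k = term_pair (j \<in> S) (k \<in> S) (scale S q z j) (scale S q z k)" if "(j, k) \<in> pairs I" for j k
    proof -
      have "j \<in> I" "k \<in> I" "z j \<noteq> z k" using that z(2) by (auto simp: pairs_def dest: inj_onD)
      then show ?thesis using pair_term'[OF _ _ _ e, of "z j" "z k" "j \<in> S" "k \<in> S"] z(1) by (simp add: f_def scale_def)
    qed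
    have "weight I t v a1 a2 b1 b2 b3 (q * b4) z * gustafson_term (1 / t) (e / b1) (e / b2) (e / b3) (\<lambda>i. e * z i) I S =
      (\<Prod>i\<in>I. ?s i) * (\<Prod>(j,k)\<in>pairs I. ?p j k)"
      unfolding weight_eq' gustafson_term_def n by (simp add: prod.distrib case_prod_unfold mult_ac)
    also have "\<dots> = (\<Prod>i\<in>I. f i ^ (n - 1)) * (\<Prod>i\<in>I. term_single (i \<in> S) (scale S q z i)) * (\<Prod>(j,k)\<in>pairs I. ?p j k)"
      unfolding prod.distrib[symmetric] by (intro arg_cong2[where f="(*)"] prod.cong refl 1)
    also have "\<dots> = (\<Prod>i\<in>I. term_single (i \<in> S) (scale S q z i)) * ((\<Prod>(j,k)\<in>pairs I. f j * f k) * (\<Prod>(j,k)\<in>pairs I. ?p j k))"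
      unfolding prod_pairs_factors[OF I, of f] n by (simp only: mult_ac)
    also have "(\<Prod>(j,k)\<in>pairs I. f j * f k) * (\<Prod>(j,k)\<in>pairs I. ?p j k) = (\<Prod>(j,k)\<in>pairs I. f j * f k * ?p j k)"
      by (simp add: prod.distrib case_prod_unfold)
    also have "\<dots> = (\<Prod>(j,k)\<in>pairs I. term_pair (j \<in> S) (k \<in> S) (scale S q z j) (scale S q z k))"
      by (rule prod.cong[OF refl]) (use 2 in auto)
    finally show "weight I t v a1 a2 b1 b2 b3 (q * b4) z * gustafson_term (1 / t) (e / b1) (e / b2) (e / b3) (\<lambda>i. e * z i) I S
       = shift_term I S (scale S q z)" by (simp only: shift_term_def)
  qed
qed

text \<open>The two products are the values of the two Gustafson sums. Being independent of
  \<open>z\<close>, they come out of the integrals, and what is left on both sides is the same sum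
  of integrals by \<open>integral_shift_term\<close>.\<close>

lemma integral_half_shift:
  "(\<integral>z. weight I t v a1 a2 b1 b2 b3 b4 z \<partial>torus_measure I) *
     (\<Prod>i<n. (1 - t ^ i * (a1 * a2 * E)) * (1 - t ^ i * (a1 * b4)) * (1 - t ^ i * (a2 * b4))) =
   (\<integral>z. weight I t v a1 a2 b1 b2 b3 (q * b4) z \<partial>torus_measure I) *
     (\<Prod>i<n. (1 - (1 / t) ^ i * (q * E / (b1 * b2))) * (1 - (1 / t) ^ i * (q * E / (b1 * b3))) * (1 - (1 / t) ^ i * (q * E / (b2 * b3))))"
  (is "?L * ?c = ?R * ?c'")
proof -
  have cont: "continuous_on (torus I) (\<lambda>z. shift_term I S (scale S c z))" if "norm q * \<rho> < norm c" "norm c < 1 / \<rho>" for c S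
  proof (rule shift_term_class[OF continuous_class])
    show "continuous_on (torus I) (\<lambda>z. scale S c z i)" for i
      unfolding scale_def by (cases "i \<in> S") (auto intro!: continuous_intros)
  qed (use that in \<open>auto intro: admissible_scale\<close>)
  have c1: "continuous_on (torus I) (shift_term I S)" for S using cont[of 1 S] q_rho by simp
  have cq: "continuous_on (torus I) (\<lambda>z. shift_term I S (scale S q z))" for S using cont[of q S] q_rho q_less_1 by simp
  have w1: "continuous_on (torus I) (weight I t v a1 a2 b1 b2 b3 b4)"
    using E_lt1 nz lt1 by (intro continuous_weight continuous_intros) (auto simp: n)
  have w2: "continuous_on (torus I) (weight I t v a1 a2 b1 b2 b3 (q * b4))"
  proof (intro continuous_weight continuous_intros)
    show "norm (a1 * a2 * t ^ (2 * card I - 2) * b1 * b2 * b3 * (q * b4) / q) < 1"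
      using norm_q_mult_less[OF E_lt1] by (simp add: n mult_ac)
  qed (use nz lt1 norm_q_mult_less in auto)
  have "?L * ?c = (\<integral>z. weight I t v a1 a2 b1 b2 b3 b4 z * ?c \<partial>torus_measure I)" by simp
  also have "\<dots> = (\<integral>z. (\<Sum>S\<in>Pow I. shift_term I S z) \<partial>torus_measure I)"
  proof (rule integral_cong_AE)
    show "AE z in torus_measure I. weight I t v a1 a2 b1 b2 b3 b4 z * ?c = (\<Sum>S\<in>Pow I. shift_term I S z)"
      using AE_torus_inj[OF I] AE_space by eventually_elim (rule weight_sum, auto)
  qed (intro torus_measurable continuous_intros w1 c1)+
  also have "\<dots> = (\<Sum>S\<in>Pow I. (\<integral>z. shift_term I S z \<partial>torus_measure I))"
    by (intro Bochner_Integration.integral_sum torus_integrable I c1)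
  also have "\<dots> = (\<Sum>S\<in>Pow I. (\<integral>z. shift_term I S (scale S q z) \<partial>torus_measure I))"
    by (intro sum.cong refl integral_shift_term[symmetric] I) auto
  also have "\<dots> = (\<integral>z. (\<Sum>S\<in>Pow I. shift_term I S (scale S q z)) \<partial>torus_measure I)"
    by (intro Bochner_Integration.integral_sum[symmetric] torus_integrable I cq)
  also have "\<dots> = (\<integral>z. weight I t v a1 a2 b1 b2 b3 (q * b4) z * ?c' \<partial>torus_measure I)"
  proof (rule integral_cong_AE)
    show "AE z in torus_measure I. (\<Sum>S\<in>Pow I. shift_term I S (scale S q z)) = weight I t v a1 a2 b1 b2 b3 (q * b4) z * ?c'"
      using AE_torus_inj[OF I] AE_space by eventually_elim (rule weight_sum'[symmetric], auto)
  qed (intro torus_measurable continuous_intros w2 cq)+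
  also have "\<dots> = ?R * ?c'" by simp
  finally show ?thesis .
qed

end
end

section \<open>Invariance of the normalised integral and removal of the parameters
  \<open>b\<close>\<close>

context nome begin

text \<open>This is the \<open>b\<close>-dependent part of the right-hand side. By the balancing
  condition q \<epsilon>^2 / (b_j b_k) equals \<open>M\<close> times the product of the other two
  parameters, which makes sense at \<open>b = 0\<close>; the value there is 1.\<close>

definition b_ratio :: "nat \<Rightarrow> complex \<Rightarrow> complex \<Rightarrow> complex \<Rightarrow> complex \<Rightarrow> complex \<Rightarrow> complex \<Rightarrow> complex \<Rightarrow> complex" where
  "b_ratio n t a1 a2 b1 b2 b3 b4 =
    (let M = a1 * a2 * t ^ (2 * n - 2) in
     \<Prod>i<n. (P (M * (1 / t) ^ i * b1 * b2) * P (M * (1 / t) ^ i * b1 * b3) * P (M * (1 / t) ^ i * b1 * b4) *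
        P (M * (1 / t) ^ i * b2 * b3) * P (M * (1 / t) ^ i * b2 * b4) * P (M * (1 / t) ^ i * b3 * b4)) /
       (P (t ^ i * (a1 * a2 * (M * b1 * b2 * b3 * b4 / q))) *
        (P (t ^ i * (a1 * b1)) * P (t ^ i * (a1 * b2)) * P (t ^ i * (a1 * b3)) * P (t ^ i * (a1 * b4))) *
        (P (t ^ i * (a2 * b1)) * P (t ^ i * (a2 * b2)) * P (t ^ i * (a2 * b3)) * P (t ^ i * (a2 * b4)))))"

lemma divide_transfer:
  fixes x y :: complex
  assumes "x * c = x' * c'" "y * c = y' * c'" "c \<noteq> 0" "c' \<noteq> 0"
  shows "x' / y' = x / y"
proof -
  have "x' / y' = (x' * c') / (y' * c')" using assms(4) by simp
  also have "\<dots> = (x * c) / (y * c)" by (simp only: assms(1,2))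
  also have "\<dots> = x / y" using assms(3) by simp
  finally show ?thesis .
qed

lemma weight_rotate: "weight I t v a1 a2 b4 b1 b2 b3 z = weight I t v a1 a2 b1 b2 b3 b4 z"
  by (simp add: weight_def Let_def single_weight_def mult_ac)

lemma b_ratio_rotate: "b_ratio n t a1 a2 b4 b1 b2 b3 = b_ratio n t a1 a2 b1 b2 b3 b4"
  by (simp add: b_ratio_def Let_def mult_ac)

text \<open>For \<open>i < n\<close> the exponent 2 n - 2 - i is nonnegative, so the negative powers
  of \<open>t\<close> in \<open>b_ratio\<close> are harmless.\<close>

lemma norm_M_le:
  fixes t :: complex
  assumes "t \<noteq> 0" "norm t < 1" "i < n"
  shows "norm (t ^ (2 * n - 2) * (1 / t) ^ i) \<le> 1"
proof -
  have "2 * n - 2 = (2 * n - 2 - i) + i" using assms(3) by simp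
  from arg_cong[OF this, of "power t"] have "t ^ (2 * n - 2) = t ^ (2 * n - 2 - i) * t ^ i" by (simp only: power_add)
  then have "t ^ (2 * n - 2) * (1 / t) ^ i = t ^ (2 * n - 2 - i)"
    using assms(1) by (simp add: power_one_over)
  then show ?thesis using assms(2) by (simp add: norm_power power_le_one)
qed

lemma mult_norm_less_1:
  fixes x y :: complex
  shows "norm x < 1 \<Longrightarrow> norm y \<le> 1 \<Longrightarrow> norm (x * y) < 1" "norm x \<le> 1 \<Longrightarrow> norm y < 1 \<Longrightarrow> norm (x * y) < 1"
  using mult_right_mono[of "norm y" 1 "norm x"] mult_left_mono[of "norm x" 1 "norm y"]
  unfolding norm_mult by (smt (verit) mult_left_le mult_left_le_one_le norm_ge_zero)+

lemma mult_norm_le_1: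
  fixes x y :: complex
  shows "norm x \<le> 1 \<Longrightarrow> norm y \<le> 1 \<Longrightarrow> norm (x * y) \<le> 1"
  using mult_mono[of "norm x" 1 "norm y" 1] by (simp add: norm_mult)

lemma M_bb_less_1:
  fixes t :: complex
  assumes "t \<noteq> 0" "norm t < 1" "i < n" "norm a1 < 1" "norm a2 < 1" "norm b < 1" "norm b' < 1"
  shows "norm (a1 * a2 * t ^ (2 * n - 2) * (1 / t) ^ i * b * b') < 1"
proof -
  have "norm (a1 * a2 * (t ^ (2 * n - 2) * (1 / t) ^ i) * b * b') < 1"
    by (intro mult_norm_less_1(1) less_imp_le[OF assms(5)] less_imp_le[OF assms(6)] less_imp_le[OF assms(7)] norm_M_le assms)
  then show ?thesis by (simp only: mult.assoc)
qed

lemma t_less_1: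
  fixes t :: complex
  assumes "norm t < 1" "norm u < 1"
  shows "norm (t ^ i * u) < 1"
  by (rule mult_norm_less_1(2)) (use assms in \<open>auto simp: norm_power power_le_one\<close>)

context
  fixes t a1 a2 v :: complex and I :: "nat set"
  assumes t: "t \<noteq> 0" "norm t < 1" and a: "a1 \<noteq> 0" "a2 \<noteq> 0" "norm a1 < 1" "norm a2 < 1" and v: "v \<noteq> 0" and I: "finite I"
begin

abbreviation "Wt \<equiv> weight I t v a1 a2"
abbreviation "Rt \<equiv> b_ratio (card I) t a1 a2"
abbreviation "E_of b1 b2 b3 b4 \<equiv> a1 * a2 * t ^ (2 * card I - 2) * b1 * b2 * b3 * b4 / q"

lemma ratio_parts_nz:
  assumes b: "norm b1 < 1" "norm b2 < 1" "norm b3 < 1" "norm b4 < 1" and E: "norm (E_of b1 b2 b3 b4) < 1" and i: "i < card I"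
  shows "P (t ^ i * (a1 * a2 * (a1 * a2 * t ^ (2 * card I - 2) * b1 * b2 * b3 * b4 / q))) \<noteq> 0"
    "P (t ^ i * (a1 * b1)) \<noteq> 0" "P (t ^ i * (a1 * b2)) \<noteq> 0" "P (t ^ i * (a1 * b3)) \<noteq> 0" "P (t ^ i * (a1 * b4)) \<noteq> 0"
    "P (t ^ i * (a2 * b1)) \<noteq> 0" "P (t ^ i * (a2 * b2)) \<noteq> 0" "P (t ^ i * (a2 * b3)) \<noteq> 0" "P (t ^ i * (a2 * b4)) \<noteq> 0"
  by (intro P_nonzero t_less_1 t(2) E a(3) b mult_norm_less_1(1)[OF a(3) less_imp_le] mult_norm_less_1(1)[OF a(4) less_imp_le]
      mult_norm_less_1(1)[OF _ less_imp_le[OF E]] a(4))+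

lemma b_ratio_nonzero:
  assumes b: "norm b1 < 1" "norm b2 < 1" "norm b3 < 1" "norm b4 < 1" and E: "norm (E_of b1 b2 b3 b4) < 1"
  shows "Rt b1 b2 b3 b4 \<noteq> 0"
proof -
  have M: "P (a1 * a2 * t ^ (2 * card I - 2) * (1 / t) ^ i * b * b') \<noteq> 0" if "i < card I" "norm b < 1" "norm b' < 1" for i b b'
    by (rule P_nonzero[OF M_bb_less_1[OF t that(1) a(3,4) that(2,3)]])
  show ?thesis
    unfolding b_ratio_def Let_def
    unfolding prod_zero_iff[OF finite_lessThan] divide_eq_0_iff mult_eq_0_iff
    using M[OF _ b(1,2)] M[OF _ b(1,3)] M[OF _ b(1,4)] M[OF _ b(2,3)] M[OF _ b(2,4)] M[OF _ b(3,4)] ratio_parts_nz[OF b E]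
    by (metis lessThan_iff)
qed

text \<open>\<open>P_rec\<close> is applied to the factors containing \<open>b4\<close>: three in
  the numerator, and three in the denominator including the one with \<open>E_of\<close>. They
  produce exactly the two triples in Gustafson's evaluations.\<close>

lemma b_ratio_shift:
  assumes b: "norm b1 < 1" "norm b2 < 1" "norm b3 < 1" "norm b4 < 1" "b1 \<noteq> 0" "b2 \<noteq> 0" "b3 \<noteq> 0"
     and E: "norm (E_of b1 b2 b3 b4) < 1"
  shows "Rt b1 b2 b3 b4 * (\<Prod>i<card I. (1 - t ^ i * (a1 * a2 * E_of b1 b2 b3 b4)) * (1 - t ^ i * (a1 * b4)) * (1 - t ^ i * (a2 * b4))) =
   Rt b1 b2 b3 (q * b4) *
     (\<Prod>i<card I. (1 - (1 / t) ^ i * (q * E_of b1 b2 b3 b4 / (b1 * b2))) * (1 - (1 / t) ^ i * (q * E_of b1 b2 b3 b4 / (b1 * b3))) *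
       (1 - (1 / t) ^ i * (q * E_of b1 b2 b3 b4 / (b2 * b3))))"
  unfolding b_ratio_def Let_def prod.distrib[symmetric]
proof (rule prod.cong[OF refl], goal_cases)
  case (1 i)
  then have i: "i < card I" by simp
  define M where "M = a1 * a2 * t ^ (2 * card I - 2)"
  define s where "s = (1 / t) ^ i"
  have nz: "P (t ^ i * (a1 * a2 * (M * b1 * b2 * b3 * b4 / q))) \<noteq> 0" "P (t ^ i * (a1 * b4)) \<noteq> 0" "P (t ^ i * (a2 * b4)) \<noteq> 0"
    using ratio_parts_nz[OF b(1-4) E i] by (simp_all add: M_def)
  have r: "P (M * s * b3 * b4) = (1 - M * s * b3 * b4) * P (M * s * b3 * (q * b4))"
    "P (M * s * b2 * b4) = (1 - M * s * b2 * b4) * P (M * s * b2 * (q * b4))"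
    "P (M * s * b1 * b4) = (1 - M * s * b1 * b4) * P (M * s * b1 * (q * b4))"
    "P (t ^ i * (a1 * b4)) = (1 - t ^ i * (a1 * b4)) * P (t ^ i * (a1 * (q * b4)))"
    "P (t ^ i * (a2 * b4)) = (1 - t ^ i * (a2 * b4)) * P (t ^ i * (a2 * (q * b4)))"
    "P (t ^ i * (a1 * a2 * (M * b1 * b2 * b3 * b4 / q))) = (1 - t ^ i * (a1 * a2 * (M * b1 * b2 * b3 * b4 / q))) * P (t ^ i * (a1 * a2 * (M * b1 * b2 * b3 * (q * b4) / q)))"
    using P_rec[of "M * s * b3 * b4"] P_rec[of "M * s * b2 * b4"] P_rec[of "M * s * b1 * b4"]
      P_rec[of "t ^ i * (a1 * b4)"] P_rec[of "t ^ i * (a2 * b4)"] P_rec[of "t ^ i * (a1 * a2 * (M * b1 * b2 * b3 * b4 / q))"]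
    by (simp_all add: mult_ac)
  have e: "s * (q * (M * b1 * b2 * b3 * b4 / q) / (b1 * b2)) = M * s * b3 * b4"
    "s * (q * (M * b1 * b2 * b3 * b4 / q) / (b1 * b3)) = M * s * b2 * b4"
    "s * (q * (M * b1 * b2 * b3 * b4 / q) / (b2 * b3)) = M * s * b1 * b4"
    using b q_nz by simp_all
  have *: "(X12 * X13 * (f14 * Y14) * X23 * (f24 * Y24) * (f34 * Y34)) / ((g * G) * (A1 * A2 * A3 * (h * H)) * (B1 * B2 * B3 * (k * K))) * (g * h * k) =
    (X12 * X13 * Y14 * X23 * Y24 * Y34) / (G * (A1 * A2 * A3 * H) * (B1 * B2 * B3 * K)) * (f34 * f24 * f14)"
    if "g * G \<noteq> 0" "h * H \<noteq> 0" "k * K \<noteq> 0" for X12 X13 f14 Y14 X23 f24 Y24 f34 Y34 g G A1 A2 A3 h H B1 B2 B3 k K :: complex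
    using that by (simp add: mult_ac)
  show ?case
    unfolding M_def[symmetric] s_def[symmetric] e r
    by (rule *) (use nz in \<open>simp_all only: r[symmetric] not_False_eq_True\<close>)
qed

definition "Gb b1 b2 b3 b4 = (\<integral>z. Wt b1 b2 b3 b4 z \<partial>torus_measure I) / Rt b1 b2 b3 b4"

lemma Gb_shift:
  assumes b: "norm b1 < 1" "norm b2 < 1" "norm b3 < 1" "norm b4 < 1" "b1 \<noteq> 0" "b2 \<noteq> 0" "b3 \<noteq> 0" "b4 \<noteq> 0"
     and E: "norm (E_of b1 b2 b3 b4) < 1"
  shows "Gb b1 b2 b3 (q * b4) = Gb b1 b2 b3 b4"
proof -
  interpret hs: half_shift q a1 a2 b1 b2 b3 b4 t v "card I"
    by unfold_locales (use a b t v E in auto)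
  let ?c = "\<Prod>i<card I. (1 - t ^ i * (a1 * a2 * E_of b1 b2 b3 b4)) * (1 - t ^ i * (a1 * b4)) * (1 - t ^ i * (a2 * b4))"
  let ?c' = "\<Prod>i<card I. (1 - (1 / t) ^ i * (q * E_of b1 b2 b3 b4 / (b1 * b2))) * (1 - (1 / t) ^ i * (q * E_of b1 b2 b3 b4 / (b1 * b3))) *
       (1 - (1 / t) ^ i * (q * E_of b1 b2 b3 b4 / (b2 * b3)))"
  have 1: "(\<integral>z. Wt b1 b2 b3 b4 z \<partial>torus_measure I) * ?c = (\<integral>z. Wt b1 b2 b3 (q * b4) z \<partial>torus_measure I) * ?c'"
    using hs.integral_half_shift[OF I refl] unfolding hs.E_def hs.M_def .
  note 2 = b_ratio_shift[OF b(1-7) E]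
  have qb: "norm (q * b4) < 1" by (rule norm_q_mult_less[OF b(4)])
  have Eq: "norm (E_of b1 b2 b3 (q * b4)) < 1" using norm_q_mult_less[OF E] by (simp add: mult_ac)
  have nz: "Rt b1 b2 b3 b4 \<noteq> 0" "Rt b1 b2 b3 (q * b4) \<noteq> 0"
    by (rule b_ratio_nonzero b qb E Eq)+
  have one: "1 - u \<noteq> 0" if "norm u < 1" for u :: complex using that by auto
  have c: "?c \<noteq> 0"
    unfolding prod_zero_iff[OF finite_lessThan] mult_eq_0_iff
    using one[OF t_less_1[OF t(2) mult_norm_less_1(1)[OF mult_norm_less_1(1)[OF a(3) less_imp_le[OF a(4)]] less_imp_le[OF E]]]]
      one[OF t_less_1[OF t(2) mult_norm_less_1(1)[OF a(3) less_imp_le[OF b(4)]]]]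
      one[OF t_less_1[OF t(2) mult_norm_less_1(1)[OF a(4) less_imp_le[OF b(4)]]]] by blast
  have c': "?c' \<noteq> 0"
  proof
    assume "?c' = 0"
    with 2 have "Rt b1 b2 b3 b4 * ?c = 0" by (simp only: mult_zero_right)
    then show False using no_zero_divisors[OF nz(1) c] by contradiction
  qed
  show ?thesis unfolding Gb_def by (rule divide_transfer[OF 1 2 c c'])
qed

lemma Gb_rotate: "Gb b4 b1 b2 b3 = Gb b1 b2 b3 b4"
  by (simp only: Gb_def weight_rotate b_ratio_rotate)

lemma E_q_less_1: "norm (E_of b1 b2 b3 b4) < 1 \<Longrightarrow> norm (E_of b1 b2 b3 (q * b4)) < 1"
  using norm_q_mult_less[of "E_of b1 b2 b3 b4"] by (simp add: mult_ac)

lemma E_rotate: "E_of b4 b1 b2 b3 = E_of b1 b2 b3 b4"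
  by (simp add: mult_ac)

text \<open>A shift of the last parameter followed by a cyclic rotation. Four rounds restore the
  order with every parameter multiplied by \<open>q\<close>.\<close>

lemma Gb_shift_rotate:
  assumes b: "norm b1 < 1" "norm b2 < 1" "norm b3 < 1" "norm b4 < 1" "b1 \<noteq> 0" "b2 \<noteq> 0" "b3 \<noteq> 0" "b4 \<noteq> 0"
     and E: "norm (E_of b1 b2 b3 b4) < 1"
  shows "Gb (q * b4) b1 b2 b3 = Gb b1 b2 b3 b4" "norm (E_of (q * b4) b1 b2 b3) < 1" "norm (q * b4) < 1" "q * b4 \<noteq> 0"
proof -
  show "Gb (q * b4) b1 b2 b3 = Gb b1 b2 b3 b4" by (simp only: Gb_rotate Gb_shift[OF assms])
  show "norm (E_of (q * b4) b1 b2 b3) < 1" unfolding E_rotate[of "q * b4" b1 b2 b3] by (rule E_q_less_1[OF E])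
  show "norm (q * b4) < 1" by (rule norm_q_mult_less[OF b(4)])
  show "q * b4 \<noteq> 0" using b(8) q_nz by simp
qed

lemma Gb_shift_all:
  assumes b: "norm b1 < 1" "norm b2 < 1" "norm b3 < 1" "norm b4 < 1" "b1 \<noteq> 0" "b2 \<noteq> 0" "b3 \<noteq> 0" "b4 \<noteq> 0"
     and E: "norm (E_of b1 b2 b3 b4) < 1"
  shows "Gb (q * b1) (q * b2) (q * b3) (q * b4) = Gb b1 b2 b3 b4"
    "norm (E_of (q * b1) (q * b2) (q * b3) (q * b4)) < 1"
proof -
  note 1 = Gb_shift_rotate[OF assms]
  note 2 = Gb_shift_rotate[OF 1(3) b(1,2,3) 1(4) b(5,6,7) 1(2)]
  note 3 = Gb_shift_rotate[OF 2(3) 1(3) b(1,2) 2(4) 1(4) b(5,6) 2(2)]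
  note 4 = Gb_shift_rotate[OF 3(3) 2(3) 1(3) b(1) 3(4) 2(4) 1(4) b(5) 3(2)]
  show "Gb (q * b1) (q * b2) (q * b3) (q * b4) = Gb b1 b2 b3 b4" using 1(1) 2(1) 3(1) 4(1) by simp
  show "norm (E_of (q * b1) (q * b2) (q * b3) (q * b4)) < 1" by (rule 4(2))
qed

lemma Gb_shift_power:
  assumes b: "norm b1 < 1" "norm b2 < 1" "norm b3 < 1" "norm b4 < 1" "b1 \<noteq> 0" "b2 \<noteq> 0" "b3 \<noteq> 0" "b4 \<noteq> 0"
     and E: "norm (E_of b1 b2 b3 b4) < 1"
  shows "Gb (q ^ N * b1) (q ^ N * b2) (q ^ N * b3) (q ^ N * b4) = Gb b1 b2 b3 b4 \<and> norm (E_of (q ^ N * b1) (q ^ N * b2) (q ^ N * b3) (q ^ N * b4)) < 1"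
proof (induction N)
  case 0
  then show ?case using E by simp
next
  case (Suc N)
  have l: "norm (q ^ N * u) < 1" if "norm u < 1" for u
    using that by (intro mult_norm_less_1(2)) (use q_less_1 in \<open>auto simp: norm_power power_le_one\<close>)
  have z: "q ^ N * u \<noteq> 0" if "u \<noteq> 0" for u using that q_nz by simp
  have s: "q ^ Suc N * u = q * (q ^ N * u)" for u by simp
  note * = Gb_shift_all[OF l[OF b(1)] l[OF b(2)] l[OF b(3)] l[OF b(4)] z[OF b(5)] z[OF b(6)] z[OF b(7)] z[OF b(8)] conjunct2[OF Suc]]
  show ?case unfolding s using * conjunct1[OF Suc] by simp
qed

lemma Gb_continuous:
  assumes cont: "continuous_on K b1" "continuous_on K b2" "continuous_on K b3" "continuous_on K b4"
    and K: "compact (K :: complex set)"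
    and b: "\<And>s. s \<in> K \<Longrightarrow> norm (b1 s) < 1" "\<And>s. s \<in> K \<Longrightarrow> norm (b2 s) < 1"
        "\<And>s. s \<in> K \<Longrightarrow> norm (b3 s) < 1" "\<And>s. s \<in> K \<Longrightarrow> norm (b4 s) < 1"
    and E: "\<And>s. s \<in> K \<Longrightarrow> norm (E_of (b1 s) (b2 s) (b3 s) (b4 s)) < 1"
    and p: "\<And>n. p n \<in> K" "p0 \<in> K" "p \<longlonglongrightarrow> p0"
  shows "(\<lambda>n. Gb (b1 (p n)) (b2 (p n)) (b3 (p n)) (b4 (p n))) \<longlonglongrightarrow> Gb (b1 p0) (b2 p0) (b3 p0) (b4 p0)"
  unfolding Gb_def
proof (rule tendsto_divide)
  let ?F = "\<lambda>x. Wt (b1 (fst x)) (b2 (fst x)) (b3 (fst x)) (b4 (fst x)) (snd x)"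
  have f: "continuous_on (K \<times> torus I) (\<lambda>x. g (fst x))" if "continuous_on K g" for g :: "complex \<Rightarrow> complex"
    by (rule continuous_on_compose2[OF that continuous_on_fst[OF continuous_on_id]]) auto
  have "continuous_on (K \<times> torus I) ?F"
  proof (rule continuous_weight)
    show "norm (a1 * a2 * t ^ (2 * card I - 2) * b1 (fst w) * b2 (fst w) * b3 (fst w) * b4 (fst w) / q) < 1"
      if "w \<in> K \<times> torus I" for w using E that by auto
    show "norm (snd w i) = 1" if "w \<in> K \<times> torus I" "i \<in> I" for w i using that by auto
    show "continuous_on (K \<times> torus I) (\<lambda>w. snd w i)" for i by (rule continuous_on_snd_coordinate)
  qed (use a v t b in \<open>auto intro!: f cont\<close>)
  from torus_integral_tendsto[OF I K this p]
  show "(\<lambda>n. integral\<^sup>L (torus_measure I) (Wt (b1 (p n)) (b2 (p n)) (b3 (p n)) (b4 (p n)))) \<longlonglongrightarrow>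
    integral\<^sup>L (torus_measure I) (Wt (b1 p0) (b2 p0) (b3 p0) (b4 p0))" by simp
  have "continuous_on K (\<lambda>s. Rt (b1 s) (b2 s) (b3 s) (b4 s))"
  proof -
    have nz: "P (t ^ i * (a1 * a2 * E_of (b1 s) (b2 s) (b3 s) (b4 s))) *
           (P (t ^ i * (a1 * b1 s)) * P (t ^ i * (a1 * b2 s)) * P (t ^ i * (a1 * b3 s)) * P (t ^ i * (a1 * b4 s))) *
           (P (t ^ i * (a2 * b1 s)) * P (t ^ i * (a2 * b2 s)) * P (t ^ i * (a2 * b3 s)) * P (t ^ i * (a2 * b4 s))) \<noteq> 0"
      if "i \<in> {..<card I}" "s \<in> K" for i s
    proof -
      from that(1) have i: "i < card I" by simp
      show ?thesis unfolding mult_eq_0_iff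
        using ratio_parts_nz[OF b(1)[OF that(2)] b(2)[OF that(2)] b(3)[OF that(2)] b(4)[OF that(2)] E[OF that(2)] i] by blast
    qed
    show ?thesis unfolding b_ratio_def Let_def
    proof (rule continuous_on_prod, rule continuous_on_divide)
      fix i assume i: "i \<in> {..<card I}"
      show "\<forall>s\<in>K. P (t ^ i * (a1 * a2 * E_of (b1 s) (b2 s) (b3 s) (b4 s))) *
           (P (t ^ i * (a1 * b1 s)) * P (t ^ i * (a1 * b2 s)) * P (t ^ i * (a1 * b3 s)) * P (t ^ i * (a1 * b4 s))) *
           (P (t ^ i * (a2 * b1 s)) * P (t ^ i * (a2 * b2 s)) * P (t ^ i * (a2 * b3 s)) * P (t ^ i * (a2 * b4 s))) \<noteq> 0"
        by (rule ballI, rule nz[OF i])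
    qed (intro continuous_intros cont; simp add: q_nz)+
  qed
  then show "(\<lambda>n. Rt (b1 (p n)) (b2 (p n)) (b3 (p n)) (b4 (p n))) \<longlonglongrightarrow> Rt (b1 p0) (b2 p0) (b3 p0) (b4 p0)"
    using p unfolding continuous_on_sequentially by (auto simp: o_def)
  show "Rt (b1 p0) (b2 p0) (b3 p0) (b4 p0) \<noteq> 0" by (rule b_ratio_nonzero b E p)+
qed

lemma Gb_eq_0:
  assumes b: "norm b1 < 1" "norm b2 < 1" "norm b3 < 1" "norm b4 < 1" "b1 \<noteq> 0" "b2 \<noteq> 0" "b3 \<noteq> 0" "b4 \<noteq> 0"
     and E: "norm (E_of b1 b2 b3 b4) < 1"
  shows "Gb b1 b2 b3 b4 = Gb 0 0 0 0"
proof -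
  have l: "norm (s * u) < 1" if "norm u < 1" "s \<in> cball 0 1" for u s :: complex
    using that by (intro mult_norm_less_1(2)) auto
  have "(\<lambda>N. Gb (q ^ N * b1) (q ^ N * b2) (q ^ N * b3) (q ^ N * b4)) \<longlonglongrightarrow> Gb (0 * b1) (0 * b2) (0 * b3) (0 * b4)"
  \<comment> \<open>The ray through the parameters is taken over the whole closed disc, a compact
    set containing all powers of \<open>q\<close> and their limit 0.\<close>
  proof (rule Gb_continuous[where K="cball 0 1" and ?b1.0="\<lambda>s. s * b1" and ?b2.0="\<lambda>s. s * b2" and ?b3.0="\<lambda>s. s * b3" and ?b4.0="\<lambda>s. s * b4"])
    show "norm (E_of (s * b1) (s * b2) (s * b3) (s * b4)) < 1" if "s \<in> cball 0 1" for s
    proof -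
      have "norm (s * (s * (s * (s * E_of b1 b2 b3 b4)))) < 1" by (intro l E that)
      then show ?thesis by (simp add: mult_ac)
    qed
    show "q ^ n \<in> cball 0 1" for n using q_less_1 by (simp add: norm_power power_le_one)
    show "(\<lambda>n. q ^ n) \<longlonglongrightarrow> 0" using q_less_1 by (rule LIMSEQ_power_zero)
  qed (auto intro!: continuous_intros l b simp del: mem_cball)
  moreover have "Gb (q ^ N * b1) (q ^ N * b2) (q ^ N * b3) (q ^ N * b4) = Gb b1 b2 b3 b4" for N
    using Gb_shift_power[OF assms] by blast
  ultimately show ?thesis using LIMSEQ_unique[OF tendsto_const] by fastforce
qed

text \<open>\<open>Gb_eq_0\<close> requires nonzero parameters, so \<open>b\<close> stays fixed
  while the other three run through q^(N+1) towards 0. The extra factor \<open>q\<close> absorbs the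
  division by \<open>q\<close> in \<open>E_of\<close> and keeps its modulus below 1.\<close>

lemma Gb_single:
  assumes b: "norm b < 1" "b \<noteq> 0"
  shows "Gb b 0 0 0 = Gb 0 0 0 0"
proof -
  have l: "norm (s * q) < 1" if "s \<in> cball 0 1" for s :: complex
    using that by (intro mult_norm_less_1(2)) (use q_less_1 in auto)
  have E: "norm (E_of b (s * q) (s * q) (s * q)) < 1" if "s \<in> cball 0 1" for s
  proof -
    have "norm (a1 * (a2 * (t ^ (2 * card I - 2) * (b * (s * (s * q * (s * q))))))) < 1"
      using that b(1) a(4) q_less_1 t(2) by (intro mult_norm_less_1(1)[OF a(3)] mult_norm_le_1) (auto simp: norm_power power_le_one)
    then show ?thesis using q_nz by (simp add: mult_ac)
  qed
  have "(\<lambda>N. Gb b (q ^ N * q) (q ^ N * q) (q ^ N * q)) \<longlonglongrightarrow> Gb b (0 * q) (0 * q) (0 * q)"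
  proof (rule Gb_continuous[where K="cball 0 1" and ?b1.0="\<lambda>s. b" and ?b2.0="\<lambda>s. s * q" and ?b3.0="\<lambda>s. s * q" and ?b4.0="\<lambda>s. s * q"])
    show "q ^ n \<in> cball 0 1" for n using q_less_1 by (simp add: norm_power power_le_one)
    show "(\<lambda>n. q ^ n) \<longlonglongrightarrow> 0" using q_less_1 by (rule LIMSEQ_power_zero)
    show "norm (E_of b (s * q) (s * q) (s * q)) < 1" if "s \<in> cball 0 1" for s by (rule E[OF that])
  qed (auto intro!: continuous_intros l b simp del: mem_cball)
  moreover have "Gb b (q ^ N * q) (q ^ N * q) (q ^ N * q) = Gb 0 0 0 0" for N
  proof (rule Gb_eq_0)
    have N: "q ^ N \<in> cball 0 1" using q_less_1 by (simp add: norm_power power_le_one)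
    show "norm (E_of b (q ^ N * q) (q ^ N * q) (q ^ N * q)) < 1" by (rule E[OF N])
    show "norm (q ^ N * q) < 1" "norm (q ^ N * q) < 1" "norm (q ^ N * q) < 1" by (rule l[OF N])+
  qed (use b q_nz in auto)
  ultimately show ?thesis using LIMSEQ_unique[OF tendsto_const] by fastforce
qed

end
end

section \<open>The Poisson kernel as an approximate identity\<close>

lemma circle_integrable:
  fixes f :: "complex \<Rightarrow> 'b::{banach, second_countable_topology}"
  assumes f: "continuous_on unit_circle f"
  shows "integrable circle_measure f"
proof -
  obtain B where "\<forall>x\<in>unit_circle. norm (f x) \<le> B" using compact_bounded_norm[OF compact_sphere f] by blast
  moreover have "f \<in> borel_measurable circle_measure"
    using borel_measurable_continuous_on_restrict[OF f] by (simp add: measurable_cong_sets[OF sets_circle_measure refl])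
  ultimately show ?thesis
    by (intro finite_measure.integrable_const_bound[OF circle_measure_finite, of _ B]) auto
qed

lemma integral_simple_pole:
  assumes a: "norm a < 1"
  shows "(\<integral>x. 1 / (1 - a / x) \<partial>circle_measure) = 1"
proof -
  have "1 - a / x \<noteq> 0" if "norm x = 1" for x
    using a that by auto
  then have "continuous_on unit_circle (\<lambda>x. 1 / (1 - a / x))"
    by (intro continuous_intros) auto
  then have "(\<integral>x. 1 / (1 - a / x) \<partial>circle_measure) = contour_integral (circlepath 0 1) (\<lambda>x. 1 / (1 - a / x) / x) / (2 * of_real pi * \<i>)"
    by (rule integral_circle_contour)
  also have "contour_integral (circlepath 0 1) (\<lambda>x. 1 / (1 - a / x) / x) = contour_integral (circlepath 0 1) (\<lambda>x. 1 / (x - a))"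
    by (rule contour_integral_cong) (auto simp: field_simps)
  also have "\<dots> = 2 * of_real pi * \<i>"
    using Cauchy_integral_circlepath_simple[of "\<lambda>_. 1" 0 1 a] a
    by (intro contour_integral_unique) (auto simp: holomorphic_intros)
  finally show ?thesis by simp
qed

definition poisson :: "real \<Rightarrow> complex \<Rightarrow> real"
  where "poisson r x = (1 - r\<^sup>2) / (norm (1 - of_real r / x))\<^sup>2"

context
  fixes r :: real
  assumes r: "0 \<le> r" "r < 1"
begin

lemma one_minus_over_nz: "norm x = 1 \<Longrightarrow> 1 - complex_of_real r / x \<noteq> 0"
proof
  assume "norm x = 1" "1 - of_real r / x = 0"
  then have "norm (of_real r / x) = 1" by simp
  then show False using r \<open>norm x = 1\<close> by (simp add: norm_divide)
qed

lemma poisson_nonneg: "0 \<le> poisson r x"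
  using r by (simp add: poisson_def power_le_one)

lemma poisson_eq:
  assumes "norm x = 1"
  shows "complex_of_real (poisson r x) = (1 - of_real r * of_real r) / ((1 - of_real r * x) * (1 - of_real r / x))"
proof -
  have "x * cnj x = 1" using assms by (simp add: complex_norm_square[symmetric])
  then have "1 / cnj x = x" using assms by (metis complex_cnj_zero_iff mult_zero_right nonzero_eq_divide_eq zero_neq_one)
  moreover have "cnj (1 - of_real r / x) = 1 - of_real r * (1 / cnj x)" by simp
  ultimately have "cnj (1 - of_real r / x) = 1 - of_real r * x" by (simp only:)
  then show ?thesis
    unfolding poisson_def of_real_divide complex_norm_square by (simp add: power2_eq_square mult.commute)
qed

lemma continuous_poisson: "continuous_on unit_circle (poisson r)"
  unfolding poisson_def by (intro continuous_intros) (use one_minus_over_nz r in auto)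

lemma integral_poisson: "(\<integral>x. poisson r x \<partial>circle_measure) = 1"
proof -
  let ?f = "\<lambda>x. 1 / (1 - complex_of_real r / x)"
  have f: "integrable circle_measure ?f"
    by (intro circle_integrable continuous_intros) (use one_minus_over_nz r in auto)
  \<comment> \<open>This reduces the mean of the kernel to that of \<open>?f\<close>, which is 1 by
    \<open>integral_simple_pole\<close>.\<close>
  have "poisson r x = 2 * Re (?f x) - 1" if "norm x = 1" for x
  proof -
    define a where "a = of_real r / x"
    have a: "norm a = r" "1 - a \<noteq> 0" using r that one_minus_over_nz[OF that] by (auto simp: a_def norm_divide)
    have "(norm (1 - a))\<^sup>2 = 1 - 2 * Re a + r\<^sup>2"
      unfolding a(1)[symmetric] cmod_power2 by (simp add: power2_eq_square algebra_simps)
    moreover have "Re (1 / (1 - a)) = (1 - Re a) / (norm (1 - a))\<^sup>2"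
      by (simp add: Re_divide cmod_power2)
    moreover have "(norm (1 - a))\<^sup>2 \<noteq> 0" using a by simp
    ultimately show ?thesis unfolding poisson_def a_def[symmetric] by (simp add: field_simps)
  qed
  then have "(\<integral>x. poisson r x \<partial>circle_measure) = (\<integral>x. 2 * Re (?f x) - 1 \<partial>circle_measure)"
    by (intro Bochner_Integration.integral_cong refl) auto
  also have "\<dots> = 2 * Re (\<integral>x. ?f x \<partial>circle_measure) - 1"
    using f by (simp add: Bochner_Integration.integral_diff circle_integrable measure_def emeasure_circle_measure_space integral_Re)
  finally show ?thesis using integral_simple_pole[of "of_real r"] r by simp
qed

text \<open>On the circle 1 - r \<le> |x - r|, hence |x - 1| \<le> 2 |x - r|, and the kernel times
  |x - 1|^2 is at most 4 (1 - r^2). A quadratic majorant thus contributes nothing in the limit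
  \<open>r \<rightarrow> 1\<close>.\<close>

lemma poisson_mean_bound:
  fixes g :: "complex \<Rightarrow> complex"
  assumes g: "continuous_on unit_circle g" and C: "0 \<le> C"
    and le: "\<And>x. norm x = 1 \<Longrightarrow> norm (g x) \<le> e + C * (norm (x - 1))\<^sup>2"
  shows "norm (\<integral>x. poisson r x * g x \<partial>circle_measure) \<le> e + 4 * C * (1 - r\<^sup>2)"
proof -
  have "norm (\<integral>x. poisson r x * g x \<partial>circle_measure) \<le> (\<integral>x. e * poisson r x + 4 * C * (1 - r\<^sup>2) \<partial>circle_measure)"
  proof (rule Bochner_Integration.integral_norm_bound_integral)
    fix x assume "x \<in> space circle_measure"
    then have x: "norm x = 1" by simp
    have n: "norm (1 - of_real r / x) = norm (x - of_real r)"
    proof -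
      have "1 - of_real r / x = (x - of_real r) / x" using x by (auto simp: diff_divide_distrib)
      then show ?thesis using x by (simp add: norm_divide)
    qed
    have "norm (x - 1) \<le> norm (x - of_real r) + (1 - r)"
      using norm_triangle_ineq[of "x - of_real r" "of_real r - 1"] r
      by (simp add: norm_minus_commute[of _ 1]) (metis of_real_1 of_real_diff norm_of_real abs_of_nonneg diff_ge_0_iff_ge less_imp_le)
    moreover have "1 - r \<le> norm (x - of_real r)" using norm_triangle_ineq2[of x "of_real r"] x r by simp
    ultimately have "norm (x - 1) \<le> 2 * norm (x - of_real r)" by linarith
    then have "(norm (x - 1))\<^sup>2 \<le> (2 * norm (x - of_real r))\<^sup>2" by (intro power_mono) auto
    then have 1: "(norm (x - 1))\<^sup>2 \<le> 4 * (norm (1 - of_real r / x))\<^sup>2" by (simp add: n power_mult_distrib)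
    have "poisson r x * (norm (x - 1))\<^sup>2 \<le> poisson r x * (4 * (norm (1 - of_real r / x))\<^sup>2)"
      by (rule mult_left_mono[OF 1 poisson_nonneg])
    also have "\<dots> = 4 * (1 - r\<^sup>2)" using one_minus_over_nz[OF x] x by (auto simp: poisson_def)
    finally have 2: "C * (poisson r x * (norm (x - 1))\<^sup>2) \<le> C * (4 * (1 - r\<^sup>2))" using C by (rule mult_left_mono)
    have "norm (poisson r x * g x) \<le> poisson r x * (e + C * (norm (x - 1))\<^sup>2)"
      unfolding norm_mult using poisson_nonneg[of x] by (simp add: mult_left_mono le[OF x])
    then show "norm (poisson r x * g x) \<le> e * poisson r x + 4 * C * (1 - r\<^sup>2)" using 2 by (simp add: algebra_simps)
  qed (intro circle_integrable continuous_intros continuous_poisson g)+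
  also have "\<dots> = e + 4 * C * (1 - r\<^sup>2)"
    by (subst Bochner_Integration.integral_add)
      (auto intro!: circle_integrable continuous_intros continuous_poisson simp: integral_poisson measure_def emeasure_circle_measure_space)
  finally show ?thesis .
qed

end

text \<open>The sequence starts at 1/2 and stays away from 0, so division by it is continuous on the
  compact interval \<open>{1/2..1}\<close>.\<close>

definition approach :: "nat \<Rightarrow> real"
  where "approach n = real (Suc n) / real (Suc (Suc n))"

lemma approach: "approach n \<in> {1/2..1}" "approach \<longlonglongrightarrow> 1"
  using LIMSEQ_Suc[of "\<lambda>n. real n / real (Suc n)", OF LIMSEQ_n_over_Suc_n] by (auto simp: approach_def[abs_def] field_simps)

lemma approach_pos: "0 < approach n"
  by (simp add: approach_def)

lemma approach_bounds: "0 \<le> approach n" "approach n < 1"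
  by (simp_all add: approach_def)

lemma poisson_tendsto:
  fixes F :: "real \<times> complex \<Rightarrow> complex"
  assumes F: "continuous_on ({1/2..1} \<times> unit_circle) F"
  shows "(\<lambda>n. \<integral>x. poisson (approach n) x * F (approach n, x) \<partial>circle_measure) \<longlonglongrightarrow> F (1, 1)"
proof -
  have Fr: "continuous_on unit_circle (\<lambda>x. F (r, x))" if "r \<in> {1/2..1}" for r
    by (rule continuous_on_compose2[OF F]) (use that in \<open>auto intro!: continuous_intros\<close>)
  obtain B where B: "\<And>x. x \<in> {1/2..1} \<times> unit_circle \<Longrightarrow> norm (F x) \<le> B"
    using compact_bounded_norm[OF compact_Times[OF compact_Icc compact_sphere] F] by blast
  have B0: "0 \<le> B" using order_trans[OF norm_ge_zero B[of "(1, 1)"]] by simp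
  have "(\<lambda>n. \<integral>x. poisson (approach n) x * (F (approach n, x) - F (approach n, 1)) \<partial>circle_measure) \<longlonglongrightarrow> 0"
  proof (rule LIMSEQ_I)
    fix e :: real assume e: "0 < e"
    obtain d where d: "d > 0" "\<And>x y. x \<in> {1/2..1} \<times> unit_circle \<Longrightarrow> y \<in> {1/2..1} \<times> unit_circle \<Longrightarrow> dist y x < d \<Longrightarrow> dist (F y) (F x) < e / 2"
      by (rule uniformly_continuous_onE[OF compact_uniformly_continuous[OF F compact_Times[OF compact_Icc compact_sphere]] half_gt_zero[OF e]]) blast
    \<comment> \<open>Where |x - 1| \<ge> d, the trivial bound 2 B is at most C |x - 1|^2.\<close>
    define C where "C = 2 * B / d\<^sup>2"
    have C: "0 \<le> C" using B0 by (simp add: C_def)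
    have le: "norm (F (r, x) - F (r, 1)) \<le> e / 2 + C * (norm (x - 1))\<^sup>2" if r: "r \<in> {1/2..1}" and x: "norm x = 1" for r x
    proof (cases "norm (x - 1) < d")
      case True
      then have "norm (F (r, x) - F (r, 1)) < e / 2"
        using d(2)[of "(r, 1)" "(r, x)"] r x by (simp add: dist_norm dist_Pair_Pair)
      moreover have "0 \<le> C * (norm (x - 1))\<^sup>2" using C by simp
      ultimately show ?thesis by linarith
    next
      case False
      have "norm (F (r, x) - F (r, 1)) \<le> norm (F (r, x)) + norm (F (r, 1))" by (rule norm_triangle_ineq4)
      also have "\<dots> \<le> C * d\<^sup>2" using B[of "(r, x)"] B[of "(r, 1)"] r x d(1) by (simp add: C_def)
      also have "\<dots> \<le> C * (norm (x - 1))\<^sup>2" using False C d(1) by (intro mult_left_mono power_mono) auto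
      finally show ?thesis using e by simp
    qed
    have "(\<lambda>n. 4 * C * (1 - (approach n)\<^sup>2)) \<longlonglongrightarrow> 4 * C * (1 - 1\<^sup>2)" by (intro tendsto_intros approach)
    then have "eventually (\<lambda>n. 4 * C * (1 - (approach n)\<^sup>2) < e / 2) sequentially" using e by (intro order_tendstoD) auto
    then obtain N where N: "\<And>n. n \<ge> N \<Longrightarrow> 4 * C * (1 - (approach n)\<^sup>2) < e / 2" by (auto simp: eventually_sequentially)
    have "norm (\<integral>x. poisson (approach n) x * (F (approach n, x) - F (approach n, 1)) \<partial>circle_measure) \<le> e / 2 + 4 * C * (1 - (approach n)\<^sup>2)" for n
      by (intro poisson_mean_bound approach_bounds approach(1) C le continuous_intros Fr)
    then show "\<exists>no. \<forall>n\<ge>no. norm ((\<integral>x. poisson (approach n) x * (F (approach n, x) - F (approach n, 1)) \<partial>circle_measure) - 0) < e"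
      using N by (intro exI[of _ N]) (smt (verit) diff_zero field_sum_of_halves)
  qed
  moreover have "(\<lambda>n. F (approach n, 1)) \<longlonglongrightarrow> F (1, 1)"
    by (rule continuous_on_tendsto_compose[OF F]) (use approach in \<open>auto intro!: tendsto_intros\<close>)
  ultimately have "(\<lambda>n. (\<integral>x. poisson (approach n) x * (F (approach n, x) - F (approach n, 1)) \<partial>circle_measure) + F (approach n, 1)) \<longlonglongrightarrow> 0 + F (1, 1)"
    by (rule tendsto_add)
  moreover have "(\<integral>x. poisson (approach n) x * F (approach n, x) \<partial>circle_measure) =
      (\<integral>x. poisson (approach n) x * (F (approach n, x) - F (approach n, 1)) \<partial>circle_measure) + F (approach n, 1)" for n
  proof -
    have "(\<integral>x. complex_of_real (poisson (approach n) x) \<partial>circle_measure) = 1"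
      using integral_poisson[OF approach_bounds] by (simp add: integral_complex_of_real)
    moreover have "integrable circle_measure (\<lambda>x. poisson (approach n) x * F (approach n, x))" "integrable circle_measure (\<lambda>x. poisson (approach n) x * F (approach n, 1))"
      by (intro circle_integrable continuous_intros continuous_poisson approach_bounds approach(1) Fr)+
    ultimately show ?thesis by (simp add: right_diff_distrib Bochner_Integration.integral_diff)
  qed
  ultimately show ?thesis by simp
qed

text \<open>Fubini singles out the variable \<open>i\<close>, in which the kernel tends to the point
  mass at 1; dominated convergence then handles the other variables.\<close>

lemma torus_poisson_tendsto:
  fixes F :: "real \<times> (nat \<Rightarrow> complex) \<Rightarrow> complex"
  assumes J: "finite J" "i \<notin> J" and F: "continuous_on ({1/2..1} \<times> torus (insert i J)) F"
  shows "(\<lambda>n. \<integral>z. poisson (approach n) (z i) * F (approach n, z) \<partial>torus_measure (insert i J)) \<longlonglongrightarrow> (\<integral>z. F (1, z(i := 1)) \<partial>torus_measure J)"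
proof -
  let ?I = "insert i J"
  have upd: "z(i := x) \<in> torus ?I" if "z \<in> torus J" "norm x = 1" for z x
    using that by (intro torusI) (auto simp: torus_undefined)
  have cu: "continuous_on X (\<lambda>x. z(i := x))" for X :: "complex set" and z :: "nat \<Rightarrow> complex"
  proof (rule continuous_on_coordinatewise_then_product)
    show "continuous_on X (\<lambda>x. (z(i := x)) k)" for k by (cases "k = i") (auto intro!: continuous_intros)
  qed
  have Fx: "continuous_on ({1/2..1} \<times> unit_circle) (\<lambda>x. F (fst x, z(i := snd x)))" if "z \<in> torus J" for z
  proof (rule continuous_on_compose2[OF F])
    have "continuous_on ({1/2..1} \<times> unit_circle) (\<lambda>x. z(i := snd x))"
      by (rule continuous_on_compose2[OF cu continuous_on_snd[OF continuous_on_id]]) auto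
    then show "continuous_on ({1/2..1} \<times> unit_circle) (\<lambda>x. (fst x, z(i := snd x)))" by (intro continuous_on_Pair continuous_on_fst continuous_on_id)
  qed (use upd that in auto)
  have h: "continuous_on (torus ?I) (\<lambda>z. poisson (approach n) (z i) * F (approach n, z))" for n
  proof -
    have "continuous_on (torus ?I) (\<lambda>z. F (approach n, z))"
      by (rule continuous_on_compose2[OF F]) (use approach in \<open>auto intro!: continuous_intros\<close>)
    moreover have "continuous_on (torus ?I) (\<lambda>z. poisson (approach n) (z i))"
      by (rule continuous_on_compose2[OF continuous_poisson[OF approach_bounds]]) (auto intro!: continuous_intros)
    ultimately show ?thesis by (intro continuous_intros)
  qed
  obtain B where B: "\<And>x. x \<in> {1/2..1} \<times> torus ?I \<Longrightarrow> norm (F x) \<le> B"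
    using compact_bounded_norm[OF compact_Times[OF compact_Icc compact_torus] F] by blast
  let ?g = "\<lambda>n z. \<integral>x. poisson (approach n) x * F (approach n, z(i := x)) \<partial>circle_measure"
  have lim: "(\<lambda>n. ?g n z) \<longlonglongrightarrow> F (1, z(i := 1))" if "z \<in> torus J" for z
    using poisson_tendsto[OF Fx[OF that]] by simp
  have gm: "?g n \<in> borel_measurable (torus_measure J)" for n
  proof -
    have "(\<lambda>(z, x). poisson (approach n) x * F (approach n, z(i := x))) \<in> borel_measurable (torus_measure J \<Otimes>\<^sub>M circle_measure)"
      using measurable_compose[OF measurable_add_dim[of i J "\<lambda>_. circle_measure"] torus_measurable[OF h[of n]]]
      by (simp add: case_prod_unfold)
    then show ?thesis
      by (rule sigma_finite_measure.borel_measurable_lebesgue_integral[OF finite_measure.axioms(1)[OF circle_measure_finite]])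
  qed
  have "(\<lambda>n. \<integral>z. ?g n z \<partial>torus_measure J) \<longlonglongrightarrow> (\<integral>z. F (1, z(i := 1)) \<partial>torus_measure J)"
  proof (rule integral_dominated_convergence[where w="\<lambda>_. B"])
    show "(\<lambda>z. F (1, z(i := 1))) \<in> borel_measurable (torus_measure J)"
      by (rule borel_measurable_LIMSEQ_metric[OF gm]) (use lim in simp)
    show "integrable (torus_measure J) (\<lambda>_. B)"
      by (rule finite_measure.integrable_const[OF torus_measure_finite[OF J(1)]])
    show "AE z in torus_measure J. norm (?g n z) \<le> B" for n
    proof (rule AE_I2)
      fix z assume "z \<in> space (torus_measure J)"
      then have z: "z \<in> torus J" by simp
      have "continuous_on unit_circle (\<lambda>x. F (approach n, z(i := x)))"
        by (rule continuous_on_compose2[OF Fx[OF z], of _ "\<lambda>x. (approach n, x)", simplified])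
          (use approach in \<open>auto intro!: continuous_intros\<close>)
      \<comment> \<open>With \<open>C = 0\<close> the estimate says that averaging against the
        kernel does not increase the bound.\<close>
      from poisson_mean_bound[OF approach_bounds this order_refl, of B] show "norm (?g n z) \<le> B"
        using B approach(1)[of n] upd[OF z] by simp
    qed
  qed (use lim gm in auto)
  moreover have "(\<integral>z. poisson (approach n) (z i) * F (approach n, z) \<partial>torus_measure ?I) = (\<integral>z. ?g n z \<partial>torus_measure J)" for n
    using circle.product_integral_insert[OF J torus_integrable[OF _ h[of n]]] J by simp
  ultimately show ?thesis by simp
qed

text \<open>After multiplication by the product of all \<open>1 - r * z i\<close> this is Lagrange
  interpolation, in the variable \<open>r\<close>, of the constant 1 at the nodes
  \<open>1 / z i\<close>.\<close>

lemma partial_fractions: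
  fixes z :: "nat \<Rightarrow> complex"
  assumes I: "finite I" "I \<noteq> {}" and z: "inj_on z I" "\<And>i. i \<in> I \<Longrightarrow> z i \<noteq> 0"
    and r: "\<And>i. i \<in> I \<Longrightarrow> 1 - r * z i \<noteq> 0"
  shows "(\<Prod>i\<in>I. 1 / (1 - r * z i)) = (\<Sum>i\<in>I. 1 / (1 - r * z i) * (\<Prod>k\<in>I-{i}. 1 / (1 - z k / z i)))"
proof -
  let ?f = "\<lambda>r. (\<Sum>i\<in>I. (\<Prod>k\<in>I-{i}. (1 - r * z k) * (1 / (1 - z k / z i)))) - 1"
  have "?f r = 0"
  proof (rule poly_fun_eq_0[where f="?f" and N="card I - 1" and Z="(\<lambda>i. 1 / z i) ` I"])
    have "poly_fun (1 * card (I - {i})) (\<lambda>r. \<Prod>k\<in>I-{i}. (1 - r * z k) * (1 / (1 - z k / z i)))" if "i \<in> I" for i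
    proof (rule poly_fun_prod)
      fix k
      show "poly_fun 1 (\<lambda>r. (1 - r * z k) * (1 / (1 - z k / z i)))"
        using poly_fun_mult[OF poly_fun_linear[of 1 "- z k"] poly_fun_const[of "1 / (1 - z k / z i)"]] by (simp add: mult.commute)
    qed (use I in auto)
    then have p: "poly_fun (card I - 1) (\<lambda>r. \<Prod>k\<in>I-{i}. (1 - r * z k) * (1 / (1 - z k / z i)))" if "i \<in> I" for i
      using that I by simp
    have one: "poly_fun (card I - 1) (\<lambda>r. 1)"
      unfolding poly_fun_def by (rule exI[of _ 1]) simp
    show "poly_fun (card I - 1) ?f" by (intro poly_fun_diff poly_fun_sum p one)
    have "inj_on (\<lambda>i. 1 / z i) I" using z by (auto simp: inj_on_def)
    then show "card ((\<lambda>i. 1 / z i) ` I) > card I - 1" using I by (simp add: card_image card_gt_0_iff)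
    fix u assume "u \<in> (\<lambda>i. 1 / z i) ` I"
    then obtain j where j: "j \<in> I" "u = 1 / z j" by auto
    have "(\<Sum>i\<in>I. (\<Prod>k\<in>I-{i}. (1 - u * z k) * (1 / (1 - z k / z i)))) = (\<Sum>i\<in>I. if i = j then 1 else 0)"
    proof (rule sum.cong[OF refl])
      fix i assume i: "i \<in> I"
      show "(\<Prod>k\<in>I-{i}. (1 - u * z k) * (1 / (1 - z k / z i))) = (if i = j then 1 else 0)"
      proof (cases "i = j")
        case True
        have "(1 - u * z k) * (1 / (1 - z k / z i)) = 1" if "k \<in> I - {i}" for k
          using that i z j True by (auto simp: inj_on_def)
        then have "(\<Prod>k\<in>I-{i}. (1 - u * z k) * (1 / (1 - z k / z i))) = 1" by (intro prod.neutral) blast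
        then show ?thesis using True by (simp only: if_True refl)
      next
        case False
        then have "(\<Prod>k\<in>I-{i}. (1 - u * z k) * (1 / (1 - z k / z i))) = 0"
          using I j z by (intro prod_zero) (auto intro!: bexI[of _ j])
        then show ?thesis using False by simp
      qed
    qed
    also have "\<dots> = 1" using I j by simp
    finally show "?f u = 0" by simp
  qed (use I in auto)
  then have s: "(\<Sum>i\<in>I. (\<Prod>k\<in>I-{i}. (1 - r * z k) * (1 / (1 - z k / z i)))) = 1" by (rule eq_iff_diff_eq_0[THEN iffD2])
  have "(\<Prod>i\<in>I. 1 / (1 - r * z i)) = (\<Prod>i\<in>I. 1 / (1 - r * z i)) * (\<Sum>i\<in>I. (\<Prod>k\<in>I-{i}. (1 - r * z k) * (1 / (1 - z k / z i))))"
    by (simp only: s mult_1_right)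
  also have "\<dots> = (\<Sum>i\<in>I. 1 / (1 - r * z i) * (\<Prod>k\<in>I-{i}. 1 / (1 - z k / z i)))"
    unfolding sum_distrib_left
  proof (rule sum.cong[OF refl])
    fix i assume i: "i \<in> I"
    have "(\<Prod>i\<in>I. 1 / (1 - r * z i)) * (\<Prod>k\<in>I-{i}. (1 - r * z k) * (1 / (1 - z k / z i)))
      = 1 / (1 - r * z i) * (\<Prod>k\<in>I-{i}. (1 / (1 - r * z k)) * ((1 - r * z k) * (1 / (1 - z k / z i))))"
      by (subst prod.remove[OF I(1) i]) (simp only: prod.distrib mult_ac)
    also have "(\<Prod>k\<in>I-{i}. (1 / (1 - r * z k)) * ((1 - r * z k) * (1 / (1 - z k / z i)))) = (\<Prod>k\<in>I-{i}. 1 / (1 - z k / z i))"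
      by (rule prod.cong[OF refl]) (use r in auto)
    finally show "(\<Prod>i\<in>I. 1 / (1 - r * z i)) * (\<Prod>k\<in>I-{i}. (1 - r * z k) * (1 / (1 - z k / z i)))
      = 1 / (1 - r * z i) * (\<Prod>k\<in>I-{i}. 1 / (1 - z k / z i))" .
  qed
  finally show ?thesis .
qed

section \<open>The integral with at most one nonzero parameter \<open>b\<close>\<close>

context nome begin

text \<open>With \<open>b2\<close>, \<open>b3\<close> and \<open>b4\<close> equal to 0, also
  \<open>E\<close> and all numerator parameters of \<open>weight\<close> vanish; of the interaction
  only the part depending on quotients of variables remains.\<close>

definition A_pair :: "complex \<Rightarrow> complex \<Rightarrow> complex \<Rightarrow> complex"
  where "A_pair t x y = (P (x / y) * P (y / x)) / (P (t * x / y) * P (t * y / x))"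

definition A_single :: "complex \<Rightarrow> complex \<Rightarrow> complex \<Rightarrow> complex \<Rightarrow> complex \<Rightarrow> complex \<Rightarrow> complex"
  where "A_single a1 a2 b al v x = Th (al / x) * Th (v * x) / (P (a1 / x) * P (a2 / x) * P (b * x))"

definition A_weight :: "nat set \<Rightarrow> complex \<Rightarrow> complex \<Rightarrow> complex \<Rightarrow> complex \<Rightarrow> complex \<Rightarrow> (nat \<Rightarrow> complex) \<Rightarrow> complex"
  where "A_weight I t v a1 a2 b z = (\<Prod>i\<in>I. A_single a1 a2 b (t ^ (card I - 1) * a1 * a2 * v) v (z i)) *
     (\<Prod>(j,k)\<in>pairs I. A_pair t (z j) (z k))"

abbreviation A_integral where "A_integral I t v a1 a2 b \<equiv> (\<integral>z. A_weight I t v a1 a2 b z \<partial>torus_measure I)"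

lemma A_weight_eq: "A_weight I t v a1 a2 b z = weight I t v a1 a2 b 0 0 0 z"
  by (simp add: A_weight_def weight_def Let_def single_weight_def pair_weight_def A_single_def A_pair_def)

text \<open>In \<open>b_ratio\<close> only the factors with \<open>a1 * b\<close> and
  \<open>a2 * b\<close> survive, so the invariance of \<open>Gb\<close> says how the integral
  changes when \<open>b\<close> is inserted.\<close>

lemma A_integral_b:
  assumes "t \<noteq> 0" "norm t < 1" "a1 \<noteq> 0" "a2 \<noteq> 0" "norm a1 < 1" "norm a2 < 1" "v \<noteq> 0" "finite I" "norm b < 1" "b \<noteq> 0"
  shows "A_integral I t v a1 a2 0 = A_integral I t v a1 a2 b * (\<Prod>i<card I. P (t ^ i * (a1 * b)) * P (t ^ i * (a2 * b)))"
proof -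
  have "(\<integral>z. weight I t v a1 a2 b 0 0 0 z \<partial>torus_measure I) / b_ratio (card I) t a1 a2 b 0 0 0 =
    (\<integral>z. weight I t v a1 a2 0 0 0 0 z \<partial>torus_measure I) / b_ratio (card I) t a1 a2 0 0 0 0"
    using Gb_single[OF assms] unfolding Gb_def[OF assms(1-8)] .
  moreover have "b_ratio (card I) t a1 a2 0 0 0 0 = 1" by (simp add: b_ratio_def)
  moreover have "b_ratio (card I) t a1 a2 b 0 0 0 = 1 / (\<Prod>i<card I. P (t ^ i * (a1 * b)) * P (t ^ i * (a2 * b)))"
    by (simp add: b_ratio_def prod_dividef)
  ultimately show ?thesis by (simp add: A_weight_eq)
qed

lemma A_weight_class:
  assumes fc: "function_class q A C" and f: "\<And>i. i \<in> I \<Longrightarrow> C (\<lambda>p. f p i)"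
    and t: "norm t < 1" "t \<noteq> 0" and v: "v \<noteq> 0" "a1 \<noteq> 0" "a2 \<noteq> 0"
    and r: "\<And>p i. p \<in> A \<Longrightarrow> i \<in> I \<Longrightarrow> norm (f p i) = r p"
      "\<And>p. p \<in> A \<Longrightarrow> norm a1 < r p \<and> norm a2 < r p \<and> norm b * r p < 1"
  shows "C (\<lambda>p. A_weight I t v a1 a2 b (f p))"
proof -
  interpret fc: function_class q A C by (rule fc)
  have r0: "0 < r p" if "p \<in> A" for p using r(2)[OF that] norm_ge_zero[of a1] by linarith
  have f0: "f p i \<noteq> 0" if "p \<in> A" "i \<in> I" for p i using r(1)[OF that] r0[OF that(1)] by auto
  have nz: "P (a1 / f p i) \<noteq> 0" "P (a2 / f p i) \<noteq> 0" "P (b * f p i) \<noteq> 0" if "p \<in> A" "i \<in> I" for p i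
    using r(1)[OF that] r(2)[OF that(1)] r0[OF that(1)] by (auto intro!: P_nonzero simp: norm_divide norm_mult)
  have nz2: "P (t * f p i / f p j) \<noteq> 0" if "p \<in> A" "i \<in> I" "j \<in> I" for p i j
    using r(1)[OF that(1,2)] r(1)[OF that(1,3)] r0[OF that(1)] t by (intro P_nonzero) (simp add: norm_divide norm_mult)
  have 1: "C (\<lambda>p. A_single a1 a2 b al v (f p i))" if "i \<in> I" "al \<noteq> 0" for i al
    unfolding A_single_def by (intro fc.intros f that(1)) (use nz f0 v that in auto)
  have 2: "C (\<lambda>p. case e of (j, k) \<Rightarrow> A_pair t (f p j) (f p k))" if "e \<in> pairs I" for e
    using that unfolding A_pair_def pairs_def
    by (clarsimp, intro fc.intros f) (use nz2 f0 in auto)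
  show ?thesis unfolding A_weight_def
    by (intro fc.mult fc.prod 1 2) (use v t in auto)
qed

text \<open>All variables move together, so their quotients stay on the unit circle and the
  interaction is unaffected; only the poles at |a1| and |a2| inside and 1 / |b| outside limit the
  radius.\<close>

lemma A_integral_scale:
  assumes I: "finite I" and t: "norm t < 1" "t \<noteq> 0" and v: "v \<noteq> 0" "a1 \<noteq> 0" "a2 \<noteq> 0" and c: "c \<noteq> 0"
    and a: "norm a1 < 1" "norm a2 < 1" "norm a1 < norm c" "norm a2 < norm c" "norm b < 1" "norm b * norm c < 1"
  shows "(\<integral>z. A_weight I t v a1 a2 b (scale I c z) \<partial>torus_measure I) = A_integral I t v a1 a2 b"
proof -
  \<comment> \<open>For \<open>b = 0\<close> there is no outer pole, and any radius beyond 1 and |c|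
    serves.\<close>
  define r2 where "r2 = (if b = 0 then max 1 (norm c) + 1 else 1 / norm b)"
  define r1 where "r1 = max (norm a1) (norm a2)"
  show ?thesis
  proof (rule torus_scale[OF I order_refl, where ?r1.0=r1 and ?r2.0=r2])
    show "(\<lambda>c. A_weight I t v a1 a2 b (scale I c z)) holomorphic_on {c. r1 < norm c \<and> norm c < r2}" if "z \<in> torus I" for z
      by (rule A_weight_class[OF holomorphic_class, where r=norm])
        (use that t v in \<open>auto simp: r1_def r2_def scale_def norm_mult pos_less_divide_eq mult.commute split: if_splits intro!: holomorphic_intros\<close>)
    have *: "continuous_on (torus I) (\<lambda>z. A_weight I t v a1 a2 b (scale I c z))"
      if "norm a1 < norm c" "norm a2 < norm c" "norm b * norm c < 1" for c
      by (rule A_weight_class[OF continuous_class, where r="\<lambda>_. norm c"])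
        (use that t v in \<open>auto simp: scale_def norm_mult intro!: continuous_intros\<close>)
    show "continuous_on (torus I) (\<lambda>z. A_weight I t v a1 a2 b (scale I c z))" by (rule * a)+
    show "continuous_on (torus I) (A_weight I t v a1 a2 b)" using *[of 1] a by simp
  qed (use a c in \<open>auto simp: r1_def r2_def le_max_iff_disj field_simps\<close>)
qed

text \<open>The substitution z -> c z turns a_j / c and v c into a_j and v. At \<open>b = 0\<close>
  the contour may then be moved back, because no pole lies outside.\<close>

lemma A_integral_homogeneous:
  assumes I: "finite I" and t: "norm t < 1" "t \<noteq> 0" and v: "v \<noteq> 0" "a1 \<noteq> 0" "a2 \<noteq> 0" and c: "c \<noteq> 0"
    and a: "norm a1 < 1" "norm a2 < 1" "norm a1 < norm c" "norm a2 < norm c"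
  shows "A_integral I t (v * c) (a1 / c) (a2 / c) 0 = A_integral I t v a1 a2 0"
proof -
  have "A_weight I t (v * c) (a1 / c) (a2 / c) 0 z = A_weight I t v a1 a2 0 (scale I c z)" for z
  proof -
    have 1: "A_single (a1 / c) (a2 / c) 0 (t ^ (card I - 1) * (a1 / c) * (a2 / c) * (v * c)) (v * c) x =
        A_single a1 a2 0 (t ^ (card I - 1) * a1 * a2 * v) v (c * x)" for x
      using c by (simp add: A_single_def mult_ac)
    have 2: "A_pair t (c * x) (c * y) = A_pair t x y" for x y using c by (simp add: A_pair_def)
    have 3: "(\<Prod>(j,k)\<in>pairs I. A_pair t (scale I c z j) (scale I c z k)) = (\<Prod>(j,k)\<in>pairs I. A_pair t (z j) (z k))"
      by (rule prod.cong[OF refl]) (auto simp: pairs_def scale_def 2)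
    show ?thesis unfolding A_weight_def 3 1 by (simp add: scale_def)
  qed
  then show ?thesis using A_integral_scale[OF I t v c a, of 0] by simp
qed

end

section \<open>The pinch of one variable between \<open>r\<close> and \<open>1 / r\<close>\<close>

text \<open>The integral under study has \<open>a1 = b1 = r\<close>, \<open>a2 = s * r\<close> and
  \<open>v = w / r\<close>, so that a1 v = w and a2 v = s w do not vary with \<open>r\<close>. The
  set \<open>J\<close> indexes the variables other than the pinched one, and \<open>\<kappa>\<close>
  bounds the distance of all poles other than those at \<open>r\<close> and
  \<open>1 / r\<close>.\<close>

locale pinch = nome +
  fixes t s w :: complex and \<kappa> :: real and J :: "nat set"
  assumes J: "finite J" and kappa: "0 < \<kappa>" "\<kappa> < 1"
    and le_kappa: "norm q \<le> \<kappa>" "norm t \<le> \<kappa>" "norm s \<le> \<kappa>"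
    and tsw: "t \<noteq> 0" "s \<noteq> 0" "w \<noteq> 0"
begin

text \<open>The one-variable weight without its factors 1 / ((1 - r / x) (1 - r x)), which cause the
  pinch; see \<open>A_single_eq\<close>.\<close>

definition y :: "complex \<Rightarrow> complex \<Rightarrow> complex" where
  "y r x = Th (t ^ card J * s * r * w / x) * Th (w / r * x) / (P (q * r / x) * P (s * r / x) * P (q * r * x))"

text \<open>\<open>A_pair\<close> without the zero \<open>1 - u / x\<close>, which the partial
  fraction denominator cancels; see \<open>A_pair_eq\<close>.\<close>

definition cross :: "complex \<Rightarrow> complex \<Rightarrow> complex" where
  "cross x u = P (x / u) * P (q * u / x) / (P (t * x / u) * P (t * u / x))"

text \<open>The partial fraction term for the pinched variable \<open>x\<close>, without the
  denominator of the Poisson kernel in \<open>x\<close>. In the other variables the expansion has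
  removed 1 / (1 - r f_k), so only 1 / (1 - r / f_k) remains.\<close>

definition Phi :: "complex \<Rightarrow> complex \<Rightarrow> (nat \<Rightarrow> complex) \<Rightarrow> complex" where
  "Phi r x f = y r x * (\<Prod>k\<in>J. cross x (f k) * y r (f k) / (1 - r / f k)) * (\<Prod>(j,k)\<in>pairs J. A_pair t (f j) (f k))"

text \<open>The common radius \<open>l\<close> of the other variables has to exceed |r|, which keeps
  \<open>1 - r / f k\<close> nonzero. At \<open>r = 1\<close> this forces a circle larger than the
  unit circle.\<close>

definition ok :: "complex \<Rightarrow> complex \<Rightarrow> (nat \<Rightarrow> complex) \<Rightarrow> bool" where
  "ok r x f \<longleftrightarrow> r \<noteq> 0 \<and> norm r \<le> 1 \<and> norm x = 1 \<and>
    (\<exists>l. (\<forall>k\<in>J. norm (f k) = l) \<and> norm r < l \<and> \<kappa> < l \<and> \<kappa> * l < 1)"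

lemma P_nz_quot: "norm u \<le> \<kappa> \<Longrightarrow> \<kappa> * norm a < norm b \<Longrightarrow> P (u * a / b) \<noteq> 0"
proof (rule P_nonzero)
  assume u: "norm u \<le> \<kappa>" and ab: "\<kappa> * norm a < norm b"
  have "norm (u * a) \<le> \<kappa> * norm a" unfolding norm_mult using u by (intro mult_right_mono) auto
  then have "norm (u * a) < norm b" using ab by linarith
  then show "norm (u * a / b) < 1" unfolding norm_divide by (simp add: divide_less_eq_1)
qed

lemma y_nz:
  assumes "norm r \<le> 1" "\<kappa> < norm x" "\<kappa> * norm x < 1"
  shows "x \<noteq> 0" "P (q * r / x) \<noteq> 0" "P (s * r / x) \<noteq> 0" "P (q * r * x) \<noteq> 0"
proof -
  show "x \<noteq> 0" using assms(2) kappa by auto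
  have "\<kappa> * norm r \<le> \<kappa>" using assms(1) kappa by (simp add: mult_left_le)
  then have r: "\<kappa> * norm r < norm x" using assms(2) by linarith
  show "P (q * r / x) \<noteq> 0" "P (s * r / x) \<noteq> 0" by (rule P_nz_quot[OF _ r], rule le_kappa)+
  have "\<kappa> * norm (r * x) \<le> \<kappa> * norm x"
    unfolding norm_mult using assms(1) kappa by (intro mult_left_mono mult_left_le_one_le) auto
  then have "\<kappa> * norm (r * x) < norm (1::complex)" using assms(3) by simp
  from P_nz_quot[OF le_kappa(1) this] show "P (q * r * x) \<noteq> 0" by (simp add: mult.assoc)
qed

lemma ok_x:
  assumes "ok r x f"
  shows "r \<noteq> 0" "x \<noteq> 0" "P (q * r / x) \<noteq> 0" "P (s * r / x) \<noteq> 0" "P (q * r * x) \<noteq> 0"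
  using assms y_nz[of r x] kappa by (simp_all add: ok_def)

lemma ok_k:
  assumes "ok r x f" "k \<in> J"
  shows "f k \<noteq> 0" "P (q * r / f k) \<noteq> 0" "P (s * r / f k) \<noteq> 0" "P (q * r * f k) \<noteq> 0"
    "P (t * x / f k) \<noteq> 0" "P (t * f k / x) \<noteq> 0" "1 - r / f k \<noteq> 0" "j \<in> J \<Longrightarrow> P (t * f j / f k) \<noteq> 0"
proof -
  obtain l where l: "norm (f k) = l" "norm r < l" "\<kappa> < l" "\<kappa> * l < 1"
    and lj: "\<And>j. j \<in> J \<Longrightarrow> norm (f j) = l"
    using assms unfolding ok_def by blast
  have r: "norm r \<le> 1" "norm x = 1" using assms(1) unfolding ok_def by blast+
  show f0: "f k \<noteq> 0" "P (q * r / f k) \<noteq> 0" "P (s * r / f k) \<noteq> 0" "P (q * r * f k) \<noteq> 0"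
    by (rule y_nz[OF r(1)]; use l in simp)+
  show "P (t * x / f k) \<noteq> 0" "P (t * f k / x) \<noteq> 0"
    by (rule P_nz_quot[OF le_kappa(2)]; use l r in simp)+
  show "1 - r / f k \<noteq> 0"
  proof
    assume "1 - r / f k = 0"
    then have "r = f k" using f0(1) by simp
    then show False using l by simp
  qed
  assume j: "j \<in> J"
  have "0 < l" using kappa l(3) by linarith
  then have "\<kappa> * l < l" using mult_strict_right_mono[OF kappa(2)] by simp
  then show "P (t * f j / f k) \<noteq> 0"
    by (intro P_nz_quot[OF le_kappa(2)]) (simp add: l(1) lj[OF j])
qed

lemma Phi_class:
  assumes fc: "function_class q A C" and c: "C r" "C x" "\<And>k. k \<in> J \<Longrightarrow> C (\<lambda>p. f p k)"
    and ok: "\<And>p. p \<in> A \<Longrightarrow> ok (r p) (x p) (f p)"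
  shows "C (\<lambda>p. Phi (r p) (x p) (f p))"
proof -
  interpret fc: function_class q A C by (rule fc)
  note x_nz = ok_x[OF ok] and k_nz = ok_k[OF ok]
  have yx: "C (\<lambda>p. y (r p) (x p))"
    unfolding y_def by (intro fc.intros c; use x_nz tsw in simp)
  have 1: "C (\<lambda>p. cross (x p) (f p k) * y (r p) (f p k) / (1 - r p / f p k))" if k: "k \<in> J" for k
    unfolding cross_def y_def by (intro fc.intros c k; use x_nz k_nz[OF _ k] tsw in simp)
  have 2: "C (\<lambda>p. case e of (j, k) \<Rightarrow> A_pair t (f p j) (f p k))" if "e \<in> pairs J" for e
    using that unfolding A_pair_def pairs_def
    by (clarsimp, intro fc.intros c) (use k_nz in auto)
  show ?thesis unfolding Phi_def by (intro fc.mult fc.prod yx 1 2)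
qed

lemma Phi_cong:
  assumes "\<And>k. k \<in> J \<Longrightarrow> f k = g k"
  shows "Phi r x f = Phi r x g"
  unfolding Phi_def
  by (intro arg_cong2[where f="(*)"] prod.cong refl) (auto simp: pairs_def assms)

text \<open>Here the factor \<open>1 - 1 / f k\<close> is absorbed, so that the weight with parameters \<open>t\<close>, \<open>s\<close>, \<open>t\<close>
  reappears in the remaining variables.\<close>
lemma Phi_1:
  assumes l: "\<And>k. k \<in> J \<Longrightarrow> norm (f k) = l" "1 < l" "\<kappa> * l < 1"
  shows "Phi 1 1 f = Th (t ^ card J * s * w) * Th w / (P q * P s * P q) * A_weight J t w t s t f"
proof -
  have "cross 1 (f k) * y 1 (f k) / (1 - 1 / f k) = A_single t s t (t ^ (card J - 1) * t * s * w) w (f k)" if k: "k \<in> J" for k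
  proof -
    have "card J = Suc (card J - 1)" using k J by (cases "card J") auto
    \<comment> \<open>One power of \<open>t\<close> becomes the new first parameter: the theta
      argument then has the form prescribed by \<open>A_weight\<close> for the variables in
      \<open>J\<close>.\<close>
    then have tn: "t ^ card J = t ^ (card J - 1) * t" by (metis power_Suc mult.commute)
    have f0: "f k \<noteq> 0" "1 - 1 / f k \<noteq> 0" using l(1)[OF k] l(2) by (auto simp: field_simps)
    have "\<kappa> < norm (f k)" "\<kappa> * norm (f k) < 1" using l(1)[OF k] l(2,3) kappa by simp_all
    from y_nz[OF _ this, of 1] have nz: "P (q / f k) \<noteq> 0" "P (q * f k) \<noteq> 0" by simp_all
    have r: "P (1 / f k) = (1 - 1 / f k) * P (q / f k)" using P_rec[of "1 / f k"] by simp
    have *: "(d * Q1) * Q2 / (T1 * T2) * (X * Y / (Q1 * S * Q2)) / d = X * Y / (T1 * S * T2)"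
      if "d \<noteq> 0" "Q1 \<noteq> 0" "Q2 \<noteq> 0" for d Q1 Q2 T1 T2 X Y S :: complex
      using that by (simp add: mult_ac)
    have c: "cross 1 (f k) = ((1 - 1 / f k) * P (q / f k)) * P (q * f k) / (P (t / f k) * P (t * f k))"
      by (simp add: cross_def r)
    have yf: "y 1 (f k) = Th (t ^ (card J - 1) * t * s * w / f k) * Th (w * f k) / (P (q / f k) * P (s / f k) * P (q * f k))"
      by (simp add: y_def tn)
    show ?thesis unfolding c yf A_single_def by (rule *[OF f0(2) nz])
  qed
  then have "(\<Prod>k\<in>J. cross 1 (f k) * y 1 (f k) / (1 - 1 / f k)) = (\<Prod>k\<in>J. A_single t s t (t ^ (card J - 1) * t * s * w) w (f k))"
    by (rule prod.cong[OF refl])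
  then show ?thesis unfolding Phi_def A_weight_def by (simp add: y_def mult_ac)
qed

end

context pinch begin

lemma A_single_eq:
  assumes "r \<noteq> 0"
  shows "A_single r (s * r) r (t ^ card J * r * (s * r) * (w / r)) (w / r) x = y r x * (1 / ((1 - r / x) * (1 - r * x)))"
proof -
  have al: "t ^ card J * r * (s * r) * (w / r) = t ^ card J * s * r * w" using assms by simp
  have r: "P (r / x) = (1 - r / x) * P (q * r / x)" "P (r * x) = (1 - r * x) * P (q * r * x)"
    using P_rec[of "r / x"] P_rec[of "r * x"] by (simp_all add: mult.assoc)
  show ?thesis unfolding A_single_def y_def al r by (simp add: mult_ac)
qed

lemma A_pair_eq: "A_pair t x u = cross x u * (1 - u / x)"
proof -
  have "P (u / x) = (1 - u / x) * P (q * u / x)" using P_rec[of "u / x"] by simp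
  then show ?thesis by (simp add: A_pair_def cross_def mult_ac)
qed

text \<open>For each \<open>k\<close> in \<open>J\<close> the zero of \<open>A_pair\<close> at
  \<open>z k = z i\<close> absorbs the denominator \<open>1 - z k / z i\<close>, leaving
  \<open>cross\<close>. The factors 1 / (1 - r z_k) are collected in front, where they no longer
  depend on the choice of \<open>i\<close>.\<close>

lemma A_weight_term:
  assumes i: "i \<notin> J" and r: "r \<noteq> 0" and z: "\<And>k. k \<in> J \<Longrightarrow> 1 - z k / z i \<noteq> 0"
  shows "A_weight (insert i J) t (w / r) r (s * r) r z * (1 / (1 - r * z i) * (\<Prod>k\<in>J. 1 / (1 - z k / z i))) =
    (\<Prod>k\<in>insert i J. 1 / (1 - r * z k)) * (Phi r (z i) z / ((1 - r * z i) * (1 - r / z i)))"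
proof -
  let ?h = "\<lambda>x. 1 / (1 - r * x)"
  have c: "card (insert i J) - 1 = card J" using i J by simp
  have sym: "A_pair t x u = A_pair t u x" for x u by (simp add: A_pair_def mult_ac)
  have pr: "(\<Prod>(j,k)\<in>pairs (insert i J). A_pair t (z j) (z k)) = (\<Prod>k\<in>J. A_pair t (z i) (z k)) * (\<Prod>(j,k)\<in>pairs J. A_pair t (z j) (z k))"
    by (rule prod_pairs_insert[OF J i sym])
  let ?a = "\<lambda>x. A_single r (s * r) r (t ^ card J * r * (s * r) * (w / r)) (w / r) x"
  have "A_weight (insert i J) t (w / r) r (s * r) r z * (?h (z i) * (\<Prod>k\<in>J. 1 / (1 - z k / z i))) =
     ?a (z i) * ?h (z i) * (\<Prod>k\<in>J. ?a (z k) * A_pair t (z i) (z k) * (1 / (1 - z k / z i))) * (\<Prod>(j,k)\<in>pairs J. A_pair t (z j) (z k))"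
    unfolding A_weight_def c pr prod.insert[OF J i] prod.distrib by (simp only: mult_ac)
  also have "(\<Prod>k\<in>J. ?a (z k) * A_pair t (z i) (z k) * (1 / (1 - z k / z i))) =
     (\<Prod>k\<in>J. ?h (z k) * (cross (z i) (z k) * y r (z k) / (1 - r / z k)))"
  proof (rule prod.cong[OF refl])
    fix k assume k: "k \<in> J"
    have *: "Y * (1 / (a * b)) * (C * d) * (1 / d) = (1 / b) * (C * Y / a)" if "d \<noteq> 0" for Y a b C d :: complex
      using that by (simp add: mult_ac)
    show "?a (z k) * A_pair t (z i) (z k) * (1 / (1 - z k / z i)) = ?h (z k) * (cross (z i) (z k) * y r (z k) / (1 - r / z k))"
      unfolding A_single_eq[OF r] A_pair_eq by (rule *[OF z[OF k]])
  qed
  also have "?a (z i) * ?h (z i) * \<dots> * (\<Prod>(j,k)\<in>pairs J. A_pair t (z j) (z k)) =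
     (\<Prod>k\<in>insert i J. ?h (z k)) * (Phi r (z i) z / ((1 - r * z i) * (1 - r / z i)))"
    unfolding A_single_eq[OF r] Phi_def prod.insert[OF J i] prod.distrib by (simp add: mult_ac)
  finally show ?thesis .
qed

text \<open>The midpoint of 1 and 1 / \<kappa>. At this radius the other variables avoid the pole
  that reaches 1 together with \<open>r\<close>.\<close>

definition "R = (1 + 1 / \<kappa>) / 2"

lemma R: "1 < R" "\<kappa> * R < 1" "R < 1 / \<kappa>"
  using kappa by (simp_all add: R_def field_simps)

abbreviation "spread \<equiv> scale J (complex_of_real R)"

lemma norm_spread: "z \<in> torus I \<Longrightarrow> k \<in> J \<Longrightarrow> J \<subseteq> I \<Longrightarrow> norm (spread z k) = R"
  using R(1) norm_torus[of z I k] by (auto simp: scale_def norm_mult)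

lemma ok_spread:
  assumes "z \<in> torus I" "J \<subseteq> I" "r \<noteq> 0" "norm r \<le> 1" "norm x = 1"
  shows "ok r x (spread z)"
  unfolding ok_def using assms R kappa by (auto intro!: exI[of _ R] norm_spread)

context
  fixes i assumes i: "i \<notin> J"
begin

abbreviation "I \<equiv> insert i J"

definition "piece r z = Phi r (z i) z / ((1 - r * z i) * (1 - r / z i))"

lemma I: "finite I" "J \<subseteq> I" "i \<in> I"
  using J by auto

lemma scale_i [simp]: "scale J c z i = z i"
  using i by (simp add: scale_def)

lemma piece_class:
  assumes fc: "function_class q A C" and f: "\<And>k. k \<in> I \<Longrightarrow> C (\<lambda>p. f p k)" and r: "norm r < 1"
    and ok: "\<And>p. p \<in> A \<Longrightarrow> ok r (f p i) (f p)"
  shows "C (\<lambda>p. piece r (f p))"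
proof -
  interpret fc: function_class q A C by (rule fc)
  have "1 - r * x \<noteq> 0" "1 - r / x \<noteq> 0" "x \<noteq> 0" if "norm x = 1" for x
  proof -
    show "1 - r * x \<noteq> 0"
    proof
      assume "1 - r * x = 0"
      then have "norm (r * x) = 1" by simp
      then show False using r that by (simp add: norm_mult)
    qed
  qed (use r that in auto)
  moreover have "norm (f p i) = 1" if "p \<in> A" for p using ok[OF that] by (simp add: ok_def)
  ultimately show ?thesis unfolding piece_def
    by (intro fc.intros f Phi_class[OF fc] ok I no_zero_divisors) (use I in auto)
qed

lemma continuous_piece:
  assumes r: "r \<noteq> 0" "norm r < 1"
  shows "continuous_on (torus I) (\<lambda>z. piece r z)"
  by (rule piece_class[OF continuous_class])
    (use r I kappa in \<open>auto simp: ok_def intro!: continuous_intros exI[of _ 1]\<close>)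

text \<open>For |r| < 1 the pole at \<open>r\<close> is still inside, and the outer one at
  \<open>1 / r\<close> is gone from the variables in \<open>J\<close>, so they can move outwards.
  This must precede the limit.\<close>

lemma integral_piece_spread:
  assumes r: "r \<noteq> 0" "norm r < 1"
  shows "(\<integral>z. piece r (spread z) \<partial>torus_measure I) = (\<integral>z. piece r z \<partial>torus_measure I)"
proof (rule torus_scale[OF I(1,2), where ?r1.0="max (norm r) \<kappa>" and ?r2.0="1 / \<kappa>"])
  have ok: "ok r (scale J c z i) (scale J c z)" if "z \<in> torus I" and c: "max (norm r) \<kappa> < norm c" "norm c < 1 / \<kappa>" for z c
    unfolding ok_def using that r kappa i
    by (auto intro!: exI[of _ "norm c"] simp: scale_def norm_mult pos_less_divide_eq mult.commute)
  show "(\<lambda>c. piece r (scale J c z)) holomorphic_on {c. max (norm r) \<kappa> < norm c \<and> norm c < 1 / \<kappa>}" if "z \<in> torus I" for z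
    by (rule piece_class[OF holomorphic_class _ r(2) ok[OF that]]) (use i in \<open>auto simp: scale_def intro!: holomorphic_intros\<close>)
  show c: "max (norm r) \<kappa> < norm (complex_of_real R)" "norm (complex_of_real R) < 1 / \<kappa>" using R r kappa by auto
  show "continuous_on (torus I) (\<lambda>z. piece r (spread z))"
    by (rule piece_class[OF continuous_class _ r(2) ok[OF _ c]]) (use i in \<open>auto simp: scale_def intro!: continuous_intros\<close>)
qed (use r kappa continuous_piece in \<open>auto simp: le_max_iff_disj\<close>)

lemma continuous_Phi_spread:
  "continuous_on ({1/2..1} \<times> torus I) (\<lambda>p. Phi (of_real (fst p)) (snd p i) (spread (snd p)))"
proof (rule Phi_class[OF continuous_class])
  show "ok (of_real (fst p)) (snd p i) (spread (snd p))" if "p \<in> {1/2..1} \<times> torus I" for p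
    by (rule ok_spread[OF _ I(2)]) (use that I in auto)
qed (auto simp: scale_def intro!: continuous_intros)

text \<open>Multiplied by 1 - r^2, a piece becomes the Poisson kernel in \<open>z i\<close> times
  \<open>Phi\<close>. The limit sets both \<open>z i\<close> and \<open>r\<close> to 1, and
  \<open>Phi_1\<close> identifies the result.\<close>

lemma piece_limit:
  "(\<lambda>n. (1 - of_real (approach n) * of_real (approach n)) * (\<integral>z. piece (of_real (approach n)) z \<partial>torus_measure I)) \<longlonglongrightarrow>
    Th (t ^ card J * s * w) * Th w / (P q * P s * P q) * A_integral J t w t s t"
    (is "_ \<longlonglongrightarrow> ?c * _")
proof -
  have "(\<integral>z. poisson r (z i) * Phi (of_real r) (z i) (spread z) \<partial>torus_measure I) =
      (1 - of_real r * of_real r) * (\<integral>z. piece (of_real r) z \<partial>torus_measure I)" if r: "0 < r" "r < 1" for r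
  proof -
    have "(\<integral>z. poisson r (z i) * Phi (of_real r) (z i) (spread z) \<partial>torus_measure I) =
        (\<integral>z. (1 - of_real r * of_real r) * piece (of_real r) (spread z) \<partial>torus_measure I)"
      by (rule Bochner_Integration.integral_cong[OF refl]) (use I(3) r in \<open>simp add: poisson_eq piece_def scale_i\<close>)
    then show ?thesis using integral_piece_spread[of "of_real r"] r by simp
  qed
  moreover have "(\<integral>z. Phi 1 1 (spread (z(i := 1))) \<partial>torus_measure J) = ?c * A_integral J t w t s t"
  proof -
    have st: "norm t < 1" "norm s < 1" using le_kappa kappa by linarith+
    have "(\<integral>z. Phi 1 1 (spread (z(i := 1))) \<partial>torus_measure J) = (\<integral>z. ?c * A_weight J t w t s t (spread z) \<partial>torus_measure J)"
    proof (rule Bochner_Integration.integral_cong[OF refl])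
      fix z assume "z \<in> space (torus_measure J)"
      then have z: "z \<in> torus J" by simp
      have "Phi 1 1 (spread (z(i := 1))) = Phi 1 1 (spread z)"
        by (rule Phi_cong) (use i in \<open>auto simp: scale_def\<close>)
      also have "\<dots> = ?c * A_weight J t w t s t (spread z)"
        by (rule Phi_1[OF norm_spread[OF z _ order_refl] R(1,2)])
      finally show "Phi 1 1 (spread (z(i := 1))) = ?c * A_weight J t w t s t (spread z)" .
    qed
    also have "\<dots> = ?c * (\<integral>z. A_weight J t w t s t (spread z) \<partial>torus_measure J)"
      by (rule integral_mult_right_zero)
    \<comment> \<open>The poles of the reduced weight have modulus at most max |t| |s| or at least 1
      / |t|, so the variables return from radius \<open>R\<close> to 1.\<close>
    also have "(\<integral>z. A_weight J t w t s t (spread z) \<partial>torus_measure J) = A_integral J t w t s t"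
    proof (rule A_integral_scale[OF J])
      have "norm t * R \<le> \<kappa> * R" using le_kappa(2) R by (intro mult_right_mono) auto
      also note R(2)
      finally show "norm t * norm (complex_of_real R) < 1" using R(1) by simp
    qed (use tsw st R in auto)
    finally show ?thesis .
  qed
  ultimately show ?thesis
    using torus_poisson_tendsto[OF J i continuous_Phi_spread] approach_bounds(2) approach_pos by simp
qed

end
end

section \<open>Evaluation at \<open>b = 0\<close> by induction on the number of variables\<close>

context nome begin

text \<open>The weight is multiplied by the product of all 1 / (1 - r z_i) and that product is
  expanded. By \<open>A_weight_term\<close> every summand contains the same product again, so it can
  be cancelled.\<close>

lemma A_integral_pieces:
  assumes I: "finite I" "I \<noteq> {}" and p: "\<And>i. i \<in> I \<Longrightarrow> pinch q t s w \<kappa> (I - {i})" and r: "r \<noteq> 0" "norm r < 1"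
  shows "A_integral I t (w / r) r (s * r) r = (\<Sum>i\<in>I. \<integral>z. pinch.piece q t s w (I - {i}) i r z \<partial>torus_measure I)"
proof -
  have c: "continuous_on (torus I) (\<lambda>z. pinch.piece q t s w (I - {i}) i r z)" if i: "i \<in> I" for i
    using pinch.continuous_piece[OF p[OF i] _ r, of i] i by (simp add: insert_absorb)
  have tws: "t \<noteq> 0" "norm t < 1" "s \<noteq> 0" "norm s < 1" "w \<noteq> 0"
  proof -
    obtain i where "i \<in> I" using I by auto
    then interpret pinch q t s w \<kappa> "I - {i}" by (rule p)
    show "t \<noteq> 0" "s \<noteq> 0" "w \<noteq> 0" by (rule tsw)+
    show "norm t < 1" "norm s < 1" using le_kappa kappa by linarith+
  qed
  have sr: "norm (s * r) < 1" by (rule mult_norm_less_1(1)) (use tws r in auto)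
  have cA: "continuous_on (torus I) (A_weight I t (w / r) r (s * r) r)"
    by (rule A_weight_class[OF continuous_class, where r="\<lambda>_. 1"]) (use tws r sr in \<open>auto intro!: continuous_intros\<close>)
  have "A_integral I t (w / r) r (s * r) r = (\<integral>z. (\<Sum>i\<in>I. pinch.piece q t s w (I - {i}) i r z) \<partial>torus_measure I)"
  proof (rule integral_cong_AE)
    show "AE z in torus_measure I. A_weight I t (w / r) r (s * r) r z = (\<Sum>i\<in>I. pinch.piece q t s w (I - {i}) i r z)"
      using AE_torus_inj[OF I(1)] AE_space
    proof eventually_elim
      fix z assume inj: "inj_on z I" and "z \<in> space (torus_measure I)"
      then have z: "z \<in> torus I" by simp
      have rz: "1 - r * z i \<noteq> 0" if "i \<in> I" for i
      proof
        assume "1 - r * z i = 0"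
        then have "norm (r * z i) = 1" by simp
        then show False using r norm_torus[OF z that] by (simp add: norm_mult)
      qed
      have pf: "(\<Prod>i\<in>I. 1 / (1 - r * z i)) = (\<Sum>i\<in>I. 1 / (1 - r * z i) * (\<Prod>k\<in>I-{i}. 1 / (1 - z k / z i)))"
        by (rule partial_fractions[OF I inj _ rz]) (use z in auto)
      have nz: "(\<Prod>i\<in>I. 1 / (1 - r * z i)) \<noteq> 0" using I rz by simp
      have "A_weight I t (w / r) r (s * r) r z * (\<Prod>i\<in>I. 1 / (1 - r * z i)) =
         (\<Sum>i\<in>I. (\<Prod>i\<in>I. 1 / (1 - r * z i)) * pinch.piece q t s w (I - {i}) i r z)"
        unfolding pf sum_distrib_left
      proof (rule sum.cong[OF refl], unfold pf[symmetric])
        fix i assume i: "i \<in> I"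
        have ii: "insert i (I - {i}) = I" and ni: "i \<notin> I - {i}" using i by auto
        have d: "1 - z k / z i \<noteq> 0" if "k \<in> I - {i}" for k
          using that i inj_onD[OF inj, of k i] z by auto
        show "A_weight I t (w / r) r (s * r) r z * (1 / (1 - r * z i) * (\<Prod>k\<in>I-{i}. 1 / (1 - z k / z i))) =
           (\<Prod>i\<in>I. 1 / (1 - r * z i)) * pinch.piece q t s w (I - {i}) i r z"
          using pinch.A_weight_term[OF p[OF i] ni r(1), of z, OF d] unfolding pinch.piece_def[OF p[OF i] ni] ii .
      qed
      then have "(\<Prod>i\<in>I. 1 / (1 - r * z i)) * A_weight I t (w / r) r (s * r) r z =
         (\<Prod>i\<in>I. 1 / (1 - r * z i)) * (\<Sum>i\<in>I. pinch.piece q t s w (I - {i}) i r z)"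
        by (simp only: sum_distrib_left mult.commute)
      then show "A_weight I t (w / r) r (s * r) r z = (\<Sum>i\<in>I. pinch.piece q t s w (I - {i}) i r z)"
        using mult_left_cancel[OF nz] by blast
    qed
  qed (intro torus_measurable continuous_intros cA c; assumption)+
  also have "\<dots> = (\<Sum>i\<in>I. \<integral>z. pinch.piece q t s w (I - {i}) i r z \<partial>torus_measure I)"
    by (intro Bochner_Integration.integral_sum torus_integrable I c)
  finally show ?thesis .
qed

text \<open>With x = a1 v and y = a2 v this is n! times the right-hand side of the theorem at
  \<open>b = 0\<close>, the index running from 0 instead of 1.\<close>

definition A_value :: "nat \<Rightarrow> complex \<Rightarrow> complex \<Rightarrow> complex \<Rightarrow> complex" where
  "A_value n t x y = fact n * (\<Prod>i<n. P t / (P q * P (t ^ Suc i)) * (Th (t ^ i * x) * Th (t ^ i * y)))"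

lemma P_t_power_nz: "norm t < 1 \<Longrightarrow> norm u < 1 \<Longrightarrow> P (t ^ i * u) \<noteq> 0"
  by (intro P_nonzero t_less_1)

text \<open>The recursion that the pinch predicts: \<open>Suc m\<close> choices of the pinched
  variable, its own factors at 1, the removal of \<open>b = t\<close> from the other
  \<open>m\<close> variables, and the factors of \<open>b = r\<close> at \<open>r = 1\<close>, where
  \<open>P q\<close> replaces the vanishing \<open>P 1\<close>.\<close>

lemma A_value_Suc:
  assumes t: "norm t < 1" and s: "norm s < 1"
  shows "A_value (Suc m) t w (s * w) = (of_nat (Suc m) * (Th (t ^ m * s * w) * Th w / (P q * P s * P q)) *
     (A_value m t (t * w) (s * w) / (\<Prod>i<m. P (t ^ i * (t * t)) * P (t ^ i * (s * t))))) *
     (P q * (\<Prod>i<m. P (t ^ Suc i)) * (\<Prod>i<Suc m. P (t ^ i * s)))"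
proof -
  define X where "X = (\<Prod>i<m. P t / (P q * P (t ^ Suc i)))"
  define A where "A = (\<Prod>i<m. Th (t ^ Suc i * w))"
  define B where "B = (\<Prod>i<m. Th (t ^ i * (s * w)))"
  define C where "C = (\<Prod>i<m. P (t ^ Suc i))"
  define C2 where "C2 = (\<Prod>i<m. P (t ^ Suc (Suc i)))"
  define S where "S = (\<Prod>i<m. P (t ^ Suc i * s))"
  have tp: "P (t ^ Suc k) \<noteq> 0" for k
    unfolding power_Suc2 by (rule P_t_power_nz[OF t t])
  have nz: "P q \<noteq> 0" "P s \<noteq> 0" "P (t ^ Suc m) \<noteq> 0"
    by (rule P_nonzero q_less_1 s tp)+
  have nz': "C2 \<noteq> 0" "S \<noteq> 0"
    unfolding C2_def S_def prod_zero_iff[OF finite_lessThan] using tp P_t_power_nz[OF t s] by blast+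
  have Sm: "(\<Prod>i<Suc m. P (t ^ i * s)) = P s * S" by (subst prod.lessThan_Suc_shift) (simp add: S_def)
  have Am: "(\<Prod>i<Suc m. Th (t ^ i * w)) = Th w * A" by (subst prod.lessThan_Suc_shift) (simp add: A_def)
  \<comment> \<open>The same product of \<open>Suc m\<close> factors, split off once at its end and
    once at its beginning.\<close>
  have CC: "C * P (t ^ Suc m) = P t * C2"
  proof -
    have "(\<Prod>i<Suc m. P (t ^ Suc i)) = C * P (t ^ Suc m)" by (simp add: C_def)
    moreover have "(\<Prod>i<Suc m. P (t ^ Suc i)) = P t * C2" by (subst prod.lessThan_Suc_shift) (simp add: C2_def)
    ultimately show ?thesis by (simp only:)
  qed
  have den: "(\<Prod>i<m. P (t ^ i * (t * t)) * P (t ^ i * (s * t))) = C2 * S"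
    by (simp add: C2_def S_def prod.distrib mult_ac)
  have V: "A_value m t (t * w) (s * w) = fact m * (X * A * B)"
  proof -
    have a: "t ^ i * (t * w) = t ^ Suc i * w" for i by simp
    show ?thesis unfolding A_value_def X_def A_def B_def prod.distrib a by (simp only: mult_ac)
  qed
  have "A_value (Suc m) t w (s * w) = fact (Suc m) * ((X * (P t / (P q * P (t ^ Suc m)))) * ((Th w * A) * (B * Th (t ^ m * s * w))))"
    unfolding A_value_def prod.distrib Am by (simp only: X_def B_def prod.lessThan_Suc mult_ac)
  also have "P t / (P q * P (t ^ Suc m)) = C / (C2 * P q)"
  proof -
    have "P t / (P q * P (t ^ Suc m)) = (P t * C2) / (P q * P (t ^ Suc m) * C2)" using nz' by simp
    also have "\<dots> = C / (C2 * P q)" unfolding CC[symmetric] using nz by simp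
    finally show ?thesis .
  qed
  also have "fact (Suc m) * ((X * (C / (C2 * P q))) * ((Th w * A) * (B * Th (t ^ m * s * w)))) =
    (of_nat (Suc m) * (Th (t ^ m * s * w) * Th w / (P q * P s * P q)) * (fact m * (X * A * B) / (C2 * S))) * (P q * C * (P s * S))"
    using nz nz' by (simp add: mult_ac)
  finally show ?thesis unfolding V den Sm C_def[symmetric] .
qed

text \<open>The strict inequality between \<open>a2\<close> and \<open>a1\<close> places the ratio
  \<open>s\<close> in the open unit disc, as \<open>pinch\<close> requires.\<close>

lemma pinch_step:
  assumes IH: "\<And>J a1 a2 v. finite J \<Longrightarrow> card J = m \<Longrightarrow> a1 \<noteq> 0 \<Longrightarrow> a2 \<noteq> 0 \<Longrightarrow> norm a1 < 1 \<Longrightarrow> norm a2 < 1 \<Longrightarrow> v \<noteq> 0 \<Longrightarrow>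
      A_integral J t v a1 a2 0 = A_value m t (a1 * v) (a2 * v)"
    and t: "t \<noteq> 0" "norm t < 1" and I: "finite I" "card I = Suc m"
    and a: "a1 \<noteq> 0" "a2 \<noteq> 0" "norm a1 < 1" "norm a2 < norm a1" and v: "v \<noteq> 0"
  shows "A_integral I t v a1 a2 0 = A_value (Suc m) t (a1 * v) (a2 * v)"
proof -
  define s where "s = a2 / a1"
  define w where "w = a1 * v"
  have s: "s \<noteq> 0" "norm s < 1" and w: "w \<noteq> 0" using a v by (auto simp: s_def w_def norm_divide)
  have sw: "s * w = a2 * v" using a by (simp add: s_def w_def)
  define \<kappa> where "\<kappa> = max (norm q) (max (norm t) (norm s))"
  have k: "0 < \<kappa>" "\<kappa> < 1" "norm q \<le> \<kappa>" "norm t \<le> \<kappa>" "norm s \<le> \<kappa>"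
    using t s q_nz q_less_1 by (auto simp: \<kappa>_def less_max_iff_disj)
  have pinch: "pinch q t s w \<kappa> (I - {i})" for i
    by unfold_locales (use I k t s w in auto)
  have I0: "I \<noteq> {}" using I by auto
  define c where "c = Th (t ^ m * s * w) * Th w / (P q * P s * P q)"
  define d where "d = A_value m t (t * w) (s * w) / (\<Prod>i<m. P (t ^ i * (t * t)) * P (t ^ i * (s * t)))"
  let ?p = "\<lambda>n. complex_of_real (approach n)"
  have p2: "?p \<longlonglongrightarrow> 1" using tendsto_of_real[OF approach(2)] by simp
  have pn: "?p n \<noteq> 0" "norm (?p n) < 1" for n using approach(1)[of n] approach_bounds[of n] by auto
  have lim: "(\<lambda>n. (1 - ?p n * ?p n) * A_integral I t (w / ?p n) (?p n) (s * ?p n) (?p n)) \<longlonglongrightarrow> of_nat (Suc m) * c * d"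
  proof -
    have "(\<lambda>n. (1 - ?p n * ?p n) * (\<integral>z. pinch.piece q t s w (I - {i}) i (?p n) z \<partial>torus_measure I)) \<longlonglongrightarrow> c * d" if i: "i \<in> I" for i
    proof -
      have ii: "insert i (I - {i}) = I" and ci: "card (I - {i}) = m" using i I by auto
      have "A_integral (I - {i}) t w t s 0 = A_integral (I - {i}) t w t s t * (\<Prod>i<card (I - {i}). P (t ^ i * (t * t)) * P (t ^ i * (s * t)))"
        by (rule A_integral_b) (use t s w I in auto)
      moreover have "A_integral (I - {i}) t w t s 0 = A_value m t (t * w) (s * w)"
        by (rule IH) (use t s w I ci in auto)
      moreover have "(\<Prod>i<m. P (t ^ i * (t * t)) * P (t ^ i * (s * t))) \<noteq> 0"
        using t s by (simp add: P_t_power_nz mult_norm_less_1 less_imp_le)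
      ultimately have d: "A_integral (I - {i}) t w t s t = d" by (simp add: d_def ci)
      have ni: "i \<notin> I - {i}" by simp
      show ?thesis
        using pinch.piece_limit[OF pinch ni] unfolding ii ci d c_def[symmetric] .
    qed
    then have "(\<lambda>n. \<Sum>i\<in>I. (1 - ?p n * ?p n) * (\<integral>z. pinch.piece q t s w (I - {i}) i (?p n) z \<partial>torus_measure I)) \<longlonglongrightarrow> (\<Sum>i\<in>I. c * d)"
      by (rule tendsto_sum)
    then show ?thesis
      by (simp add: A_integral_pieces[OF I(1) I0 pinch pn] sum_distrib_left I(2) mult.assoc)
  qed
  \<comment> \<open>The factors produced by inserting \<open>b = r\<close>, except 1 - r^2. That one
    is left with the integral, whose divergence it compensates.\<close>
  define f where "f = (\<lambda>r. P (q * (r * r)) * (\<Prod>i<m. P (t ^ Suc i * (r * r))) * (\<Prod>i<Suc m. P (t ^ i * (s * r * r))))"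
  have flim: "(\<lambda>n. f (?p n)) \<longlonglongrightarrow> f 1"
  proof -
    have "continuous_on UNIV f" unfolding f_def by (intro continuous_intros)
    then show ?thesis using p2 by (simp add: continuous_on_sequentially o_def)
  qed
  \<comment> \<open>The right-hand side is constant in \<open>n\<close>, so its limit is its
    value.\<close>
  have eq: "A_integral I t v a1 a2 0 = (1 - ?p n * ?p n) * A_integral I t (w / ?p n) (?p n) (s * ?p n) (?p n) * f (?p n)" for n
  proof -
    define r where "r = ?p n"
    have r: "r \<noteq> 0" "norm r < 1" using pn by (simp_all add: r_def)
    \<comment> \<open>Rescaling by \<open>a1 / r\<close> sends \<open>a1\<close> to
      \<open>r\<close>; as |r| < 1, the new circle still encloses the poles at \<open>a1\<close> and
      \<open>a2\<close>.\<close>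
    have big: "norm a1 < norm (a1 / r)" using a r by (simp add: norm_divide pos_less_divide_eq)
    have h: "A_integral I t (v * (a1 / r)) (a1 / (a1 / r)) (a2 / (a1 / r)) 0 = A_integral I t v a1 a2 0"
      by (rule A_integral_homogeneous) (use I t v a r big in auto)
    have e: "v * (a1 / r) = w / r" "a1 / (a1 / r) = r" "a2 / (a1 / r) = s * r"
      using a r by (simp_all add: w_def s_def)
    have "A_integral I t v a1 a2 0 = A_integral I t (w / r) r (s * r) 0" using h unfolding e by (rule sym)
    also have "\<dots> = A_integral I t (w / r) r (s * r) r * (\<Prod>i<card I. P (t ^ i * (r * r)) * P (t ^ i * (s * r * r)))"
      by (rule A_integral_b) (use t r s w I mult_norm_less_1(1)[OF s(2), of r] in auto)
    also have "(\<Prod>i<card I. P (t ^ i * (r * r)) * P (t ^ i * (s * r * r))) = (1 - r * r) * f r"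
    proof -
      have "(\<Prod>i<Suc m. P (t ^ i * (r * r))) = P (r * r) * (\<Prod>i<m. P (t ^ Suc i * (r * r)))"
        by (subst prod.lessThan_Suc_shift) simp
      then show ?thesis unfolding I(2) prod.distrib f_def by (simp only: P_rec[of "r * r"] mult.assoc)
    qed
    finally show ?thesis by (simp add: r_def mult_ac)
  qed
  have "(\<lambda>n. A_integral I t v a1 a2 0) \<longlonglongrightarrow> of_nat (Suc m) * c * d * f 1"
    using tendsto_mult[OF lim flim] by (simp only: eq[symmetric])
  then have "A_integral I t v a1 a2 0 = of_nat (Suc m) * c * d * f 1"
    by (rule LIMSEQ_unique[OF tendsto_const])
  also have "\<dots> = A_value (Suc m) t w (s * w)"
    unfolding A_value_Suc[OF t(2) s(2)] c_def d_def f_def by simp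
  finally show ?thesis by (simp add: sw) (simp add: w_def)
qed

lemma A_weight_commute: "A_weight I t v a1 a2 b z = A_weight I t v a2 a1 b z"
  by (simp add: A_weight_def A_single_def mult_ac)

lemma A_value_commute: "A_value n t x y = A_value n t y x"
  by (simp add: A_value_def mult_ac)

theorem A_integral_value:
  assumes t: "t \<noteq> 0" "norm t < 1"
  shows "finite I \<Longrightarrow> card I = n \<Longrightarrow> a1 \<noteq> 0 \<Longrightarrow> a2 \<noteq> 0 \<Longrightarrow> norm a1 < 1 \<Longrightarrow> norm a2 < 1 \<Longrightarrow> v \<noteq> 0 \<Longrightarrow>
    A_integral I t v a1 a2 0 = A_value n t (a1 * v) (a2 * v)"
proof (induction n arbitrary: I a1 a2 v)
  case 0
  then have "A_integral I t v a1 a2 0 = (\<integral>z. 1 \<partial>torus_measure {})" by (simp add: A_weight_def)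
  also have "\<dots> = 1" using emeasure_torus[of "{}"] by (simp add: measure_def)
  finally show ?case by (simp add: A_value_def)
next
  case (Suc m)
  note step = pinch_step[OF Suc.IH t Suc.prems(1,2)]
  have ne: "A_integral I t v a1 b 0 = A_value (Suc m) t (a1 * v) (b * v)" if "b \<noteq> 0" "norm b < norm a1" for b
    by (rule step) (use that Suc.prems in auto)
  consider "norm a2 < norm a1" | "norm a1 < norm a2" | "norm a1 = norm a2" by linarith
  then show ?case
  proof cases
    case 1
    then show ?thesis using ne Suc.prems by simp
  next
    case 2
    have "A_integral I t v a2 a1 0 = A_value (Suc m) t (a2 * v) (a1 * v)"
      by (rule step) (use 2 Suc.prems in auto)
    then show ?thesis by (simp only: A_weight_commute[of I t v a2] A_value_commute[of _ _ "a2 * v"])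
  next
    case 3
    \<comment> \<open>Equal moduli would give |s| = 1. Instead \<open>a2\<close> is approached by
      smaller multiples of itself, and both sides are continuous there.\<close>
    let ?b = "\<lambda>r. a2 * complex_of_real r"
    have b: "?b r \<noteq> 0" "norm (?b r) < 1" if "r \<in> {1/2..1}" for r
      using that Suc.prems mult_norm_less_1(1)[of a2 "of_real r"] by auto
    have "continuous_on ({1/2..1} \<times> torus I) (\<lambda>x. A_weight I t v a1 (?b (fst x)) 0 (snd x))"
      unfolding A_weight_eq
    proof (rule continuous_weight)
      show "norm (a1 * ?b (fst w) * t ^ (2 * card I - 2) * 0 * 0 * 0 * 0 / q) < 1" for w :: "real \<times> (nat \<Rightarrow> complex)" by simp
    qed (use b Suc.prems t in \<open>auto intro!: continuous_intros\<close>)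
    from torus_integral_tendsto[OF Suc.prems(1) compact_Icc this approach(1) _ approach(2)]
    have 1: "(\<lambda>n. A_integral I t v a1 (?b (approach n)) 0) \<longlonglongrightarrow> A_integral I t v a1 a2 0" by simp
    have "continuous_on {1/2..1} (\<lambda>r. A_value (Suc m) t (a1 * v) (?b r * v))"
      unfolding A_value_def
      by (intro continuous_intros) (use b Suc.prems t P_t_power_nz[OF t(2,2)] P_nonzero[OF q_less_1] in \<open>auto simp: mult.commute\<close>)
    from continuous_on_tendsto_compose[OF this approach(2)] approach(1)
    have 2: "(\<lambda>n. A_value (Suc m) t (a1 * v) (?b (approach n) * v)) \<longlonglongrightarrow> A_value (Suc m) t (a1 * v) (a2 * v)" by simp
    have "A_integral I t v a1 (?b (approach n)) 0 = A_value (Suc m) t (a1 * v) (?b (approach n) * v)" for n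
      by (rule ne) (use 3 approach_bounds[of n] b[OF approach(1)[of n]] approach(1)[of n] Suc.prems in \<open>auto simp: norm_mult\<close>)
    with 1 2 show ?thesis using LIMSEQ_unique by simp
  qed
qed

end

section \<open>Return to the parametrised torus and to the original parameters\<close>

lemma emeasure_circle_measure_lborel:
  assumes "A \<in> sets circle_measure"
  shows "circlepath 0 1 -` A \<inter> {0..1} \<in> sets lborel"
    and "emeasure circle_measure A = emeasure lborel (circlepath 0 1 -` A \<inter> {0..1})"
proof -
  have A: "A \<in> sets borel" using assms by (auto simp: sets_circle_measure sets_restrict_space_iff)
  have "circlepath 0 1 -` A \<inter> space borel \<in> sets borel" by (rule measurable_sets[OF circlepath_01_measurable A])
  then show m: "circlepath 0 1 -` A \<inter> {0..1} \<in> sets lborel" by auto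
  have "emeasure circle_measure A = (\<integral>\<^sup>+s. indicator (circlepath 0 1 -` A \<inter> {0..1}) s \<partial>lborel)"
    unfolding emeasure_circle_measure[OF assms] by (rule nn_integral_cong) (auto simp: indicator_def)
  then show "emeasure circle_measure A = emeasure lborel (circlepath 0 1 -` A \<inter> {0..1})"
    using m by simp
qed

text \<open>Comparison on boxes suffices. The restricted lambda in \<open>e\<close> supplies the
  value \<open>undefined\<close> that points of the torus have outside \<open>I\<close>.\<close>

lemma torus_measure_eq_distr:
  fixes I :: "nat set"
  assumes I: "finite I"
  defines "N \<equiv> restrict_space (PiM I (\<lambda>_. lborel)) (PiE I (\<lambda>_. {0..1}))"
  defines "e \<equiv> (\<lambda>s. \<lambda>i\<in>I. circlepath 0 1 (s i))"
  shows "e \<in> measurable N (torus_measure I)" "distr N (torus_measure I) e = torus_measure I"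
proof -
  interpret l: product_sigma_finite "\<lambda>_::nat. lborel :: real measure"
    by (simp add: product_sigma_finite_def lborel.sigma_finite_measure_axioms)
  let ?X = "PiE I (\<lambda>_. {0..1::real})"
  have X: "?X \<in> sets (PiM I (\<lambda>_. lborel))" using I by (intro sets_PiM_I_finite) auto
  show m: "e \<in> measurable N (torus_measure I)"
    unfolding e_def
  proof (rule measurable_restrict)
    fix i assume i: "i \<in> I"
    have "(\<lambda>s. s i) \<in> borel_measurable (PiM I (\<lambda>_. lborel :: real measure))"
      using measurable_component_singleton[OF i, of "\<lambda>_. lborel :: real measure"] by simp
    then have "(\<lambda>s. circlepath 0 1 (s i)) \<in> borel_measurable N"
      unfolding N_def by (intro measurable_restrict_space1 measurable_compose[OF _ circlepath_01_measurable])
    then have "(\<lambda>s. circlepath 0 1 (s i)) \<in> measurable N (restrict_space borel unit_circle)"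
      by (intro measurable_restrict_space2) auto
    then show "(\<lambda>s. circlepath 0 1 (s i)) \<in> measurable N circle_measure"
      by (simp add: measurable_cong_sets[OF refl sets_circle_measure])
  qed
  show "distr N (torus_measure I) e = torus_measure I"
  proof (rule circle.PiM_eqI[OF I])
    fix A assume A: "\<And>i. i \<in> I \<Longrightarrow> A i \<in> sets circle_measure"
    let ?B = "\<lambda>i. circlepath 0 1 -` A i \<inter> {0..1}"
    have eq: "e -` Pi\<^sub>E I A \<inter> space N = Pi\<^sub>E I ?B"
    proof -
      have "space N = ?X" using sets.sets_into_space[OF X] by (auto simp: N_def space_restrict_space)
      then show ?thesis by (auto simp: e_def PiE_iff)
    qed
    have "emeasure (distr N (torus_measure I) e) (Pi\<^sub>E I A) = emeasure N (Pi\<^sub>E I ?B)"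
      using A I by (subst emeasure_distr[OF m]) (auto intro!: sets_PiM_I_finite simp: eq)
    also have "\<dots> = emeasure (PiM I (\<lambda>_. lborel)) (Pi\<^sub>E I ?B)"
      unfolding N_def by (rule emeasure_restrict_space) (use X in \<open>auto simp: PiE_iff\<close>)
    also have "\<dots> = (\<Prod>i\<in>I. emeasure lborel (?B i))"
      by (rule l.emeasure_PiM[OF I emeasure_circle_measure_lborel(1)[OF A]])
    also have "\<dots> = (\<Prod>i\<in>I. emeasure circle_measure (A i))"
      by (intro prod.cong refl emeasure_circle_measure_lborel(2)[symmetric] A)
    finally show "emeasure (distr N (torus_measure I) e) (Pi\<^sub>E I A) = (\<Prod>i\<in>I. emeasure circle_measure (A i))" .
  qed simp
qed

lemma torus_integral_eq:
  assumes h: "continuous_on (torus {1..n}) h"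
    and f: "\<And>z. (\<And>i. i \<in> {1..n} \<Longrightarrow> norm (z i) = 1) \<Longrightarrow> f z = h (restrict z {1..n})"
  shows "torus_integral n f = integral\<^sup>L (torus_measure {1..n}) h"
proof -
  let ?X = "PiE {1..n} (\<lambda>_. {0..1::real})"
  let ?M = "PiM {1..n} (\<lambda>_. lborel :: real measure)"
  have X: "?X \<in> sets ?M" by (intro sets_PiM_I_finite) auto
  \<comment> \<open>Each coordinate of the pullback contributes the constant 2 pi i, and together
    they cancel the normalisation.\<close>
  have d: "vector_derivative (circlepath 0 1) (at x) / circlepath 0 1 x = 2 * of_real pi * \<i>" for x
    unfolding vector_derivative_circlepath by (simp add: circlepath)
  have "torus_integral n f = 1 / (2 * of_real pi * \<i>) ^ n * (LINT s : ?X | ?M. f (\<lambda>i. circlepath 0 1 (s i)) * (2 * of_real pi * \<i>) ^ n)"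
    unfolding torus_integral_def d by simp
  also have "\<dots> = (LINT s : ?X | ?M. f (\<lambda>i. circlepath 0 1 (s i)))"
    by simp
  also have "\<dots> = (LINT s : ?X | ?M. h (\<lambda>i\<in>{1..n}. circlepath 0 1 (s i)))"
    by (simp add: f)
  also have "\<dots> = (LINT s | restrict_space ?M ?X. h (\<lambda>i\<in>{1..n}. circlepath 0 1 (s i)))"
    unfolding set_lebesgue_integral_def by (subst integral_restrict_space) (use X sets.sets_into_space[OF X] in \<open>auto simp: Int_absorb2\<close>)
  also have "\<dots> = integral\<^sup>L (torus_measure {1..n}) h"
    using integral_distr[OF torus_measure_eq_distr(1)[of "{1..n}"] torus_measurable[OF h]] torus_measure_eq_distr(2)[of "{1..n}"] by simp
  finally show ?thesis .
qed

context nome begin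

lemma integral_weight:
  assumes t: "t \<noteq> 0" "norm t < 1" and a: "a1 \<noteq> 0" "a2 \<noteq> 0" "norm a1 < 1" "norm a2 < 1" and v: "v \<noteq> 0" and I: "finite I"
    and b: "norm b1 < 1" "norm b2 < 1" "norm b3 < 1" "norm b4 < 1" "b1 \<noteq> 0" "b2 \<noteq> 0" "b3 \<noteq> 0" "b4 \<noteq> 0"
    and E: "norm (a1 * a2 * t ^ (2 * card I - 2) * b1 * b2 * b3 * b4 / q) < 1"
  shows "(\<integral>z. weight I t v a1 a2 b1 b2 b3 b4 z \<partial>torus_measure I) =
    A_value (card I) t (a1 * v) (a2 * v) * b_ratio (card I) t a1 a2 b1 b2 b3 b4"
proof -
  have "(\<integral>z. weight I t v a1 a2 b1 b2 b3 b4 z \<partial>torus_measure I) / b_ratio (card I) t a1 a2 b1 b2 b3 b4 =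
    (\<integral>z. weight I t v a1 a2 0 0 0 0 z \<partial>torus_measure I) / b_ratio (card I) t a1 a2 0 0 0 0"
    using Gb_eq_0[OF t a v I b E] unfolding Gb_def[OF t a v I] .
  moreover have "b_ratio (card I) t a1 a2 0 0 0 0 = 1" by (simp add: b_ratio_def)
  moreover have "(\<integral>z. weight I t v a1 a2 0 0 0 0 z \<partial>torus_measure I) = A_value (card I) t (a1 * v) (a2 * v)"
    using A_integral_value[OF t I refl a v] by (simp add: A_weight_eq)
  moreover have "b_ratio (card I) t a1 a2 b1 b2 b3 b4 \<noteq> 0" by (rule b_ratio_nonzero[OF t a v I b(1-4) E])
  ultimately show ?thesis by (simp add: field_simps)
qed

lemma weight_restrict: "weight I t v a1 a2 b1 b2 b3 b4 (restrict z I) = weight I t v a1 a2 b1 b2 b3 b4 z"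
  unfolding weight_def Let_def by (intro arg_cong2[where f="(*)"] prod.cong refl) (auto simp: pairs_def)

end

theorem corollary1p3:
  fixes n :: nat and q \<epsilon> t v :: complex and a b :: "nat \<Rightarrow> complex"
  assumes "n \<ge> 1"
    and "q \<noteq> 0" and "norm q < 1"
    and "0 < norm \<epsilon>" and "norm \<epsilon> < 1"
    and "\<forall>i\<in>{1..2}. norm (a i) < 1"
    and "\<forall>j\<in>{1..4}. norm (b j) < 1"
    and "norm t < 1"
    and "q * \<epsilon>^2 = a 1 * a 2 * b 1 * b 2 * b 3 * b 4 * t ^ (2 * n - 2)"
    and "v \<noteq> 0"
  shows
    "1 / fact n * torus_integral n (\<lambda>z.
       (\<Prod>i=1..n.
          qpochs_inf [\<epsilon> * z i, - \<epsilon> * z i] q / qpochs_inf [q * \<epsilon> * z i, - q * \<epsilon> * z i] q *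
          (thetas [t ^ (n - 1) * a 1 * a 2 * v * inverse (z i), v * z i] q /
             (\<Prod>j=1..2. qpochs_inf [a j * \<epsilon>^2 * z i, a j * inverse (z i)] q)) *
          (\<Prod>k=1..4. qpoch_inf (q * inverse (b k) * \<epsilon>^2 * z i) q / qpoch_inf (b k * z i) q)) *
       (\<Prod>(j, k)\<in>{(j, k). 1 \<le> j \<and> j < k \<and> k \<le> n}.
          qpoch_inf (\<epsilon>^2 * z j * z k) q / qpoch_inf (q * \<epsilon>^2 * z j * z k) q *
          (qpochs_inf [z j / z k, z k / z j] q / qpochs_inf [t * z j / z k, t * z k / z j] q) *
          (qpoch_inf (q * inverse t * \<epsilon>^2 * z j * z k) q / qpoch_inf (t * \<epsilon>^2 * z j * z k) q)))
     = (\<Prod>i=1..n.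
          (qpoch_inf t q *
             (\<Prod>l=1..2. theta (t ^ (i - 1) * a l * v) q) *
             (\<Prod>(j, k)\<in>{(j, k). 1 \<le> j \<and> j < k \<and> k \<le> 4}.
                qpoch_inf (q * inverse (t ^ (i - 1)) * inverse (b j) * inverse (b k) * \<epsilon>^2) q)) /
          (qpochs_inf [q, t ^ i] q *
             qpoch_inf (t ^ (i - 1) * a 1 * a 2 * \<epsilon>^2) q *
             (\<Prod>j=1..2. \<Prod>k=1..4. qpoch_inf (t ^ (i - 1) * a j * b k) q)))"
    (is "1 / fact n * torus_integral n (?f t) = (\<Prod>i=1..n. ?R t i)")
proof -
  interpret nome q by unfold_locales (use assms in auto)
  have set2: "{1..2::nat} = {1, 2}" and set4: "{1..4::nat} = {1, 2, 3, 4}" by auto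
  have pairs4: "{(j, k). 1 \<le> j \<and> j < k \<and> k \<le> (4::nat)} = {(1,2),(1,3),(1,4),(2,3),(2,4),(3,4)}" by auto
  have pairsn: "{(j, k). 1 \<le> j \<and> j < k \<and> k \<le> n} = pairs {1..n}" by (auto simp: pairs_def)
  have an: "norm (a 1) < 1" "norm (a 2) < 1" using assms(6) unfolding set2 by simp_all
  have bn: "norm (b 1) < 1" "norm (b 2) < 1" "norm (b 3) < 1" "norm (b 4) < 1" using assms(7) unfolding set4 by simp_all
  have e0: "q * \<epsilon>^2 \<noteq> 0" using assms(2,4) by auto
  then have nz: "a 1 \<noteq> 0" "a 2 \<noteq> 0" "b 1 \<noteq> 0" "b 2 \<noteq> 0" "b 3 \<noteq> 0" "b 4 \<noteq> 0" unfolding assms(9) by auto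
  have \<epsilon>2: "norm (\<epsilon>^2) < 1" using assms(5) by (simp add: norm_power power_less_one_iff)
  \<comment> \<open>The parameter is called \<open>s\<close> because the case \<open>t = 0\<close>
    will use this at a different, nonzero value.\<close>
  have main: "1 / fact n * torus_integral n (?f s) = (\<Prod>i=1..n. ?R s i)"
    if s: "norm s < 1" "s \<noteq> 0" and bal: "q * \<epsilon>^2 = a 1 * a 2 * b 1 * b 2 * b 3 * b 4 * s ^ (2 * n - 2)" for s
  proof -
    define M where "M = a 1 * a 2 * s ^ (2 * n - 2)"
    have qE: "q * \<epsilon>^2 = M * b 1 * b 2 * b 3 * b 4" using bal by (simp add: M_def mult_ac)
    have E: "\<epsilon>^2 = M * b 1 * b 2 * b 3 * b 4 / q" using qE q_nz by (simp add: field_simps)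
    have m: "q * inverse s * \<epsilon>^2 = M * b 1 * b 2 * b 3 * b 4 / s" using qE by (simp add: field_simps)
    have c: "q * inverse (b 1) * \<epsilon>^2 = M * b 2 * b 3 * b 4" "q * inverse (b 2) * \<epsilon>^2 = M * b 1 * b 3 * b 4"
      "q * inverse (b 3) * \<epsilon>^2 = M * b 1 * b 2 * b 4" "q * inverse (b 4) * \<epsilon>^2 = M * b 1 * b 2 * b 3"
      using qE nz by (simp_all add: field_simps)
    have E1: "norm (a 1 * a 2 * s ^ (2 * card {1..n} - 2) * b 1 * b 2 * b 3 * b 4 / q) < 1"
      using \<epsilon>2[unfolded E M_def] by simp
    let ?h = "weight {1..n} s v (a 1) (a 2) (b 1) (b 2) (b 3) (b 4)"
    have f: "?f s z = ?h (restrict z {1..n})" if z: "\<And>i. i \<in> {1..n} \<Longrightarrow> norm (z i) = 1" for z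
      unfolding weight_restrict unfolding weight_def Let_def card_atLeastAtMost diff_Suc_1 pairsn
        M_def[symmetric] E[symmetric]
    proof (intro arg_cong2[where f="(*)"] prod.cong refl, goal_cases)
      case (1 i)
      \<comment> \<open>The bound |\<epsilon>| < 1 keeps the denominators nonzero, so
        \<open>P_1_minus\<close> reduces the quotients to polynomials.\<close>
      have n1: "norm (\<epsilon> * z i) < 1" "norm (- (\<epsilon> * z i)) < 1" using z[OF 1] assms(5) by (simp_all add: norm_mult)
      have "qpochs_inf [\<epsilon> * z i, - \<epsilon> * z i] q / qpochs_inf [q * \<epsilon> * z i, - q * \<epsilon> * z i] q =
         (P (\<epsilon> * z i) / P (q * (\<epsilon> * z i))) * (P (- (\<epsilon> * z i)) / P (q * (- (\<epsilon> * z i))))"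
        by (simp add: qpochs_inf_def mult.assoc)
      also have "\<dots> = 1 - \<epsilon>^2 * (z i)^2"
        unfolding P_1_minus[OF n1(1)] P_1_minus[OF n1(2)] by (simp add: algebra_simps power2_eq_square)
      finally show ?case
        unfolding set2 set4 single_weight_def c[symmetric] by (simp add: qpochs_inf_def thetas_def divide_inverse mult.assoc)
    next
      case (2 p)
      then obtain j k where p: "p = (j, k)" "j \<in> {1..n}" "k \<in> {1..n}" by (auto simp: pairs_def)
      then have n1: "norm (\<epsilon>^2 * z j * z k) < 1" using z \<epsilon>2 by (simp add: norm_mult)
      have w: "qpoch_inf (\<epsilon>^2 * z j * z k) q / qpoch_inf (q * \<epsilon>^2 * z j * z k) q = 1 - \<epsilon>^2 * z j * z k"
        using P_1_minus[OF n1] by (simp only: mult.assoc)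
      show ?case unfolding p(1) case_prod_conv w m pair_weight_def by (simp add: qpochs_inf_def)
    qed
    have cont: "continuous_on (torus {1..n}) ?h"
      by (rule continuous_weight) (use an bn nz s assms(10) E1 in \<open>auto intro!: continuous_intros\<close>)
    have u: "1 / fact n * (fact n * x * y) = x * y" for x y :: complex by simp
    have "1 / fact n * torus_integral n (?f s) = 1 / fact n * integral\<^sup>L (torus_measure {1..n}) ?h"
      by (simp only: torus_integral_eq[OF cont f])
    also have "\<dots> = 1 / fact n * (A_value n s (a 1 * v) (a 2 * v) * b_ratio n s (a 1) (a 2) (b 1) (b 2) (b 3) (b 4))"
      using integral_weight[OF s(2,1) nz(1,2) an assms(10) _ bn nz(3-6) E1] by simp
    also have "\<dots> = (\<Prod>i<n. ?R s (Suc i))"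
      unfolding A_value_def b_ratio_def Let_def M_def[symmetric] E[symmetric] u prod.distrib[symmetric]
    proof (rule prod.cong[OF refl], goal_cases)
      case (1 i)
      have pc: "q * inverse (s ^ i) * inverse (b 1) * inverse (b 2) * \<epsilon>^2 = M * (1 / s) ^ i * b 3 * b 4"
        "q * inverse (s ^ i) * inverse (b 1) * inverse (b 3) * \<epsilon>^2 = M * (1 / s) ^ i * b 2 * b 4"
        "q * inverse (s ^ i) * inverse (b 1) * inverse (b 4) * \<epsilon>^2 = M * (1 / s) ^ i * b 2 * b 3"
        "q * inverse (s ^ i) * inverse (b 2) * inverse (b 3) * \<epsilon>^2 = M * (1 / s) ^ i * b 1 * b 4"
        "q * inverse (s ^ i) * inverse (b 2) * inverse (b 4) * \<epsilon>^2 = M * (1 / s) ^ i * b 1 * b 3"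
        "q * inverse (s ^ i) * inverse (b 3) * inverse (b 4) * \<epsilon>^2 = M * (1 / s) ^ i * b 1 * b 2"
        using qE nz s by (simp_all add: power_one_over field_simps)
      show ?case
        unfolding set2 set4 pairs4 diff_Suc_1 pc[symmetric] by (simp add: qpochs_inf_def mult_ac)
    qed
    also have "\<dots> = (\<Prod>i=1..n. ?R s i)"
      unfolding One_nat_def by (rule prod.atLeast1_atMost_eq[symmetric])
    finally show ?thesis .
  qed
  show ?thesis
  proof (cases "t = 0")
    case False
    then show ?thesis by (rule main[OF assms(8) _ assms(9)])
  next
    case True
    \<comment> \<open>The left-hand side of the balancing condition is nonzero, so
      \<open>0 ^ (2 * n - 2)\<close> must be 1 and not 0.\<close>
    have n: "n = 1"
      using assms(1) e0[unfolded assms(9) True] by (cases "n = 1") (auto simp: power_0_left)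
    have none: "{(j, k). 1 \<le> j \<and> j < k \<and> k \<le> (1::nat)} = {}" by auto
    \<comment> \<open>For \<open>n = 1\<close> the balancing condition is free of \<open>t\<close>,
      and both sides contain \<open>t\<close> only through the quotient of \<open>P t\<close> by
      \<open>P (t ^ 1)\<close>, which is 1. The value 1/2 therefore settles the case
      \<open>t = 0\<close>.\<close>
    have half: "norm (1 / 2 :: complex) < 1" "(1 / 2 :: complex) \<noteq> 0" by simp_all
    have P2: "P (1 / 2) \<noteq> 0" by (rule P_nonzero[OF half(1)])
    have cancel: "(c * x * y) / ((d * c) * u * w) = (x * y) / (d * u * w)" if "c \<noteq> 0" for c d x y u w :: complex
      using that by (simp add: mult_ac)
    show ?thesis
      using main[OF half] assms(9) unfolding True n none by (simp add: qpochs_inf_def cancel[OF P2])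
  qed
qed

end
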